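(* Let $d>1$ and define the Hermite gradient $\nabla_Hf=(A_{-d}f,\dots,A_{-1}f,A_1f,\dots,A_df)$. Let $1<p,q<\infty$ with $\frac1p-\frac1d\le\frac1q<\frac1p+\frac1d$. Then there is a constant $C$ such that $$\|f\|_q\le C\,\|\nabla_Hf\|_{L^p_{\mathbb{R}^{2d}}}$$ for all $f\in\mathfrak{L}^p_1$, where $\|\nabla_Hf\|_{L^p_{\mathbb{R}^{2d}}}$ denotes the $L^p(\mathbb{R}^d)$ norm of the $\mathbb{R}^{2d}$-valued (Euclidean-norm) function $\nabla_Hf$.
   Context: $H=-\Delta+|x|^2$ on $\mathbb{R}^d$; for $1\le j\le d$, $A_j=\partial/\partial x_j+x_j$ and $A_{-j}=-\partial/\partial x_j+x_j$ (distributional derivatives). For $s>0$, $H^{-s}$ is the operator on $L^p(\mathbb{R}^d)$ given by $H^{-s}f(x)=\int K_s(x,y)f(y)\,dy$, $K_s(x,y)=\frac{1}{\Gamma(s)}\int_0^\infty G_t(x,y)t^{s-1}dt$, $G_t(x,y)=(2\pi\sinh 2t)^{-d/2}\exp(-\frac12|x-y|^2\coth 2t-x\cdot y\tanh t)$; it satisfies $H^{-s}h_\alpha=(2|\alpha|+d)^{-s}h_\alpha$ on Hermite functions and is one-to-one. $\mathfrak{L}^p_1=H^{-1/2}(L^p(\mathbb{R}^d))$ with norm $\|f\|_{\mathfrak{L}^p_1}=\|g\|_p$ where $H^{-1/2}g=f$. *)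

theory Defs
  imports "HOL-Analysis.Analysis"
begin

(* An L^p class is handled through its representatives; identities between elements of L^p
   are stated almost everywhere. *)

definition Lp_norm :: "real \<Rightarrow> ('a::euclidean_space \<Rightarrow> 'b::real_normed_vector) \<Rightarrow> ennreal"
  where "Lp_norm p f =
    (let I = (\<integral>\<^sup>+ x. ennreal (norm (f x) powr p) \<partial>lebesgue)
     in if I = \<infinity> then \<infinity> else ennreal (enn2real I powr (1 / p)))"

definition Lp :: "real \<Rightarrow> ('a::euclidean_space \<Rightarrow> 'b::real_normed_vector) set"
  where "Lp p = {f \<in> borel_measurable lebesgue. Lp_norm p f < \<infinity>}"

definition partial_deriv :: "'n \<Rightarrow> (real ^ 'n::finite \<Rightarrow> real) \<Rightarrow> real ^ 'n \<Rightarrow> real"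
  where "partial_deriv j \<phi> x = frechet_derivative \<phi> (at x) (axis j 1)"

primrec C_diff :: "nat \<Rightarrow> (real ^ 'n::finite \<Rightarrow> real) \<Rightarrow> bool"
  where
    "C_diff 0 \<phi> \<longleftrightarrow> continuous_on UNIV \<phi>"
  | "C_diff (Suc k) \<phi> \<longleftrightarrow>
       (\<forall>x. \<phi> differentiable (at x)) \<and> (\<forall>j. C_diff k (partial_deriv j \<phi>))"

definition test_function :: "(real ^ 'n::finite \<Rightarrow> real) \<Rightarrow> bool"
  where "test_function \<phi> \<longleftrightarrow> (\<forall>k. C_diff k \<phi>) \<and> compact (closure (support_on UNIV \<phi>))"

(* A distribution is a functional of which only the values on test functions matter. *)

type_synonym 'n distr = "(real ^ 'n \<Rightarrow> real) \<Rightarrow> real"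

definition distr_of :: "(real ^ 'n::finite \<Rightarrow> real) \<Rightarrow> 'n distr"
  where "distr_of f \<phi> = (LINT x|lebesgue. f x * \<phi> x)"

definition distr_partial :: "'n::finite \<Rightarrow> 'n distr \<Rightarrow> 'n distr"
  where "distr_partial j T \<phi> = - T (partial_deriv j \<phi>)"

definition distr_coord_mult :: "'n::finite \<Rightarrow> 'n distr \<Rightarrow> 'n distr"
  where "distr_coord_mult j T \<phi> = T (\<lambda>x. x $ j * \<phi> x)"

definition A_plus :: "'n::finite \<Rightarrow> 'n distr \<Rightarrow> 'n distr"
  where "A_plus j T \<phi> = distr_partial j T \<phi> + distr_coord_mult j T \<phi>"

definition A_minus :: "'n::finite \<Rightarrow> 'n distr \<Rightarrow> 'n distr"
  where "A_minus j T \<phi> = - distr_partial j T \<phi> + distr_coord_mult j T \<phi>"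

(* The 2d components are indexed by the sum type: Inl j carries A_{-j} and Inr j carries A_j. *)

definition hermite_gradient :: "(real ^ 'n::finite \<Rightarrow> real) \<Rightarrow> 'n + 'n \<Rightarrow> 'n distr"
  where "hermite_gradient f k =
    (case k of Inl j \<Rightarrow> A_minus j (distr_of f) | Inr j \<Rightarrow> A_plus j (distr_of f))"

(* L^p norm of a vector of distributions: the norm of the L^p function representing it, which is
   unique up to null sets, and infinity (the infimum of the empty set) if there is none. *)

definition distr_Lp_norm :: "real \<Rightarrow> ('m::finite \<Rightarrow> 'n::finite distr) \<Rightarrow> ennreal"
  where "distr_Lp_norm p T =
    (INF G \<in> {G :: real ^ 'n \<Rightarrow> real ^ 'm. G \<in> Lp p \<and>
        (\<forall>k \<phi>. test_function \<phi> \<longrightarrow> T k \<phi> = distr_of (\<lambda>x. G x $ k) \<phi>)}. Lp_norm p G)"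

definition hermite_heat_kernel :: "real \<Rightarrow> real ^ 'n::finite \<Rightarrow> real ^ 'n \<Rightarrow> real"
  where "hermite_heat_kernel t x y =
    (2 * pi * sinh (2 * t)) powr (- real CARD('n) / 2) *
    exp (- (1 / 2) * (norm (x - y))\<^sup>2 * (cosh (2 * t) / sinh (2 * t)) - (x \<bullet> y) * tanh t)"

(* For s <= d / 2 the integral diverges on the diagonal x = y, where the Bochner integral is 0;
   this does not affect the operator below. *)

definition hermite_power_kernel :: "real \<Rightarrow> real ^ 'n::finite \<Rightarrow> real ^ 'n \<Rightarrow> real"
  where "hermite_power_kernel s x y =
    1 / Gamma s * (LINT t:{0<..}|lborel. hermite_heat_kernel t x y * t powr (s - 1))"

definition hermite_neg_power :: "real \<Rightarrow> (real ^ 'n::finite \<Rightarrow> real) \<Rightarrow> real ^ 'n \<Rightarrow> real"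
  where "hermite_neg_power s f x = (LINT y|lebesgue. hermite_power_kernel s x y * f y)"

definition hermite_sobolev :: "real \<Rightarrow> (real ^ 'n::finite \<Rightarrow> real) set"
  where "hermite_sobolev p =
    {f. \<exists>g \<in> Lp p. AE x in lebesgue. f x = hermite_neg_power (1 / 2) g x}"

end

theory Submission
  imports Defs
begin

text \<open>
  The components of the Hermite gradient \<open>G\<close> satisfy \<open>A_j f + A_{-j} f = 2 x_j f\<close> and
  \<open>A_j f - A_{-j} f = 2 \<partial>_j f\<close>, so \<open>|x| |f|\<close> and the weak gradient of \<open>f\<close> are both bounded by a
  multiple of \<open>|G|\<close>, and the claim is a Sobolev inequality with weight; no Riesz transforms enter.
  The a priori knowledge \<open>f = H^{-1/2} g\<close> is only used to see that \<open>f\<close> is locally integrable.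

  For the Sobolev inequality, averaging \<open>v(x) = v(x + w) - \<integral>\<^sub>0\<^sup>1 w \<cdot> \<nabla>v(x + rw) dr\<close> over the unit ball
  and cutting the integral at \<open>r = R\<close> gives a weak-type estimate: the part \<open>r < R\<close> has \<open>L^p\<close> norm
  \<open>O(R)\<close>, the rest is pointwise \<open>O(R^{-\<delta>})\<close>. Truncation of \<open>v\<close> at all levels (Maz'ya) upgrades it to the
  strong type, including the endpoint \<open>1/q = 1/p - 1/d\<close>. The \<open>L^p\<close> norm of \<open>f\<close> near the origin is
  recovered by moving along a line segment to a region where \<open>|f| \<le> |x| |f|\<close>; the exponents \<open>q < p\<close>
  follow from the \<open>L^p\<close> bound on \<open>(1 + |x|) f\<close> and the integrability of \<open>(1 + |x|)^{-r}\<close> for \<open>r > d\<close>.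
\<close>

section \<open>Integral inequalities\<close>

text \<open>The Sobolev argument follows values along line segments, but \<open>f\<close> has only
  weak derivatives. All estimates are therefore proved for C^1 functions, applied to mollifications
  with constants independent of the mollification scale, and carried over to \<open>f\<close> by
  Fatou's lemma. The bound on |x| |f| dominates |f| only away from the origin and is blurred by
  mollification; hence the comparison |u| <= g is required only for |x| >= 2. Cleared of
  denominators, the conditions on the exponents are d (q - p) <= p q for p <= q, and p q / (p - q) >
  d for q < p. For p < q the decay exponent of the far part is \<delta> = p / (q - p). It equals d/p
  - 1 at the endpoint and is larger for smaller q, which is possible because only segments of length
  at most 1 are used. Truncation works because the C^1 class is stable under it, with the dominating
  function cut down to one band of levels. The recurring factors 2^p come from absorbing half of the
  left side in an additive form of Hoelder's inequality.\<close>

lemma nn_integral_lborel_affine: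
  fixes f :: "'a::euclidean_space \<Rightarrow> ennreal"
  assumes [measurable]: "f \<in> borel_measurable borel" and c: "c \<noteq> 0"
  shows "(\<integral>\<^sup>+x. f x \<partial>lborel) = ennreal (\<bar>c\<bar> ^ DIM('a)) * (\<integral>\<^sup>+x. f (t + c *\<^sub>R x) \<partial>lborel)"
proof -
  have "(\<integral>\<^sup>+x. f x \<partial>lborel) =
      (\<integral>\<^sup>+x. f x \<partial>density (distr lborel borel (\<lambda>x. t + c *\<^sub>R x)) (\<lambda>_. ennreal (\<bar>c\<bar> ^ DIM('a))))"
    using lborel_affine[OF c, of t] by simp
  also have "\<dots> = ennreal (\<bar>c\<bar> ^ DIM('a)) * (\<integral>\<^sup>+x. f (t + c *\<^sub>R x) \<partial>lborel)"
    by (simp add: nn_integral_density nn_integral_distr nn_integral_cmult)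
  finally show ?thesis .
qed

lemma nn_integral_lborel_translate:
  fixes f :: "'a::euclidean_space \<Rightarrow> ennreal"
  assumes "f \<in> borel_measurable borel"
  shows "(\<integral>\<^sup>+x. f (x + t) \<partial>lborel) = (\<integral>\<^sup>+x. f x \<partial>lborel)"
  using nn_integral_lborel_affine[OF assms, of 1 t] by (simp add: add.commute)

lemma nn_integral_lborel_reflect:
  fixes f :: "'a::euclidean_space \<Rightarrow> ennreal"
  assumes "f \<in> borel_measurable borel"
  shows "(\<integral>\<^sup>+x. f (t - x) \<partial>lborel) = (\<integral>\<^sup>+x. f x \<partial>lborel)"
  using nn_integral_lborel_affine[OF assms, of "-1" t] by simp

abbreviation powr_int :: "real \<Rightarrow> ('a::euclidean_space \<Rightarrow> real) \<Rightarrow> ennreal"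
  where "powr_int p f \<equiv> \<integral>\<^sup>+x. ennreal (f x powr p) \<partial>lborel"

abbreviation abs_powr_int :: "real \<Rightarrow> ('a::euclidean_space \<Rightarrow> real) \<Rightarrow> ennreal"
  where "abs_powr_int p f \<equiv> \<integral>\<^sup>+x. ennreal (\<bar>f x\<bar> powr p) \<partial>lborel"

text \<open>Integrated and optimised over \<open>s\<close>, this is Hoelder's inequality up to a constant factor.\<close>

lemma le_add_scaled_powr:
  fixes p s t :: real
  assumes "p \<ge> 1" "s > 0" "t \<ge> 0"
  shows "t \<le> s + s powr (1 - p) * t powr p"
proof (cases "t \<le> s")
  case True
  then show ?thesis by (simp add: add_increasing2)
next
  case False
  then have "t powr (1 - p) \<le> s powr (1 - p)"
    using assms by (intro powr_mono2') auto
  then have "t powr (1 - p) * t powr p \<le> s powr (1 - p) * t powr p"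
    by (intro mult_right_mono) auto
  moreover have "t powr (1 - p) * t powr p = t"
    using False assms by (simp flip: powr_add)
  ultimately show ?thesis using assms by linarith
qed

lemma nn_integral_le_powr:
  assumes g[measurable]: "g \<in> borel_measurable M" "\<And>x. g x \<ge> (0::real)"
    and p: "p \<ge> 1" and s: "s > 0"
  shows "(\<integral>\<^sup>+x. ennreal (g x) \<partial>M) \<le>
    ennreal s * emeasure M (space M) + ennreal (s powr (1 - p)) * (\<integral>\<^sup>+x. ennreal (g x powr p) \<partial>M)"
proof -
  have "(\<integral>\<^sup>+x. ennreal (g x) \<partial>M) \<le>
      (\<integral>\<^sup>+x. ennreal s + ennreal (s powr (1 - p)) * ennreal (g x powr p) \<partial>M)"
  proof (intro nn_integral_mono)
    fix x
    show "ennreal (g x) \<le> ennreal s + ennreal (s powr (1 - p)) * ennreal (g x powr p)"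
      using le_add_scaled_powr[OF p s, of "g x"] g(2)[of x] s
      by (simp flip: ennreal_mult' ennreal_plus)
  qed
  also have "\<dots> = ennreal s * emeasure M (space M) +
      ennreal (s powr (1 - p)) * (\<integral>\<^sup>+x. ennreal (g x powr p) \<partial>M)"
    by (simp add: nn_integral_add nn_integral_cmult)
  finally show ?thesis .
qed

text \<open>Jensen's inequality for a measure of mass at most \<open>m\<close>, with an extra factor
  \<open>2 powr p\<close>. Only a lower bound \<open>b\<close> of the integral enters, so the
  integral itself may be infinite.\<close>

lemma powr_le_nn_integral:
  assumes g[measurable]: "g \<in> borel_measurable M" "\<And>x. g x \<ge> (0::real)"
    and p: "p \<ge> 1" and m: "m > 0" "emeasure M (space M) \<le> ennreal m"
    and b: "b \<ge> 0" "ennreal b \<le> (\<integral>\<^sup>+x. ennreal (g x) \<partial>M)"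
  shows "ennreal (b powr p) \<le>
    ennreal (2 powr p * m powr (p - 1)) * (\<integral>\<^sup>+x. ennreal (g x powr p) \<partial>M)" (is "_ \<le> _ * ?I")
proof (cases "b = 0 \<or> ?I = \<infinity>")
  case True
  then show ?thesis
    using m p by (auto simp: ennreal_mult_top)
next
  case False
  then obtain i where i: "?I = ennreal i" "i \<ge> 0" by (cases ?I) auto
  \<comment> \<open>For this \<open>s\<close> the first term \<open>s * m\<close> is half of
    \<open>b\<close> and can be absorbed on the left.\<close>
  define s where "s = b / (2 * m)"
  have s: "s > 0" using False b m by (simp add: s_def)
  have "ennreal b \<le> ennreal s * ennreal m + ennreal (s powr (1 - p)) * ennreal i"
    using b(2) nn_integral_le_powr[OF g p s] mult_left_mono[OF m(2), of "ennreal s"] i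
    by (metis add_right_mono order_trans zero_le)
  also have "\<dots> = ennreal (s * m + s powr (1 - p) * i)"
    using s m i by (simp add: ennreal_mult')
  finally have "b \<le> s * m + s powr (1 - p) * i"
    using s m i by (subst (asm) ennreal_le_iff) auto
  then have "b / 2 \<le> s powr (1 - p) * i" using m by (simp add: s_def)
  then have "s powr (p - 1) * (b / 2) \<le> s powr (p - 1) * (s powr (1 - p) * i)"
    by (intro mult_left_mono) auto
  also have "\<dots> = i" using s by (simp flip: powr_add mult.assoc)
  finally have *: "s powr (p - 1) * (b / 2) \<le> i" .
  have "b powr p = 2 powr p * m powr (p - 1) * (s powr (p - 1) * (b / 2))"
    using b False m p by (simp add: s_def powr_divide powr_mult powr_diff field_simps)
  also have "\<dots> \<le> 2 powr p * m powr (p - 1) * i"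
    using * by (intro mult_left_mono) auto
  finally show ?thesis using i by (simp flip: ennreal_mult'' add: ennreal_leI)
qed

text \<open>Derivatives occur only along lines: \<open>v' x w\<close> is the derivative at
  \<open>x\<close> in direction \<open>w\<close>, and its continuity in \<open>x\<close> serves the
  fundamental theorem of calculus. The bound \<open>g\<close> is merely measurable because
  truncation cuts it off sharply at level sets.\<close>

definition C1_dominated :: "('a::euclidean_space \<Rightarrow> real) \<Rightarrow> ('a \<Rightarrow> real) \<Rightarrow> bool"
  where "C1_dominated v g \<longleftrightarrow> continuous_on UNIV v \<and> g \<in> borel_measurable borel \<and> (\<forall>x. g x \<ge> 0) \<and>
    (\<exists>v'. (\<forall>x w r. ((\<lambda>r. v (x + r *\<^sub>R w)) has_real_derivative v' (x + r *\<^sub>R w) w) (at r)) \<and>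
      (\<forall>w. continuous_on UNIV (\<lambda>x. v' x w)) \<and> (\<forall>x w. norm w \<le> 1 \<longrightarrow> \<bar>v' x w\<bar> \<le> g x))"

lemma C1_dominated_measurable:
  assumes "C1_dominated v g"
  shows "v \<in> borel_measurable borel" "g \<in> borel_measurable borel" "g x \<ge> 0"
  using assms by (auto simp: C1_dominated_def intro: borel_measurable_continuous_onI)

lemma C1_dominated_line:
  assumes dom: "C1_dominated v g" and w: "norm w \<le> 1" and R: "R \<ge> 0"
  shows "ennreal \<bar>v (x + R *\<^sub>R w) - v x\<bar> \<le>
    (\<integral>\<^sup>+r. ennreal (g (x + r *\<^sub>R w)) * indicator {0..R} r \<partial>lborel)"
proof -
  obtain v' where
    der: "\<And>x w r. ((\<lambda>r. v (x + r *\<^sub>R w)) has_real_derivative v' (x + r *\<^sub>R w) w) (at r)"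
    and cont: "\<And>w. continuous_on UNIV (\<lambda>x. v' x w)" and bnd: "\<And>x w. norm w \<le> 1 \<Longrightarrow> \<bar>v' x w\<bar> \<le> g x"
    using dom unfolding C1_dominated_def by blast
  let ?f = "\<lambda>r. v' (x + r *\<^sub>R w) w"
  have contf: "continuous_on A ?f" for A
    by (rule continuous_on_compose2[OF cont]) (auto intro!: continuous_intros)
  have "(LINT r|lborel. indicator {0..R} r *\<^sub>R ?f r) = v (x + R *\<^sub>R w) - v (x + 0 *\<^sub>R w)"
    using R
    by (intro integral_FTC_Icc)
      (auto intro: contf has_field_derivative_at_within der
        simp flip: has_real_derivative_iff_has_vector_derivative)
  moreover have "integrable lborel (\<lambda>r. indicator {0..R} r *\<^sub>R ?f r)"
    using borel_integrable_atLeastAtMost'[OF contf] by (simp add: set_integrable_def)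
  ultimately have "ennreal \<bar>v (x + R *\<^sub>R w) - v x\<bar> \<le> (\<integral>\<^sup>+r. ennreal (norm (indicator {0..R} r *\<^sub>R ?f r)) \<partial>lborel)"
    using integral_norm_bound_ennreal[of lborel "\<lambda>r. indicator {0..R} r *\<^sub>R ?f r"] by simp
  also have "\<dots> \<le> (\<integral>\<^sup>+r. ennreal (g (x + r *\<^sub>R w)) * indicator {0..R} r \<partial>lborel)"
    using bnd[OF w] by (intro nn_integral_mono) (auto simp: indicator_def ennreal_leI)
  finally show ?thesis .
qed

text \<open>The two parts are left in different orders of integration on purpose. The near part
  \<open>r <= R\<close> will be integrated over \<open>x\<close> as a whole, whereas the far part
  needs, for each fixed \<open>r\<close>, a bound on the integral over the ball.\<close>

lemma C1_dominated_ball_average: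
  fixes v :: "'a::euclidean_space \<Rightarrow> real"
  assumes dom: "C1_dominated v g" and R: "0 \<le> R" "R \<le> 1"
  shows "ennreal (unit_ball_vol (real DIM('a)) * \<bar>v x\<bar>) \<le>
    (\<integral>\<^sup>+w. indicator (cball 0 1) w * (\<integral>\<^sup>+r. ennreal (g (x + r *\<^sub>R w)) * indicator {0..R} r \<partial>lborel) \<partial>lborel) +
    (\<integral>\<^sup>+r. indicator {R..1} r * (\<integral>\<^sup>+w. ennreal (g (x + r *\<^sub>R w)) * indicator (cball 0 1) w \<partial>lborel) \<partial>lborel) +
    (\<integral>\<^sup>+w. ennreal \<bar>v (x + w)\<bar> * indicator (cball 0 1) w \<partial>lborel)"
proof -
  note [measurable] = C1_dominated_measurable[OF dom]
  let ?B = "cball 0 1 :: 'a set"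
  let ?G = "\<lambda>w r. ennreal (g (x + r *\<^sub>R w))"
  let ?N = "\<lambda>w. \<integral>\<^sup>+r. ?G w r * indicator {0..R} r \<partial>lborel"
  let ?F = "\<lambda>w. \<integral>\<^sup>+r. ?G w r * indicator {R..1} r \<partial>lborel"
  have [measurable]: "?B \<in> sets borel"
    by simp
  have m[measurable]: "(\<lambda>w. \<integral>\<^sup>+r. ?G w r * indicator {a..b} r \<partial>lborel) \<in> borel_measurable borel" for a b
    by measurable
  have "ennreal (unit_ball_vol (real DIM('a)) * \<bar>v x\<bar>) = (\<integral>\<^sup>+w. ennreal \<bar>v x\<bar> * indicator ?B w \<partial>lborel)"
    by (subst nn_integral_cmult_indicator) (auto simp: emeasure_cball ennreal_mult' mult.commute)
  also have "\<dots> \<le> (\<integral>\<^sup>+w. indicator ?B w * ?N w +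
      indicator ?B w * ?F w +
      ennreal \<bar>v (x + w)\<bar> * indicator ?B w \<partial>lborel)"
  proof (intro nn_integral_mono)
    fix w :: 'a
    show "ennreal \<bar>v x\<bar> * indicator ?B w \<le> indicator ?B w * ?N w +
      indicator ?B w * ?F w +
      ennreal \<bar>v (x + w)\<bar> * indicator ?B w"
    proof (cases "w \<in> ?B")
      case True
      then have "ennreal \<bar>v (x + 1 *\<^sub>R w) - v x\<bar> \<le> (\<integral>\<^sup>+r. ?G w r * indicator {0..1} r \<partial>lborel)"
        by (intro C1_dominated_line[OF dom]) auto
      also have "\<dots> \<le> (\<integral>\<^sup>+r. ?G w r * indicator {0..R} r + ?G w r * indicator {R..1} r \<partial>lborel)"
        using R by (intro nn_integral_mono) (auto simp: indicator_def)
      also have "\<dots> = ?N w + ?F w"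
        by (intro nn_integral_add) auto
      finally have "ennreal \<bar>v (x + w) - v x\<bar> + ennreal \<bar>v (x + w)\<bar> \<le>
          ?N w + ?F w +
          ennreal \<bar>v (x + w)\<bar>"
        by (intro add_right_mono) simp
      moreover have "ennreal \<bar>v x\<bar> \<le> ennreal \<bar>v (x + w) - v x\<bar> + ennreal \<bar>v (x + w)\<bar>"
        by (simp flip: ennreal_plus)
      ultimately have "ennreal \<bar>v x\<bar> \<le> ?N w +
          ?F w + ennreal \<bar>v (x + w)\<bar>"
        by (rule order_trans[rotated])
      then show ?thesis using True by simp
    qed auto
  qed
  also have "\<dots> = (\<integral>\<^sup>+w. indicator ?B w * ?N w \<partial>lborel) +
      (\<integral>\<^sup>+w. indicator ?B w * ?F w \<partial>lborel) +
      (\<integral>\<^sup>+w. ennreal \<bar>v (x + w)\<bar> * indicator ?B w \<partial>lborel)"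
    by (subst nn_integral_add; (subst nn_integral_add)?; simp add: m)
  also have "(\<integral>\<^sup>+w. indicator ?B w * ?F w \<partial>lborel) =
      (\<integral>\<^sup>+w. \<integral>\<^sup>+r. indicator ?B w * (?G w r * indicator {R..1} r) \<partial>lborel \<partial>lborel)"
    by (simp add: nn_integral_cmult)
  also have "\<dots> = (\<integral>\<^sup>+r. \<integral>\<^sup>+w. indicator ?B w * (?G w r * indicator {R..1} r) \<partial>lborel \<partial>lborel)"
    by (rule lborel_pair.Fubini') simp
  also have "\<dots> = (\<integral>\<^sup>+r. \<integral>\<^sup>+w. indicator {R..1} r * (?G w r * indicator ?B w) \<partial>lborel \<partial>lborel)"
    by (simp add: mult_ac)
  also have "\<dots> = (\<integral>\<^sup>+r. indicator {R..1} r * (\<integral>\<^sup>+w. ?G w r * indicator ?B w \<partial>lborel) \<partial>lborel)"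
    by (simp add: nn_integral_cmult)
  finally show ?thesis .
qed

text \<open>Hoelder's inequality on the ball of radius \<open>r\<close> about \<open>x\<close>,
  rescaled to the unit ball; the scaling produces the power of \<open>r\<close>.\<close>

lemma ball_integral_le:
  fixes g :: "'a::euclidean_space \<Rightarrow> real"
  assumes [measurable]: "g \<in> borel_measurable borel" and g: "\<And>x. g x \<ge> 0"
    and p: "p \<ge> 1" and M: "M > 0" and r: "r > 0"
    and int: "powr_int p g \<le> ennreal (M powr p)"
  shows "(\<integral>\<^sup>+w. ennreal (g (x + r *\<^sub>R w)) * indicator (cball 0 1) w \<partial>lborel) \<le>
    ennreal ((unit_ball_vol (real DIM('a)) + 1) * r powr (- real DIM('a) / p) * M)"
proof -
  let ?B = "cball 0 1 :: 'a set" and ?d = "real DIM('a)"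
  let ?m = "restrict_space lborel ?B"
  \<comment> \<open>Chosen so that \<open>s powr p\<close> is the bound for the rescaled L^p
    integral. Both terms of \<open>nn_integral_le_powr\<close> then become multiples of
    \<open>s\<close>, with factors the ball volume and 1.\<close>
  define s where "s = r powr (- ?d / p) * M"
  have s: "s > 0" using M r by (simp add: s_def)
  have "powr_int p g = ennreal (r ^ DIM('a)) * (\<integral>\<^sup>+w. ennreal (g (x + r *\<^sub>R w) powr p) \<partial>lborel)"
    using nn_integral_lborel_affine[of "\<lambda>x. ennreal (g x powr p)" r x] r by simp
  then have "ennreal (r powr (- ?d)) * ennreal (r powr ?d) * (\<integral>\<^sup>+w. ennreal (g (x + r *\<^sub>R w) powr p) \<partial>lborel) \<le>
      ennreal (r powr (- ?d)) * ennreal (M powr p)"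
    using int r by (simp add: powr_realpow mult.assoc mult_left_mono)
  moreover have "ennreal (r powr (- ?d)) * ennreal (r powr ?d) = 1"
    using r by (simp flip: ennreal_mult' powr_add)
  ultimately have I: "(\<integral>\<^sup>+w. ennreal (g (x + r *\<^sub>R w) powr p) \<partial>lborel) \<le> ennreal (r powr (- ?d) * M powr p)"
    by (simp add: ennreal_mult')
  have "(\<integral>\<^sup>+w. ennreal (g (x + r *\<^sub>R w)) * indicator ?B w \<partial>lborel) = (\<integral>\<^sup>+w. ennreal (g (x + r *\<^sub>R w)) \<partial>?m)"
    by (simp add: nn_integral_restrict_space)
  also have "\<dots> \<le> ennreal s * emeasure ?m (space ?m) +
      ennreal (s powr (1 - p)) * (\<integral>\<^sup>+w. ennreal (g (x + r *\<^sub>R w) powr p) \<partial>?m)"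
    using p s g by (intro nn_integral_le_powr) (auto intro!: measurable_restrict_space1)
  also have "\<dots> \<le> ennreal s * ennreal (unit_ball_vol ?d) + ennreal (s powr (1 - p)) * ennreal (r powr (- ?d) * M powr p)"
  proof (intro add_mono mult_left_mono order_refl)
    show "emeasure ?m (space ?m) \<le> ennreal (unit_ball_vol ?d)"
      by (simp add: space_restrict_space emeasure_restrict_space emeasure_cball)
    have "(\<integral>\<^sup>+w. ennreal (g (x + r *\<^sub>R w) powr p) \<partial>?m) \<le> (\<integral>\<^sup>+w. ennreal (g (x + r *\<^sub>R w) powr p) \<partial>lborel)"
      by (simp add: nn_integral_restrict_space) (intro nn_integral_mono, auto simp: indicator_def)
    with I show "(\<integral>\<^sup>+w. ennreal (g (x + r *\<^sub>R w) powr p) \<partial>?m) \<le> ennreal (r powr (- ?d) * M powr p)"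
      by (rule order_trans[rotated])
  qed auto
  also have "\<dots> = ennreal (s * unit_ball_vol ?d + s powr (1 - p) * (r powr (- ?d) * M powr p))"
    using s by (simp add: ennreal_mult')
  also have "r powr (- ?d) * M powr p = s powr p"
    using r M p by (simp add: s_def powr_mult powr_powr)
  also have "s powr (1 - p) * s powr p = s"
    using s by (simp flip: powr_add)
  finally show ?thesis by (simp add: s_def algebra_simps)
qed

text \<open>Chebyshev's inequality for the near part, whose L^p norm is O(R). Jensen's inequality is
  applied to the product measure on ball times segment, of mass \<open>R\<close> times the ball
  volume; after Fubini every shift contributes the same L^p integral of \<open>g\<close>.\<close>

lemma line_ball_powr_integral_le:
  fixes g :: "'a::euclidean_space \<Rightarrow> real"
  assumes [measurable]: "g \<in> borel_measurable borel" and g: "\<And>x. g x \<ge> 0"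
    and p: "p \<ge> 1" and R: "R > 0" and b: "b \<ge> 0" and E[measurable]: "E \<in> sets borel"
    and low: "\<And>x. x \<in> E \<Longrightarrow> ennreal b \<le>
      (\<integral>\<^sup>+w. indicator (cball 0 1) w * (\<integral>\<^sup>+r. ennreal (g (x + r *\<^sub>R w)) * indicator {0..R} r \<partial>lborel) \<partial>lborel)"
  shows "ennreal (b powr p) * emeasure lborel E \<le>
    ennreal (2 powr p * (R * unit_ball_vol (real DIM('a))) powr p) * powr_int p g"
proof -
  let ?B = "cball 0 1 :: 'a set" and ?V = "unit_ball_vol (real DIM('a))"
  let ?I = "\<lambda>z. indicator ?B (fst z) * indicator {0..R} (snd z) :: ennreal"
  let ?m = "density (lborel \<Otimes>\<^sub>M lborel) ?I :: ('a \<times> real) measure"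
  let ?K = "\<integral>\<^sup>+x. ennreal (g x powr p) \<partial>lborel"
  have [measurable]: "(\<lambda>z. indicator ?B (fst z) :: ennreal) \<in> borel_measurable (lborel \<Otimes>\<^sub>M lborel)"
      "(\<lambda>z. indicator {0..R} (snd z) :: ennreal) \<in> borel_measurable (lborel \<Otimes>\<^sub>M lborel)"
    by (rule measurable_compose[OF measurable_fst borel_measurable_indicator]
        measurable_compose[OF measurable_snd borel_measurable_indicator]; simp)+
  have mI: "?I \<in> borel_measurable (lborel \<Otimes>\<^sub>M lborel)"
    by measurable
  have iter: "(\<integral>\<^sup>+z. ennreal (h (x + snd z *\<^sub>R fst z)) \<partial>?m) =
      (\<integral>\<^sup>+w. indicator ?B w * (\<integral>\<^sup>+r. ennreal (h (x + r *\<^sub>R w)) * indicator {0..R} r \<partial>lborel) \<partial>lborel)"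
    if [measurable]: "h \<in> borel_measurable borel" for h x
  proof -
    have "(\<integral>\<^sup>+z. ennreal (h (x + snd z *\<^sub>R fst z)) \<partial>?m) =
        (\<integral>\<^sup>+z. ?I z * ennreal (h (x + snd z *\<^sub>R fst z)) \<partial>(lborel \<Otimes>\<^sub>M lborel))"
      by (subst nn_integral_density) auto
    also have "\<dots> = (\<integral>\<^sup>+w. \<integral>\<^sup>+r. indicator ?B w * (ennreal (h (x + r *\<^sub>R w)) * indicator {0..R} r) \<partial>lborel \<partial>lborel)"
      by (subst lborel.nn_integral_fst[symmetric]) (auto simp: mult_ac)
    finally show ?thesis by (simp add: nn_integral_cmult)
  qed
  have mass: "emeasure ?m (space ?m) \<le> ennreal (R * ?V)"
  proof -
    have "emeasure ?m (space ?m) = (\<integral>\<^sup>+z. ennreal ((\<lambda>_. 1) ((0::'a) + snd z *\<^sub>R fst z)) \<partial>?m)"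
      by simp
    also have "\<dots> = (\<integral>\<^sup>+w. indicator ?B w * ennreal R \<partial>(lborel :: 'a measure))"
      using R by (subst iter) (auto)
    also have "\<dots> = ennreal (R * ?V)"
      using R by (subst mult.commute, subst nn_integral_cmult_indicator) (auto simp: emeasure_cball ennreal_mult')
    finally show ?thesis by simp
  qed
  have "ennreal (b powr p) * emeasure lborel E = (\<integral>\<^sup>+x. ennreal (b powr p) * indicator E x \<partial>lborel)"
    by (simp add: nn_integral_cmult)
  also have "\<dots> \<le> (\<integral>\<^sup>+x. ennreal (2 powr p * (R * ?V) powr (p - 1)) *
      (\<integral>\<^sup>+z. ennreal (g (x + snd z *\<^sub>R fst z) powr p) \<partial>?m) \<partial>lborel)"
  proof (intro nn_integral_mono)
    fix x :: 'a
    show "ennreal (b powr p) * indicator E x \<le> ennreal (2 powr p * (R * ?V) powr (p - 1)) *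
      (\<integral>\<^sup>+z. ennreal (g (x + snd z *\<^sub>R fst z) powr p) \<partial>?m)"
    proof (cases "x \<in> E")
      case True
      then show ?thesis
        using low[OF True] R g p b mass
        by (simp, intro powr_le_nn_integral) (auto simp: iter)
    qed auto
  qed
  also have "\<dots> = ennreal (2 powr p * (R * ?V) powr (p - 1)) * (\<integral>\<^sup>+x. \<integral>\<^sup>+z. ennreal (g (x + snd z *\<^sub>R fst z) powr p) \<partial>?m \<partial>lborel)"
    by (intro nn_integral_cmult) (simp add: nn_integral_density)
  also have "(\<integral>\<^sup>+x. \<integral>\<^sup>+z. ennreal (g (x + snd z *\<^sub>R fst z) powr p) \<partial>?m \<partial>lborel) =
      (\<integral>\<^sup>+x. \<integral>\<^sup>+z. ?I z * ennreal (g (x + snd z *\<^sub>R fst z) powr p) \<partial>(lborel \<Otimes>\<^sub>M lborel) \<partial>lborel)"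
    by (intro nn_integral_cong, subst nn_integral_density) auto
  also have "\<dots> = (\<integral>\<^sup>+z. \<integral>\<^sup>+x. ?I z * ennreal (g (x + snd z *\<^sub>R fst z) powr p) \<partial>lborel \<partial>(lborel \<Otimes>\<^sub>M lborel))"
    unfolding lborel_prod by (rule lborel_pair.Fubini'[symmetric]) (simp flip: lborel_prod)
  also have "\<dots> = (\<integral>\<^sup>+z. ?I z * ?K \<partial>(lborel \<Otimes>\<^sub>M lborel))"
  proof (intro nn_integral_cong)
    fix z :: "'a \<times> real"
    show "(\<integral>\<^sup>+x. ?I z * ennreal (g (x + snd z *\<^sub>R fst z) powr p) \<partial>lborel) = ?I z * ?K"
      by (simp add: nn_integral_cmult nn_integral_lborel_translate[of "\<lambda>x. ennreal (g x powr p)"])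
  qed
  also have "\<dots> = emeasure ?m (space ?m) * ?K"
    using emeasure_density[OF mI sets.top] by (simp add: nn_integral_multc space_pair_measure)
  also have "ennreal (2 powr p * (R * ?V) powr (p - 1)) * (emeasure ?m (space ?m) * ?K) \<le>
      ennreal (2 powr p * (R * ?V) powr (p - 1)) * (ennreal (R * ?V) * ?K)"
    using mass by (intro mult_left_mono mult_right_mono) auto
  also have "\<dots> = ennreal (2 powr p * ((R * ?V) powr (p - 1) * (R * ?V))) * ?K"
    using R by (simp add: ennreal_mult' mult.assoc)
  also have "(R * ?V) powr (p - 1) * (R * ?V) = (R * ?V) powr p"
    using R by (simp add: powr_diff)
  finally show ?thesis .
qed

section \<open>Weak and strong Sobolev estimates\<close>

text \<open>Since \<open>r <= 1\<close>, a smaller \<open>c\<close> only decreases the integrand, so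
  the borderline exponent \<open>1 + \<delta>\<close> is the worst case. This is how exponents
  \<open>q\<close> below the critical one are covered.\<close>

lemma powr_integral_le:
  assumes d: "\<delta> > 0" and R: "0 < R" "R \<le> 1" and c: "c \<le> 1 + \<delta>"
  shows "(\<integral>\<^sup>+r. ennreal (r powr (- c)) * indicator {R..1} r \<partial>lborel) \<le> ennreal (R powr (- \<delta>) / \<delta>)"
proof -
  have "(\<integral>\<^sup>+r. ennreal (r powr (- c)) * indicator {R..1} r \<partial>lborel) \<le>
      (\<integral>\<^sup>+r. ennreal (r powr (- \<delta> - 1)) * indicator {R..1} r \<partial>lborel)"
    using R c by (intro nn_integral_mono) (auto simp: indicator_def intro!: ennreal_leI powr_mono')
  also have "\<dots> = ennreal (- (1 powr (- \<delta>)) / \<delta> - - (R powr (- \<delta>)) / \<delta>)"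
    using R d
    by (intro nn_integral_FTC_Icc) (auto intro!: derivative_eq_intros)
  also have "\<dots> \<le> ennreal (R powr (- \<delta>) / \<delta>)"
    using d by (intro ennreal_leI) (simp add: divide_right_mono)
  finally show ?thesis .
qed

text \<open>Choose \<open>R\<close> so that on \<open>E\<close> the far part and the integral of |v|
  over the ball take up at most half of the ball volume. The near part then carries the other half,
  and Chebyshev's inequality bounds the measure of \<open>E\<close> by a multiple of
  \<open>(R * M) powr p\<close>, hence of \<open>M powr q\<close>. Only level 1 is treated, because
  \<open>ramp a\<close> brings every other level to it.\<close>

lemma weak_type:
  fixes p q :: real
  assumes p: "1 \<le> p" "p < q" and pq: "real DIM('a::euclidean_space) * (q - p) \<le> p * q"
  obtains C where "C > 0"
    "\<And>(v :: 'a \<Rightarrow> real) g M E. C1_dominated v g \<Longrightarrow> M \<ge> 0 \<Longrightarrow>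
      powr_int p g \<le> ennreal (M powr p) \<Longrightarrow>
      abs_powr_int p v \<le> ennreal (M powr p) \<Longrightarrow>
      E \<in> sets borel \<Longrightarrow> (\<And>x. x \<in> E \<Longrightarrow> 1 \<le> \<bar>v x\<bar>) \<Longrightarrow>
      emeasure lborel E \<le> ennreal (C * M powr q)"
proof -
  let ?d = "real DIM('a)" and ?V = "unit_ball_vol (real DIM('a))"
  have V: "?V > 0" "?V \<noteq> 0" using unit_ball_vol_pos[of ?d] by linarith+
  \<comment> \<open>The hypothesis \<open>pq\<close> says exactly that \<open>?d / p\<close> is at
    most \<open>1 + \<delta>\<close>, as \<open>powr_integral_le\<close> demands; moreover
    \<open>p / \<delta> + p = q\<close>.\<close>
  define \<delta> where "\<delta> = p / (q - p)"
  have d: "\<delta> > 0" "?d / p \<le> 1 + \<delta>"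
    using p pq by (auto simp: \<delta>_def field_simps)
  \<comment> \<open>With \<open>R powr (- \<delta>) = 1 / (c * M)\<close> and
    \<open>M <= 1 / c\<close>, the far part and the integral of |v| add up to at most
    \<open>(?V + 1) * (1 / \<delta> + 1) / c\<close>, which is \<open>?V / 2\<close> for this
    \<open>c\<close>.\<close>
  define c where "c = 2 * ((?V + 1) * (1 / \<delta> + 1)) / ?V"
  have c: "c > 0"
    unfolding c_def using V d by (intro divide_pos_pos mult_pos_pos add_pos_pos) auto
  define C1 where "C1 = (1 / c) powr (p - q)"
  define C2 where "C2 = 4 powr p * c powr (p / \<delta>)"
  show thesis
  proof (rule that[of "C1 + C2"])
    show "C1 + C2 > 0" using c by (simp add: C1_def C2_def add_pos_pos)
    fix v :: "'a \<Rightarrow> real" and g M E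
    assume dom: "C1_dominated v g" and M: "M \<ge> 0"
      and ig: "powr_int p g \<le> ennreal (M powr p)"
      and iv: "abs_powr_int p v \<le> ennreal (M powr p)"
      and E[measurable]: "E \<in> sets borel" and low: "\<And>x. x \<in> E \<Longrightarrow> 1 \<le> \<bar>v x\<bar>"
    note [measurable] = C1_dominated_measurable[OF dom]
    have triv: "emeasure lborel E \<le> ennreal (M powr p)"
    proof -
      have "emeasure lborel E = (\<integral>\<^sup>+x. indicator E x \<partial>lborel)" by simp
      also have "\<dots> \<le> abs_powr_int p v"
        using low p by (intro nn_integral_mono) (auto simp: indicator_def intro!: ge_one_powr_ge_zero)
      finally show ?thesis using iv by simp
    qed
    show "emeasure lborel E \<le> ennreal ((C1 + C2) * M powr q)"
    proof (cases "c * M < 1")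
      \<comment> \<open>Here the intended radius, a positive power of \<open>c * M\<close>, may
        exceed 1. The plain Chebyshev bound \<open>M powr p\<close> is then already at most a
        multiple of \<open>M powr q\<close>.\<close>
      case False
      then have M': "M \<ge> 1 / c" "M > 0" using c M by (auto simp: field_simps intro: ccontr)
      have "M powr (p - q) \<le> C1"
        using M' c p unfolding C1_def by (intro powr_mono2') auto
      then have "M powr (p - q) * M powr q \<le> (C1 + C2) * M powr q"
        using c by (intro mult_right_mono) (auto simp: C2_def intro!: add_increasing2)
      then have "M powr p \<le> (C1 + C2) * M powr q"
        using M' by (simp flip: powr_add)
      with triv show ?thesis by (meson ennreal_leI order_trans)
    next
      case True
      show ?thesis
      proof (cases "M = 0")
        case True
        with triv show ?thesis by simp
      next
        case False
        with M have M: "M > 0" by simp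
        define R where "R = (c * M) powr (1 / \<delta>)"
        have R: "0 < R" "R \<le> 1"
          using c M True d by (auto simp: R_def powr_le1)
        have low': "ennreal (?V / 2) \<le>
          (\<integral>\<^sup>+w. indicator (cball 0 1) w * (\<integral>\<^sup>+r. ennreal (g (x + r *\<^sub>R w)) * indicator {0..R} r \<partial>lborel) \<partial>lborel)"
          (is "_ \<le> ?N") if x: "x \<in> E" for x
        proof -
          have gpos: "g y \<ge> 0" for y using C1_dominated_measurable[OF dom] by blast
          let ?A = "\<lambda>r. \<integral>\<^sup>+w. ennreal (g (x + r *\<^sub>R w)) * indicator (cball 0 1) w \<partial>lborel"
          have far: "(\<integral>\<^sup>+r. indicator {R..1} r * ?A r \<partial>lborel) \<le>
              ennreal ((?V + 1) * M * (R powr (- \<delta>) / \<delta>))"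
          proof -
            have "(\<integral>\<^sup>+r. indicator {R..1} r * ?A r \<partial>lborel) \<le>
                (\<integral>\<^sup>+r. ennreal ((?V + 1) * M) * (ennreal (r powr (- (?d / p))) * indicator {R..1} r) \<partial>lborel)"
            proof (intro nn_integral_mono)
              fix r
              show "indicator {R..1} r * ?A r \<le>
                ennreal ((?V + 1) * M) * (ennreal (r powr (- (?d / p))) * indicator {R..1} r)"
              proof (cases "r \<in> {R..1}")
                case True
                have "?A r \<le>
                    ennreal ((?V + 1) * r powr (- ?d / p) * M)"
                  using True R M p gpos ig by (intro ball_integral_le) auto
                then show ?thesis using True M V by (simp add: mult_ac flip: ennreal_mult')
              qed auto
            qed
            also have "\<dots> = ennreal ((?V + 1) * M) * (\<integral>\<^sup>+r. ennreal (r powr (- (?d / p))) * indicator {R..1} r \<partial>lborel)"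
              by (intro nn_integral_cmult) auto
            also have "\<dots> \<le> ennreal ((?V + 1) * M) * ennreal (R powr (- \<delta>) / \<delta>)"
              using d R by (intro mult_left_mono powr_integral_le) auto
            also have "\<dots> = ennreal ((?V + 1) * M * (R powr (- \<delta>) / \<delta>))"
              using M V d by (simp flip: ennreal_mult')
            finally show ?thesis .
          qed
          have loc: "(\<integral>\<^sup>+w. ennreal \<bar>v (x + w)\<bar> * indicator (cball 0 1) w \<partial>lborel) \<le> ennreal ((?V + 1) * M)"
            using ball_integral_le[of "\<lambda>x. \<bar>v x\<bar>" p M 1 x] p M iv by simp
          have eR: "R powr (- \<delta>) = 1 / (c * M)"
            using c M d by (simp add: R_def powr_powr powr_minus_divide)
          have "(?V + 1) * M * (R powr (- \<delta>) / \<delta>) + (?V + 1) * M \<le> ?V / 2"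
          proof -
            have "M \<le> 1 / c" using True c by (simp add: field_simps)
            then have "(?V + 1) * M \<le> (?V + 1) / c" using V mult_left_mono[of M "1 / c" "?V + 1"] by simp
            moreover have "(?V + 1) * M * (R powr (- \<delta>) / \<delta>) = (?V + 1) / c * (1 / \<delta>)"
              using M c by (simp add: eR)
            ultimately have "(?V + 1) * M * (R powr (- \<delta>) / \<delta>) + (?V + 1) * M \<le> (?V + 1) / c * (1 / \<delta>) + (?V + 1) / c"
              by (simp only: add_left_mono)
            also have "\<dots> = (?V + 1) / c * (1 / \<delta> + 1)" by (simp add: distrib_left)
            also have "\<dots> = ((?V + 1) * (1 / \<delta> + 1)) / (2 * ((?V + 1) * (1 / \<delta> + 1)) / ?V)"
              by (simp add: c_def)
            also have "\<dots> = ?V / 2"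
            proof -
              have "X / (2 * X / ?V) = ?V / 2" if "X > 0" for X using that V by simp
              then show ?thesis using V d by (meson add_pos_pos divide_pos_pos mult_pos_pos zero_less_one)
            qed
            finally show ?thesis .
          qed
          note small = this
          have "ennreal ?V \<le> ennreal (?V * \<bar>v x\<bar>)"
            using low[OF x] V by (intro ennreal_leI) simp
          also have "\<dots> \<le> ?N + ennreal ((?V + 1) * M * (R powr (- \<delta>) / \<delta>)) + ennreal ((?V + 1) * M)"
            using C1_dominated_ball_average[OF dom, of R x] R far loc
            by (meson add_mono less_imp_le order_refl order_trans)
          also have "\<dots> = ?N + ennreal ((?V + 1) * M * (R powr (- \<delta>) / \<delta>) + (?V + 1) * M)"
            using M V d by (subst ennreal_plus) (auto simp: add.assoc)
          also have "\<dots> \<le> ?N + ennreal (?V / 2)"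
            using small by (intro add_left_mono ennreal_leI)
          finally have *: "ennreal ?V \<le> ?N + ennreal (?V / 2)" .
          show "ennreal (?V / 2) \<le> ?N"
          proof (cases ?N)
            case (real n)
            then show ?thesis using * V by (simp flip: ennreal_plus)
          qed simp
        qed
        have "ennreal ((?V / 2) powr p) * emeasure lborel E \<le>
            ennreal (2 powr p * (R * ?V) powr p) * powr_int p g"
          using p R V C1_dominated_measurable[OF dom] low'
          by (intro line_ball_powr_integral_le) auto
        also have "\<dots> \<le> ennreal (2 powr p * (R * ?V) powr p) * ennreal (M powr p)"
          using ig by (intro mult_left_mono) auto
        also have "\<dots> = ennreal ((?V / 2) powr p) * ennreal (4 powr p * R powr p * M powr p)"
        proof -
          have "2 powr p * (R * ?V) powr p = (?V / 2) powr p * (4 powr p * R powr p)"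
            using R V p by (simp flip: powr_mult)
          then show ?thesis by (simp flip: ennreal_mult' add: mult_ac)
        qed
        finally have "ennreal ((?V / 2) powr p) * emeasure lborel E \<le>
            ennreal ((?V / 2) powr p) * ennreal (4 powr p * R powr p * M powr p)" .
        then have "emeasure lborel E \<le> ennreal (4 powr p * R powr p * M powr p)"
          by (subst (asm) ennreal_mult_le_mult_iff) (auto simp: V(2))
        also have "4 powr p * R powr p * M powr p = C2 * M powr (p / \<delta> + p)"
          using c M d by (simp add: C2_def R_def powr_powr powr_mult powr_add)
        also have "p / \<delta> + p = q" using p by (simp add: \<delta>_def)
        also have "ennreal (C2 * M powr q) \<le> ennreal ((C1 + C2) * M powr q)"
          using c by (intro ennreal_leI mult_right_mono) (auto simp: C1_def)
        finally show ?thesis .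
      qed
    qed
  qed
qed

text \<open>A truncation that is \<open>C\<^sup>1\<close>, so that it can be composed with \<open>C\<^sup>1\<close> functions.\<close>

definition ramp :: "real \<Rightarrow> real \<Rightarrow> real"
  where "ramp a t = ((max 0 (t - a))\<^sup>2 - 2 * (max 0 (t - 2 * a))\<^sup>2 + (max 0 (t - 3 * a))\<^sup>2) / (2 * a\<^sup>2)"

text \<open>The square of the positive part of s is (s^2 + s |s|) / 2, so only s |s| at the origin
  has to be differentiated by hand.\<close>

lemma max_0_square_has_derivative:
  "((\<lambda>t. (max 0 (t - b))\<^sup>2) has_real_derivative 2 * max 0 (t - b)) (at t)"
proof -
  have *: "((\<lambda>t::real. t * \<bar>t\<bar>) has_real_derivative 2 * \<bar>s\<bar>) (at s)" for s
  proof (cases "s = 0")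
    case True
    have "((\<lambda>t::real. \<bar>t\<bar>) \<longlongrightarrow> 0) (at 0)"
      using tendsto_rabs[OF tendsto_ident_at[of 0 UNIV]] by simp
    then have "((\<lambda>t::real. t * \<bar>t\<bar> / t) \<longlongrightarrow> 0) (at 0)"
      by (rule Lim_transform_eventually) (auto simp: eventually_at intro!: exI[of _ 1])
    then show ?thesis using True by (simp add: has_field_derivative_iff)
  next
    case False
    have "((\<lambda>t. sgn s * t\<^sup>2) has_real_derivative 2 * \<bar>s\<bar>) (at s)"
      by (auto intro!: derivative_eq_intros simp: abs_sgn)
    then show ?thesis
      by (rule has_field_derivative_transform_within[of _ _ _ _ "\<bar>s\<bar>"])
        (use False in \<open>auto simp: dist_real_def power2_eq_square sgn_if abs_if split: if_splits\<close>)
  qed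
  have "(\<lambda>t. (max 0 (t - b))\<^sup>2) = (\<lambda>t. ((t - b)\<^sup>2 + (t - b) * \<bar>t - b\<bar>) / 2)"
    by (rule ext, auto simp: max_def power2_eq_square abs_if, simp add: algebra_simps)
  moreover have "((\<lambda>t. (t - b) * \<bar>t - b\<bar>) has_real_derivative 2 * \<bar>t - b\<bar>) (at t)"
    using DERIV_chain2[OF *[of "t - b"] DERIV_diff[OF DERIV_ident DERIV_const]] by simp
  then have "((\<lambda>t. ((t - b)\<^sup>2 + (t - b) * \<bar>t - b\<bar>) / 2) has_real_derivative
      (2 * (t - b) + 2 * \<bar>t - b\<bar>) / 2) (at t)"
    by (intro DERIV_cdivide DERIV_add) (auto intro!: derivative_eq_intros)
  moreover have "(2 * (t - b) + 2 * \<bar>t - b\<bar>) / 2 = 2 * max 0 (t - b)"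
    by (auto simp: max_def)
  ultimately show ?thesis by simp
qed

text \<open>The hat function supported on [a, 3a] with peak 1/a at 2a. Its area is 1, so its
  primitive \<open>ramp a\<close> climbs from 0 to 1.\<close>

definition tent :: "real \<Rightarrow> real \<Rightarrow> real"
  where "tent a t = (max 0 (t - a) - 2 * max 0 (t - 2 * a) + max 0 (t - 3 * a)) / a\<^sup>2"

lemma ramp_has_derivative:
  assumes "a > 0"
  shows "(ramp a has_real_derivative tent a t) (at t)"
proof -
  have "(ramp a has_real_derivative
      (2 * max 0 (t - a) - 2 * (2 * max 0 (t - 2 * a)) + 2 * max 0 (t - 3 * a)) / (2 * a\<^sup>2)) (at t)"
    unfolding ramp_def
    by (intro DERIV_cdivide DERIV_add DERIV_diff DERIV_cmult max_0_square_has_derivative)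
  moreover have "(2 * max 0 (t - a) - 2 * (2 * max 0 (t - 2 * a)) + 2 * max 0 (t - 3 * a)) / (2 * a\<^sup>2) = tent a t"
    using assms by (simp add: tent_def field_simps)
  ultimately show ?thesis by simp
qed

lemma tent_bound: "a > 0 \<Longrightarrow> \<bar>tent a t\<bar> \<le> (if a \<le> t \<and> t \<le> 3 * a then 1 / a else 0)"
  by (auto simp: tent_def max_def field_simps power2_eq_square)

lemma ramp_bounds:
  assumes "a > 0"
  shows "0 \<le> ramp a t" "ramp a t \<le> 1" "t \<le> a \<Longrightarrow> ramp a t = 0" "3 * a \<le> t \<Longrightarrow> ramp a t = 1"
proof -
  have "\<exists>y. (ramp a has_real_derivative y) (at x) \<and> 0 \<le> y" for x
    using ramp_has_derivative[OF assms, of x] assms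
    by (intro exI[of _ "tent a x"]) (auto simp: tent_def max_def)
  then have mono: "s \<le> t \<Longrightarrow> ramp a s \<le> ramp a t" for s t
    by (meson DERIV_nonneg_imp_nondecreasing)
  show zero: "t \<le> a \<Longrightarrow> ramp a t = 0" for t
    using assms by (simp add: ramp_def max_def)
  show one: "3 * a \<le> t \<Longrightarrow> ramp a t = 1" for t
    using assms by (simp add: ramp_def max_def field_simps power2_eq_square)
  show "0 \<le> ramp a t" using zero[of "min t a"] mono[of "min t a" t] by simp
  show "ramp a t \<le> 1" using one[of "max t (3 * a)"] mono[of t "max t (3 * a)"] by simp
qed

lemma C1_dominated_ramp:
  assumes dom: "C1_dominated u g" and a: "a > 0"
  shows "C1_dominated (\<lambda>x. ramp a (u x)) (\<lambda>x. if a \<le> u x \<and> u x \<le> 3 * a then g x / a else 0)"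
proof -
  note [measurable] = C1_dominated_measurable[OF dom]
  obtain u' where cu: "continuous_on UNIV u" and
    der: "\<And>x w r. ((\<lambda>r. u (x + r *\<^sub>R w)) has_real_derivative u' (x + r *\<^sub>R w) w) (at r)"
    and cont: "\<And>w. continuous_on UNIV (\<lambda>x. u' x w)" and bnd: "\<And>x w. norm w \<le> 1 \<Longrightarrow> \<bar>u' x w\<bar> \<le> g x"
    using dom unfolding C1_dominated_def by blast
  have g: "g x \<ge> 0" for x using dom by (simp add: C1_dominated_def)
  show ?thesis
    unfolding C1_dominated_def
  proof (intro conjI allI exI[of _ "\<lambda>x w. tent a (u x) * u' x w"] impI)
    show "continuous_on UNIV (\<lambda>x. ramp a (u x))"
      unfolding ramp_def using a by (auto intro!: continuous_intros cu)
    show "((\<lambda>r. ramp a (u (x + r *\<^sub>R w))) has_real_derivative tent a (u (x + r *\<^sub>R w)) * u' (x + r *\<^sub>R w) w) (at r)" for x w r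
      using DERIV_chain2[OF ramp_has_derivative[OF a] der] by (simp add: mult.commute)
    show "continuous_on UNIV (\<lambda>x. tent a (u x) * u' x w)" for w
      unfolding tent_def using a by (auto intro!: continuous_intros cu cont)
    show "\<bar>tent a (u x) * u' x w\<bar> \<le> (if a \<le> u x \<and> u x \<le> 3 * a then g x / a else 0)" if "norm w \<le> 1" for x w
      using mult_mono[OF tent_bound[OF a, of "u x"] bnd[OF that, of x]] a
      by (auto simp: abs_mult split: if_splits)
  qed (use a g in auto)
qed

lemma measurable_ramp[measurable (raw)]:
  assumes [measurable]: "f \<in> borel_measurable M" "g \<in> borel_measurable M"
  shows "(\<lambda>x. ramp (f x) (g x)) \<in> borel_measurable M"
  unfolding ramp_def by measurable

text \<open>A lower layer-cake bound that keeps only the levels between t/6 and t/3: an interval of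
  length t/6 on which the integrand is at least \<open>(t / 6) powr (q - 1)\<close>. The condition
  on \<open>3 * a\<close> is there because \<open>ramp a\<close> reaches 1 at
  \<open>3 * a\<close>.\<close>

lemma powr_le_level_integral:
  fixes t q :: real
  assumes q: "q \<ge> 1"
  shows "ennreal ((max 0 t / 6) powr q) \<le>
    (\<integral>\<^sup>+a. ennreal (a powr (q - 1)) * (indicator {0<..} a * indicator {..t} (3 * a)) \<partial>lborel)"
proof (cases "t > 0")
  case True
  have "ennreal ((max 0 t / 6) powr q) = ennreal ((t / 6) powr (q - 1)) * ennreal (t / 6)"
    using True by (simp add: powr_diff flip: ennreal_mult')
  also have "\<dots> = (\<integral>\<^sup>+a. ennreal ((t / 6) powr (q - 1)) * indicator {t / 6..t / 3} a \<partial>lborel)"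
    using True by (subst nn_integral_cmult_indicator) auto
  also have "\<dots> \<le> (\<integral>\<^sup>+a. ennreal (a powr (q - 1)) * (indicator {0<..} a * indicator {..t} (3 * a)) \<partial>lborel)"
    using True q by (intro nn_integral_mono) (auto simp: indicator_def intro!: ennreal_leI powr_mono2)
  finally show ?thesis .
qed auto

text \<open>To be read at a fixed point, with \<open>t\<close> the value of the function and
  \<open>G\<close> that of the dominating function. The band condition confines \<open>a\<close> to
  [t/3, t], where the gradient term is G^p / a <= 3 G^p / t; the length 2t/3 gives 2 G^p. The ramp
  term is at most \<open>t powr (p - 1)\<close> and vanishes for a >= t.\<close>

lemma level_integral_le:
  fixes t p G :: real
  assumes p: "p \<ge> 1" and G: "G \<ge> 0"
  shows "(\<integral>\<^sup>+a. ennreal (a powr (p - 1)) * (indicator {0<..} a *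
      (ennreal ((if a \<le> t \<and> t \<le> 3 * a then G / a else 0) powr p) + ennreal (\<bar>ramp a t\<bar> powr p))) \<partial>lborel) \<le>
    ennreal (2 * G powr p + \<bar>t\<bar> powr p)"
proof -
  let ?L = "\<lambda>a. ennreal (a powr (p - 1)) * (indicator {0<..} a *
      (ennreal ((if a \<le> t \<and> t \<le> 3 * a then G / a else 0) powr p) + ennreal (\<bar>ramp a t\<bar> powr p)))"
  have *: "?L a \<le>
      ennreal (G powr p * (3 / \<bar>t\<bar>)) * indicator {t / 3..t} a + ennreal (\<bar>t\<bar> powr (p - 1)) * indicator {0..t} a" for a
  proof (cases "0 < a")
    case True
    have 1: "a powr (p - 1) * (if a \<le> t \<and> t \<le> 3 * a then G / a else 0) powr p \<le>
        G powr p * (3 / \<bar>t\<bar>) * indicator {t / 3..t} a"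
    proof (cases "a \<le> t \<and> t \<le> 3 * a")
      case True
      then have "a powr (p - 1) * (G / a) powr p = G powr p * (1 / a)"
        using \<open>0 < a\<close> G by (simp add: powr_diff powr_divide)
      also have "\<dots> \<le> G powr p * (3 / \<bar>t\<bar>)"
        using True \<open>0 < a\<close> by (intro mult_left_mono) (auto simp: field_simps)
      finally show ?thesis using True by (auto simp: indicator_def)
    qed auto
    have 2: "a powr (p - 1) * \<bar>ramp a t\<bar> powr p \<le> \<bar>t\<bar> powr (p - 1) * indicator {0..t} a"
    proof (cases "a \<le> t")
      case le: True
      have "\<bar>ramp a t\<bar> powr p \<le> 1"
        using ramp_bounds[OF True, of t] p by (intro powr_le1) auto
      moreover have "a powr (p - 1) \<le> \<bar>t\<bar> powr (p - 1)"
        using le True p by (intro powr_mono2) auto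
      ultimately have "a powr (p - 1) * \<bar>ramp a t\<bar> powr p \<le> \<bar>t\<bar> powr (p - 1) * 1"
        by (intro mult_mono) auto
      then show ?thesis using le True by simp
    qed (use ramp_bounds[OF True, of t] p in auto)
    have "ennreal (a powr (p - 1)) * (ennreal ((if a \<le> t \<and> t \<le> 3 * a then G / a else 0) powr p) + ennreal (\<bar>ramp a t\<bar> powr p)) =
        ennreal (a powr (p - 1) * (if a \<le> t \<and> t \<le> 3 * a then G / a else 0) powr p) + ennreal (a powr (p - 1) * \<bar>ramp a t\<bar> powr p)"
      by (simp only: distrib_left ennreal_mult' powr_ge_zero)
    also have "\<dots> \<le> ennreal (G powr p * (3 / \<bar>t\<bar>) * indicator {t / 3..t} a) + ennreal (\<bar>t\<bar> powr (p - 1) * indicator {0..t} a)"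
      by (intro add_mono ennreal_leI 1 2)
    also have "\<dots> = ennreal (G powr p * (3 / \<bar>t\<bar>)) * indicator {t / 3..t} a + ennreal (\<bar>t\<bar> powr (p - 1)) * indicator {0..t} a"
      by (simp add: indicator_def)
    finally show ?thesis using True by simp
  qed auto
  show ?thesis
  proof (cases "t > 0")
    case True
    have "(\<integral>\<^sup>+a. ?L a \<partial>lborel) \<le>
      (\<integral>\<^sup>+a. ennreal (G powr p * (3 / \<bar>t\<bar>)) * indicator {t / 3..t} a + ennreal (\<bar>t\<bar> powr (p - 1)) * indicator {0..t} a \<partial>lborel)"
      by (intro nn_integral_mono *)
    also have "\<dots> = ennreal (G powr p * (3 / \<bar>t\<bar>)) * ennreal (t - t / 3) + ennreal (\<bar>t\<bar> powr (p - 1)) * ennreal t"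
      using True by (subst nn_integral_add) (auto simp: nn_integral_cmult_indicator)
    also have "\<dots> = ennreal (2 * G powr p + \<bar>t\<bar> powr p)"
      using True by (simp add: powr_diff flip: ennreal_mult' ennreal_plus)
    finally show ?thesis .
  next
    case False
    then have "(\<integral>\<^sup>+a. ?L a \<partial>lborel) = (\<integral>\<^sup>+a. 0 \<partial>(lborel :: real measure))"
      using p by (intro nn_integral_cong) (auto simp: indicator_def ramp_bounds)
    then show ?thesis by simp
  qed
qed

text \<open>The gradient of \<open>ramp a \<circ> u\<close> lives on \<open>a \<le> u \<le> 3a\<close>; integrating the weak-type estimates over all
  levels \<open>a\<close> therefore counts every point only boundedly often with respect to \<open>da/a\<close>.\<close>

lemma strong_type_pos_part:
  fixes p q :: real
  assumes p: "1 \<le> p" "p < q" and pq: "real DIM('a::euclidean_space) * (q - p) \<le> p * q"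
  obtains C where "C > 0"
    "\<And>(u :: 'a \<Rightarrow> real) g N. C1_dominated u g \<Longrightarrow> N > 0 \<Longrightarrow>
      powr_int p g \<le> ennreal (N powr p) \<Longrightarrow>
      abs_powr_int p u \<le> ennreal (N powr p) \<Longrightarrow>
      (\<integral>\<^sup>+x. ennreal (max 0 (u x) powr q) \<partial>lborel) \<le> ennreal (C * N powr q)"
proof -
  obtain K where K: "K > 0" and weak:
    "\<And>(v :: 'a \<Rightarrow> real) g M E. C1_dominated v g \<Longrightarrow> M \<ge> 0 \<Longrightarrow>
      powr_int p g \<le> ennreal (M powr p) \<Longrightarrow>
      abs_powr_int p v \<le> ennreal (M powr p) \<Longrightarrow>
      E \<in> sets borel \<Longrightarrow> (\<And>x. x \<in> E \<Longrightarrow> 1 \<le> \<bar>v x\<bar>) \<Longrightarrow>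
      emeasure lborel E \<le> ennreal (K * M powr q)"
    using weak_type[OF p pq] by blast
  show thesis
  proof (rule that[of "6 powr q * (K * 2 powr (q - p) * 3)"])
    show "6 powr q * (K * 2 powr (q - p) * 3) > 0" using K by simp
    fix u :: "'a \<Rightarrow> real" and g N
    assume dom: "C1_dominated u g" and N: "N > 0"
      and ig: "powr_int p g \<le> ennreal (N powr p)"
      and iu: "abs_powr_int p u \<le> ennreal (N powr p)"
    note [measurable] = C1_dominated_measurable[OF dom]
    have g: "g x \<ge> 0" for x using C1_dominated_measurable[OF dom] by blast
    define h where "h a x = (if a \<le> u x \<and> u x \<le> 3 * a then g x / a else 0)" for a x
    have [measurable]: "(\<lambda>z. h (fst z) (snd z)) \<in> borel_measurable (lborel \<Otimes>\<^sub>M lborel)"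
      unfolding h_def by measurable
    have hm[measurable]: "h a \<in> borel_measurable borel" for a
      unfolding h_def by measurable
    let ?j = "\<lambda>a x. ennreal (h a x powr p) + ennreal (\<bar>ramp a (u x)\<bar> powr p)"
    define J where "J a = (\<integral>\<^sup>+x. ?j a x \<partial>lborel)" for a
    have Jm[measurable]: "J \<in> borel_measurable borel"
      unfolding J_def by measurable
    have level: "ennreal (a powr (q - 1)) * emeasure lborel {x. 3 * a \<le> u x} \<le>
        ennreal (K * (2 * N) powr (q - p)) * (ennreal (a powr (p - 1)) * J a)" if a: "a > 0" for a
    proof -
      \<comment> \<open>A bound uniform in \<open>a\<close>: on the band \<open>h a\<close> equals
        \<open>g / a\<close>, and \<open>ramp a\<close> vanishes where \<open>u x <= a\<close>. It
        makes \<open>J a\<close> finite and later yields \<open>a * M <= 2 * N\<close>.\<close>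
      have "ennreal (a powr p) * J a = (\<integral>\<^sup>+x. ennreal (a powr p) * ?j a x \<partial>lborel)"
        unfolding J_def by (simp add: nn_integral_cmult)
      also have "\<dots> \<le> (\<integral>\<^sup>+x. ennreal (g x powr p) + ennreal (\<bar>u x\<bar> powr p) \<partial>lborel)"
      proof (intro nn_integral_mono)
        fix x
        have "a powr p * h a x powr p \<le> g x powr p"
          using a g[of x] by (auto simp: h_def powr_divide)
        moreover have "a powr p * \<bar>ramp a (u x)\<bar> powr p \<le> \<bar>u x\<bar> powr p"
        proof (cases "u x \<le> a")
          case False
          have "a powr p * \<bar>ramp a (u x)\<bar> powr p \<le> \<bar>u x\<bar> powr p * 1"
            using False a p ramp_bounds[OF a, of "u x"] by (intro mult_mono powr_mono2 powr_le1) auto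
          then show ?thesis by simp
        qed (use ramp_bounds[OF a, of "u x"] p in auto)
        ultimately show "ennreal (a powr p) * ?j a x \<le>
            ennreal (g x powr p) + ennreal (\<bar>u x\<bar> powr p)"
          by (simp add: distrib_left add_mono ennreal_leI flip: ennreal_mult')
      qed
      also have "\<dots> \<le> ennreal (N powr p) + ennreal (N powr p)"
        using ig iu by (simp add: nn_integral_add add_mono)
      also have "\<dots> = ennreal (2 * N powr p)" by (simp flip: ennreal_plus)
      finally have aJ: "ennreal (a powr p) * J a \<le> ennreal (2 * N powr p)" .
      then have "J a \<noteq> \<infinity>" using a by (auto simp: ennreal_mult_top top_unique)
      then obtain j where j: "J a = ennreal j" "j \<ge> 0" by (cases "J a") auto
      define M where "M = j powr (1 / p)"
      have M: "M \<ge> 0" "M powr p = j" using p j by (auto simp: M_def powr_powr)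
      have J: "(\<integral>\<^sup>+x. ennreal (h a x powr p) \<partial>lborel) \<le> ennreal (M powr p)"
          "(\<integral>\<^sup>+x. ennreal (\<bar>ramp a (u x)\<bar> powr p) \<partial>lborel) \<le> ennreal (M powr p)"
        unfolding M(2) j(1)[symmetric] J_def by (auto intro!: nn_integral_mono)
      have E: "emeasure lborel {x. 3 * a \<le> u x} \<le> ennreal (K * M powr q)"
        using C1_dominated_ramp[OF dom a] M(1) J ramp_bounds[OF a]
        by (intro weak[where v = "\<lambda>x. ramp a (u x)" and g = "h a"]) (auto simp: h_def[abs_def])
      have "a powr p * j \<le> 2 * N powr p"
        using aJ a j by (simp flip: ennreal_mult')
      also have "\<dots> \<le> (2 * N) powr p"
        using p powr_mono[of 1 p 2] N by (simp add: powr_mult)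
      finally have "(a * M) powr p \<le> (2 * N) powr p"
        using a M by (simp add: powr_mult)
      then have "a * M \<le> 2 * N"
        using powr_less_mono2[of p "2 * N" "a * M"] p(1) N by linarith
      then have *: "(a * M) powr (q - p) \<le> (2 * N) powr (q - p)"
        using p a M by (intro powr_mono2) auto
      \<comment> \<open>Splitting off the power \<open>q - p\<close> of \<open>a * M\<close>, which
        is bounded independently of \<open>a\<close>, leaves \<open>M powr p\<close>, that is
        \<open>J a\<close>. The weak estimates thus become linear in the energy and can be
        integrated over the levels.\<close>
      have "a powr (q - 1) * (K * M powr q) = K * (a powr (p - 1) * M powr p) * (a * M) powr (q - p)"
      proof -
        have "a powr (p - 1) * a powr (q - p) = a powr (q - 1)" "M powr p * M powr (q - p) = M powr q"
          by (simp_all flip: powr_add)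
        moreover have "(a * M) powr (q - p) = a powr (q - p) * M powr (q - p)"
          using a M(1) by (simp add: powr_mult)
        ultimately show ?thesis by (metis (no_types) mult.assoc mult.left_commute)
      qed
      also have "\<dots> \<le> K * (a powr (p - 1) * M powr p) * (2 * N) powr (q - p)"
        using * K by (intro mult_left_mono) auto
      also have "\<dots> = K * (2 * N) powr (q - p) * (a powr (p - 1) * j)" by (simp add: M(2))
      finally have **: "a powr (q - 1) * (K * M powr q) \<le> K * (2 * N) powr (q - p) * (a powr (p - 1) * j)" .
      have "ennreal (a powr (q - 1)) * emeasure lborel {x. 3 * a \<le> u x} \<le> ennreal (a powr (q - 1)) * ennreal (K * M powr q)"
        by (intro mult_left_mono E) simp
      also have "\<dots> \<le> ennreal (K * (2 * N) powr (q - p) * (a powr (p - 1) * j))"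
        using ** by (simp add: ennreal_leI flip: ennreal_mult')
      also have "\<dots> = ennreal (K * (2 * N) powr (q - p)) * (ennreal (a powr (p - 1)) * J a)"
        using K j by (simp add: ennreal_mult')
      finally show ?thesis .
    qed
    have "(\<integral>\<^sup>+x. ennreal ((max 0 (u x) / 6) powr q) \<partial>lborel) \<le>
        (\<integral>\<^sup>+x. \<integral>\<^sup>+a. ennreal (a powr (q - 1)) * (indicator {0<..} a * indicator {..u x} (3 * a)) \<partial>lborel \<partial>lborel)"
      using p by (intro nn_integral_mono powr_le_level_integral) auto
    also have "\<dots> = (\<integral>\<^sup>+x. \<integral>\<^sup>+a. ennreal (a powr (q - 1)) * (indicator {0<..} a * indicator {x. 3 * a \<le> u x} x) \<partial>lborel \<partial>lborel)"
      by (simp add: indicator_def)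
    also have "\<dots> = (\<integral>\<^sup>+a. \<integral>\<^sup>+x. ennreal (a powr (q - 1)) * (indicator {0<..} a * indicator {x. 3 * a \<le> u x} x) \<partial>lborel \<partial>lborel)"
      by (rule lborel_pair.Fubini'[symmetric]) simp
    also have "\<dots> = (\<integral>\<^sup>+a. indicator {0<..} a * (ennreal (a powr (q - 1)) * emeasure lborel {x. 3 * a \<le> u x}) \<partial>lborel)"
      by (simp add: nn_integral_cmult mult_ac)
    also have "\<dots> \<le> (\<integral>\<^sup>+a. ennreal (K * (2 * N) powr (q - p)) * (ennreal (a powr (p - 1)) * (indicator {0<..} a * J a)) \<partial>lborel)"
      using level by (intro nn_integral_mono) (auto simp: indicator_def)
    also have "\<dots> = ennreal (K * (2 * N) powr (q - p)) * (\<integral>\<^sup>+a. ennreal (a powr (p - 1)) * (indicator {0<..} a * J a) \<partial>lborel)"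
      by (intro nn_integral_cmult) measurable
    also have "(\<integral>\<^sup>+a. ennreal (a powr (p - 1)) * (indicator {0<..} a * J a) \<partial>lborel) =
        (\<integral>\<^sup>+a. \<integral>\<^sup>+x. ennreal (a powr (p - 1)) * (indicator {0<..} a * ?j a x) \<partial>lborel \<partial>lborel)"
      unfolding J_def by (simp add: nn_integral_cmult)
    also have "\<dots> = (\<integral>\<^sup>+x. \<integral>\<^sup>+a. ennreal (a powr (p - 1)) * (indicator {0<..} a * ?j a x) \<partial>lborel \<partial>lborel)"
      by (rule lborel_pair.Fubini'[symmetric]) (simp add: h_def)
    also have "\<dots> \<le> (\<integral>\<^sup>+x. ennreal (2 * g x powr p + \<bar>u x\<bar> powr p) \<partial>lborel)"
      unfolding h_def using p(1) g by (intro nn_integral_mono level_integral_le)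
    also have "\<dots> = 2 * powr_int p g + abs_powr_int p u"
      by (simp add: ennreal_mult' nn_integral_add nn_integral_cmult)
    also have "\<dots> \<le> 2 * ennreal (N powr p) + ennreal (N powr p)"
      by (intro add_mono mult_left_mono ig iu) simp
    also have "\<dots> = ennreal (2 * N powr p) + ennreal (N powr p)"
      by (simp add: ennreal_mult')
    also have "\<dots> = ennreal (3 * N powr p)"
      by (simp flip: ennreal_plus)
    finally have fin: "(\<integral>\<^sup>+x. ennreal ((max 0 (u x) / 6) powr q) \<partial>lborel) \<le> ennreal (K * (2 * N) powr (q - p)) * ennreal (3 * N powr p)"
      by (simp add: mult_left_mono)
    have "(\<integral>\<^sup>+x. ennreal (max 0 (u x) powr q) \<partial>lborel) = (\<integral>\<^sup>+x. ennreal (6 powr q) * ennreal ((max 0 (u x) / 6) powr q) \<partial>lborel)"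
      by (simp add: powr_divide flip: ennreal_mult')
    also have "\<dots> = ennreal (6 powr q) * (\<integral>\<^sup>+x. ennreal ((max 0 (u x) / 6) powr q) \<partial>lborel)"
      by (simp add: nn_integral_cmult)
    also have "\<dots> \<le> ennreal (6 powr q) * (ennreal (K * (2 * N) powr (q - p)) * ennreal (3 * N powr p))"
      by (intro mult_left_mono fin) simp
    also have "\<dots> = ennreal (6 powr q * (K * 2 powr (q - p) * 3) * N powr q)"
      using K N by (simp add: powr_mult powr_diff flip: ennreal_mult')
    finally show "(\<integral>\<^sup>+x. ennreal (max 0 (u x) powr q) \<partial>lborel) \<le> ennreal (6 powr q * (K * 2 powr (q - p) * 3) * N powr q)" .
  qed
qed

lemma C1_dominated_uminus:
  assumes "C1_dominated u g"
  shows "C1_dominated (\<lambda>x. - u x) g"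
proof -
  obtain u' where
    der: "\<And>x w r. ((\<lambda>r. u (x + r *\<^sub>R w)) has_real_derivative u' (x + r *\<^sub>R w) w) (at r)"
    and cont: "\<And>w. continuous_on UNIV (\<lambda>x. u' x w)" and bnd: "\<And>x w. norm w \<le> 1 \<Longrightarrow> \<bar>u' x w\<bar> \<le> g x"
    using assms unfolding C1_dominated_def by blast
  with assms show ?thesis
    unfolding C1_dominated_def
    by (intro conjI exI[of _ "\<lambda>x w. - u' x w"])
      (auto intro!: continuous_on_minus DERIV_minus der cont bnd)
qed

text \<open>From a point of norm below 2, the shift by \<open>5 *\<^sub>R e\<close> leads to norm
  above 3. Either \<open>g\<close> is at least |u x| / 2 at the end point, or \<open>u\<close>
  changes by at least |u x| / 2 along the segment, which the integral of \<open>g\<close> over the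
  segment detects. The two halvings and the factor of \<open>powr_le_nn_integral\<close> give
  \<open>2 powr p\<close> and \<open>4 powr p\<close>; Jensen on a segment of length 5 and Fubini
  give \<open>5 powr p\<close>.\<close>

lemma powr_integral_confined:
  fixes u :: "'a::euclidean_space \<Rightarrow> real"
  assumes dom: "C1_dominated u g" and p: "p \<ge> 1" and out: "\<And>x. norm x \<ge> 2 \<Longrightarrow> \<bar>u x\<bar> \<le> g x"
  shows "abs_powr_int p u \<le>
    ennreal (1 + 2 powr p + 4 powr p * 5 powr p) * powr_int p g"
proof -
  note [measurable] = C1_dominated_measurable[OF dom]
  have g: "g x \<ge> 0" for x using C1_dominated_measurable[OF dom] by blast
  obtain e :: 'a where e: "e \<in> Basis" using nonempty_Basis by blast
  then have ne: "norm e = 1" by simp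
  let ?G = "\<lambda>x. ennreal (g x powr p)"
  let ?c = "4 powr p * 5 powr (p - 1) :: real"
  let ?S = "\<lambda>x. \<integral>\<^sup>+r. indicator {0..5} r * ?G (x + r *\<^sub>R e) \<partial>lborel"
  have pw: "ennreal (\<bar>u x\<bar> powr p) \<le> ?G x + (ennreal (2 powr p) * ?G (x + 5 *\<^sub>R e) +
      ennreal ?c * ?S x)" for x
  proof (cases "norm x \<ge> 2")
    case True
    then have "ennreal (\<bar>u x\<bar> powr p) \<le> ?G x"
      using out p by (intro ennreal_leI powr_mono2) auto
    then show ?thesis by (simp add: add_increasing2)
  next
    case False
    have "norm (5 *\<^sub>R e) \<le> norm (x + 5 *\<^sub>R e) + norm x"
      using norm_triangle_ineq4[of "x + 5 *\<^sub>R e" x] by simp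
    then have far: "\<bar>u (x + 5 *\<^sub>R e)\<bar> \<le> g (x + 5 *\<^sub>R e)"
      using False ne by (intro out) simp
    have pw2: "ennreal (\<bar>u x\<bar> powr p) \<le> ennreal (2 powr p) * ?G (x + 5 *\<^sub>R e) +
      ennreal ?c * ?S x"
    proof (cases "\<bar>u x\<bar> / 2 \<le> g (x + 5 *\<^sub>R e)")
      case True
      then have "\<bar>u x\<bar> powr p \<le> (2 * g (x + 5 *\<^sub>R e)) powr p"
        using p by (intro powr_mono2) auto
      then have "ennreal (\<bar>u x\<bar> powr p) \<le> ennreal (2 powr p) * ?G (x + 5 *\<^sub>R e)"
        using g by (simp add: powr_mult ennreal_leI flip: ennreal_mult')
      then show ?thesis by (simp add: add_increasing2)
    next
      case False
      have "\<bar>u x\<bar> / 2 \<le> \<bar>u (x + 5 *\<^sub>R e) - u x\<bar>" using False far by linarith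
      then have "ennreal (\<bar>u x\<bar> / 2) \<le> (\<integral>\<^sup>+r. ennreal (g (x + r *\<^sub>R e)) * indicator {0..5} r \<partial>lborel)"
        using order_trans[OF ennreal_leI C1_dominated_line[OF dom, of e 5 x]] ne by simp
      also have "\<dots> = (\<integral>\<^sup>+r. ennreal (g (x + r *\<^sub>R e)) \<partial>density lborel (indicator {0..5}))"
        by (subst nn_integral_density) (auto simp: mult.commute)
      finally have "ennreal ((\<bar>u x\<bar> / 2) powr p) \<le> ennreal (2 powr p * 5 powr (p - 1)) *
          (\<integral>\<^sup>+r. ?G (x + r *\<^sub>R e) \<partial>density lborel (indicator {0..5}))"
        using p g by (intro powr_le_nn_integral) (auto simp: emeasure_density)
      then have "ennreal (2 powr p) * ennreal ((\<bar>u x\<bar> / 2) powr p) \<le> ennreal (2 powr p) * (ennreal (2 powr p * 5 powr (p - 1)) *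
          ?S x)"
        by (intro mult_left_mono) (simp_all add: nn_integral_density)
      also have "\<dots> = ennreal (2 powr p * (2 powr p * 5 powr (p - 1))) * ?S x"
        by (simp add: ennreal_mult' mult.assoc)
      also have "2 powr p * (2 powr p * 5 powr (p - 1)) = ?c"
        using powr_mult[of 2 2 p] by simp
      finally show ?thesis
        by (simp add: powr_divide add_increasing flip: ennreal_mult')
    qed
    show ?thesis by (intro add_increasing[OF _ pw2]) simp
  qed
  have m: "(\<lambda>x. \<integral>\<^sup>+r. indicator {0..5} r * ?G (x + r *\<^sub>R e) \<partial>lborel) \<in> borel_measurable lborel"
    by measurable
  have "(\<integral>\<^sup>+x. \<integral>\<^sup>+r. indicator {0..5} r * ?G (x + r *\<^sub>R e) \<partial>lborel \<partial>lborel) =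
      (\<integral>\<^sup>+r. \<integral>\<^sup>+x. indicator {0..5} r * ?G (x + r *\<^sub>R e) \<partial>lborel \<partial>lborel)"
    by (rule lborel_pair.Fubini') simp
  also have "\<dots> = (\<integral>\<^sup>+r. integral\<^sup>N lborel ?G * indicator {0..5::real} r \<partial>lborel)"
    by (simp add: nn_integral_cmult nn_integral_lborel_translate[of ?G] mult.commute)
  also have "\<dots> = 5 * integral\<^sup>N lborel ?G"
    by (subst nn_integral_cmult_indicator) (auto simp: mult.commute)
  finally have it: "(\<integral>\<^sup>+x. \<integral>\<^sup>+r. indicator {0..5} r * ?G (x + r *\<^sub>R e) \<partial>lborel \<partial>lborel) = 5 * integral\<^sup>N lborel ?G" .
  have "abs_powr_int p u \<le> (\<integral>\<^sup>+x. ?G x + (ennreal (2 powr p) * ?G (x + 5 *\<^sub>R e) +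
      ennreal ?c * ?S x) \<partial>lborel)"
    by (intro nn_integral_mono pw)
  also have "\<dots> = integral\<^sup>N lborel ?G + (ennreal (2 powr p) * integral\<^sup>N lborel ?G + ennreal ?c * (5 * integral\<^sup>N lborel ?G))"
    using m by (simp add: nn_integral_add nn_integral_cmult nn_integral_lborel_translate[of ?G] it)
  also have "\<dots> = (ennreal 1 + (ennreal (2 powr p) + ennreal ?c * ennreal 5)) * integral\<^sup>N lborel ?G"
    by (simp add: distrib_right mult.assoc)
  also have "ennreal 1 + (ennreal (2 powr p) + ennreal ?c * ennreal 5) = ennreal (1 + 2 powr p + 4 powr p * 5 powr p)"
    using ennreal_mult''[of 5 ?c] by (simp add: powr_diff add.assoc)
  finally show ?thesis .
qed

text \<open>The comparison outside the ball of radius 2 replaces an L^p bound on \<open>u\<close>.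
  For a mollified function it follows from the bound on |x| |f|: radius 2 leaves room for a
  mollification scale up to 1 while |y| >= 1 still holds at the points averaged over.\<close>

lemma sobolev_confined:
  fixes p q :: real
  assumes p: "1 \<le> p" "p \<le> q" and pq: "real DIM('a::euclidean_space) * (q - p) \<le> p * q"
  obtains C where "C > 0"
    "\<And>(u :: 'a \<Rightarrow> real) g N. C1_dominated u g \<Longrightarrow> N > 0 \<Longrightarrow> (\<And>x. norm x \<ge> 2 \<Longrightarrow> \<bar>u x\<bar> \<le> g x) \<Longrightarrow>
      powr_int p g \<le> ennreal (N powr p) \<Longrightarrow>
      abs_powr_int q u \<le> ennreal (C * N powr q)"
proof -
  define k :: real where "k = 1 + 2 powr p + 4 powr p * 5 powr p"
  have k: "k \<ge> 1" by (simp add: k_def)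
  have base: "abs_powr_int p u \<le> ennreal (k * N powr p)"
    if "C1_dominated u g" "\<And>x. norm x \<ge> 2 \<Longrightarrow> \<bar>u x\<bar> \<le> g x"
      "powr_int p g \<le> ennreal (N powr p)" for u :: "'a \<Rightarrow> real" and g N
  proof -
    have "abs_powr_int p u \<le> ennreal k * powr_int p g"
      unfolding k_def using powr_integral_confined[OF that(1) p(1) that(2)] .
    also have "\<dots> \<le> ennreal k * ennreal (N powr p)" by (intro mult_left_mono that(3)) simp
    finally show ?thesis using k by (simp add: ennreal_mult')
  qed
  show thesis
  proof (cases "p = q")
    case True
    then show ?thesis using base k by (intro that[of k]) auto
  next
    case False
    with p have "p < q" by simp
    then obtain C where C: "C > 0" and strong:
      "\<And>(u :: 'a \<Rightarrow> real) g N. C1_dominated u g \<Longrightarrow> N > 0 \<Longrightarrow>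
        powr_int p g \<le> ennreal (N powr p) \<Longrightarrow>
        abs_powr_int p u \<le> ennreal (N powr p) \<Longrightarrow>
        (\<integral>\<^sup>+x. ennreal (max 0 (u x) powr q) \<partial>lborel) \<le> ennreal (C * N powr q)"
      using strong_type_pos_part[OF p(1) _ pq] by blast
    \<comment> \<open>After enlarging \<open>N\<close> by the factor \<open>l >= 1\<close>, one
      number bounds the L^p integrals of both \<open>u\<close> and \<open>g\<close>, as
      \<open>strong\<close> requires.\<close>
    define l where "l = k powr (1 / p)"
    have l: "l \<ge> 1" "l powr p = k"
      using k p by (auto simp: l_def powr_powr ge_one_powr_ge_zero)
    show ?thesis
    proof (rule that[of "2 * C * l powr q"])
      show "2 * C * l powr q > 0" using C l by simp
      fix u :: "'a \<Rightarrow> real" and g N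
      assume dom: "C1_dominated u g" and N: "N > 0" and out: "\<And>x. norm x \<ge> 2 \<Longrightarrow> \<bar>u x\<bar> \<le> g x"
        and ig: "powr_int p g \<le> ennreal (N powr p)"
      note [measurable] = C1_dominated_measurable[OF dom]
      have lN: "(l * N) powr p = k * N powr p" using l N by (simp add: powr_mult)
      have iu: "abs_powr_int p u \<le> ennreal ((l * N) powr p)"
        unfolding lN using base[OF dom out ig] .
      have "N powr p \<le> k * N powr p" using mult_right_mono[OF k, of "N powr p"] by simp
      then have ig': "powr_int p g \<le> ennreal ((l * N) powr p)"
        unfolding lN using ig by (meson ennreal_leI order_trans)
      have "abs_powr_int q u \<le>
          (\<integral>\<^sup>+x. ennreal (max 0 (u x) powr q) + ennreal (max 0 (- u x) powr q) \<partial>lborel)"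
        using p by (intro nn_integral_mono) (auto simp: max_def abs_if)
      also have "\<dots> = (\<integral>\<^sup>+x. ennreal (max 0 (u x) powr q) \<partial>lborel) + (\<integral>\<^sup>+x. ennreal (max 0 (- u x) powr q) \<partial>lborel)"
        by (simp add: nn_integral_add)
      also have "\<dots> \<le> ennreal (C * (l * N) powr q) + ennreal (C * (l * N) powr q)"
        using l N iu ig' dom by (intro add_mono strong[of _ g] C1_dominated_uminus) auto
      also have "\<dots> = ennreal (2 * C * l powr q * N powr q)"
        using C l N by (simp add: powr_mult flip: ennreal_plus)
      finally show "abs_powr_int q u \<le> ennreal (2 * C * l powr q * N powr q)" .
    qed
  qed
qed

section \<open>Mollifiers\<close>

lemma partial_deriv_eq:
  assumes "(f has_derivative f') (at x)"
  shows "partial_deriv j f x = f' (axis j 1)"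
  using frechet_derivative_at[OF assms] by (simp add: partial_deriv_def)

lemma C_diff_continuous: "C_diff k f \<Longrightarrow> continuous_on UNIV f"
  by (cases k) (auto intro!: differentiable_imp_continuous_on simp: differentiable_on_def
      intro: differentiable_at_withinI)

lemma C_diff_Suc_imp: "C_diff (Suc k) f \<Longrightarrow> C_diff k f"
proof (induction k arbitrary: f)
  case 0
  then show ?case using C_diff_continuous by fastforce
next
  case (Suc k)
  then show ?case by (metis C_diff.simps(2))
qed

lemma C_diff_const: "C_diff k (\<lambda>x :: real ^ 'n::finite. c)"
proof (induction k arbitrary: c)
  case (Suc k)
  have "partial_deriv j (\<lambda>x. c) = (\<lambda>x. 0)" for j :: 'n
    by (rule ext) (simp add: partial_deriv_eq[OF has_derivative_const])
  with Suc show ?case by simp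
qed simp

lemma C_diff_nth: "C_diff k (\<lambda>x :: real ^ 'n::finite. x $ i)"
proof (cases k)
  case (Suc l)
  have der: "((\<lambda>x. x $ i) has_derivative (\<lambda>x. x $ i)) (at x)" for x :: "real ^ 'n"
    by (rule bounded_linear_imp_has_derivative) (rule bounded_linear_vec_nth)
  have "partial_deriv j (\<lambda>x. x $ i) = (\<lambda>x. axis j 1 $ i)" for j
    by (rule ext) (rule partial_deriv_eq[OF der])
  then show ?thesis
    using Suc der C_diff_const[of l] by (auto simp: differentiable_def)
qed (auto intro!: continuous_intros)

lemma C_diff_add: "C_diff k f \<Longrightarrow> C_diff k g \<Longrightarrow> C_diff k (\<lambda>x :: real ^ 'n::finite. f x + g x)"
proof (induction k arbitrary: f g)
  case (Suc k)
  have "partial_deriv j (\<lambda>x. f x + g x) = (\<lambda>x. partial_deriv j f x + partial_deriv j g x)" for j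
  proof (rule ext)
    fix x
    have "(f has_derivative frechet_derivative f (at x)) (at x)" "(g has_derivative frechet_derivative g (at x)) (at x)"
      using Suc.prems by (auto simp: frechet_derivative_works)
    from partial_deriv_eq[OF has_derivative_add[OF this]]
    show "partial_deriv j (\<lambda>x. f x + g x) x = partial_deriv j f x + partial_deriv j g x"
      by (simp add: partial_deriv_def)
  qed
  with Suc show ?case by auto
qed (auto intro: continuous_on_add)

lemma C_diff_mult: "C_diff k f \<Longrightarrow> C_diff k g \<Longrightarrow> C_diff k (\<lambda>x :: real ^ 'n::finite. f x * g x)"
proof (induction k arbitrary: f g)
  case (Suc k)
  have "partial_deriv j (\<lambda>x. f x * g x) = (\<lambda>x. f x * partial_deriv j g x + partial_deriv j f x * g x)" for j
  proof (rule ext)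
    fix x
    have "(f has_derivative frechet_derivative f (at x)) (at x)" "(g has_derivative frechet_derivative g (at x)) (at x)"
      using Suc.prems by (auto simp: frechet_derivative_works)
    from partial_deriv_eq[OF has_derivative_mult[OF this]]
    show "partial_deriv j (\<lambda>x. f x * g x) x = f x * partial_deriv j g x + partial_deriv j f x * g x"
      by (simp add: partial_deriv_def)
  qed
  with Suc show ?case
    by (auto intro!: C_diff_add Suc.IH simp: C_diff_Suc_imp)
qed (auto intro: continuous_on_mult)

lemma C_diff_sum:
  assumes "\<And>i. i \<in> I \<Longrightarrow> C_diff k (f i)"
  shows "C_diff k (\<lambda>x :: real ^ 'n::finite. \<Sum>i\<in>I. f i x)"
  using assms by (induction I rule: infinite_finite_induct) (auto intro: C_diff_const C_diff_add)

text \<open>The span of these functions is closed under differentiation, so smoothness follows by induction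
  over all \<open>m\<close> at once.\<close>

definition bump :: "nat \<Rightarrow> real \<Rightarrow> real"
  where "bump m t = (if t > 0 then inverse t ^ m * exp (- inverse t) else 0)"

lemma bump_tendsto_0: "(bump m \<longlongrightarrow> 0) (at 0)"
proof -
  have "((\<lambda>t. inverse t ^ m / exp (inverse t)) \<longlongrightarrow> (0::real)) (at_right 0)"
    using filterlim_compose[OF tendsto_power_div_exp_0 filterlim_inverse_at_top_right] .
  then have "(bump m \<longlongrightarrow> 0) (at_right 0)"
    by (rule Lim_transform_eventually)
      (auto simp: eventually_at_right_field bump_def exp_minus field_simps intro!: exI[of _ 1])
  moreover have "(bump m \<longlongrightarrow> 0) (at_left 0)"
    by (rule tendsto_eventually) (auto simp: eventually_at_left_field bump_def intro!: exI[of _ "-1"])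
  ultimately show ?thesis by (simp add: filterlim_split_at_real)
qed

lemma bump_has_derivative:
  "(bump m has_real_derivative bump (m + 2) t - real m * bump (m + 1) t) (at t)"
proof -
  consider "t > 0" | "t < 0" | "t = 0" by linarith
  then show ?thesis
  proof cases
    case 1
    have "((\<lambda>t. inverse t ^ m * exp (- inverse t)) has_real_derivative bump (m + 2) t - real m * bump (m + 1) t) (at t)"
      using 1 power_minus_mult[of m "inverse t"]
      by (cases "m = 0") (auto intro!: derivative_eq_intros simp: bump_def power2_eq_square algebra_simps)
    then show ?thesis
      by (rule has_field_derivative_transform_within_open[of _ _ _ "{0<..}"]) (use 1 in \<open>auto simp: bump_def\<close>)
  next
    case 2
    have "((\<lambda>t. 0) has_real_derivative 0) (at t)" by simp
    then have "(bump m has_real_derivative 0) (at t)"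
      by (rule has_field_derivative_transform_within_open[of _ _ _ "{..<0}"]) (use 2 in \<open>auto simp: bump_def\<close>)
    then show ?thesis using 2 by (simp add: bump_def)
  next
    case 3
    \<comment> \<open>The difference quotient of \<open>bump m\<close> at 0 is
      \<open>bump (m + 1)\<close>, which tends to 0.\<close>
    have "((\<lambda>h. (bump m h - bump m 0) / (h - 0)) \<longlongrightarrow> 0) (at 0)"
      by (rule Lim_transform_eventually[OF bump_tendsto_0[of "m + 1"]])
        (auto simp: eventually_at bump_def divide_inverse mult_ac intro!: exI[of _ 1])
    then show ?thesis using 3 by (simp add: has_field_derivative_iff bump_def)
  qed
qed

lemma continuous_bump: "continuous_on A (bump m)"
  by (meson DERIV_isCont bump_has_derivative continuous_at_imp_continuous_on)

lemma C_diff_bump: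
  assumes "\<And>k. C_diff k w"
  shows "C_diff k (\<lambda>x :: real ^ 'n::finite. bump m (w x))"
proof (induction k arbitrary: m)
  case 0
  have "continuous_on UNIV w" using C_diff_continuous[OF assms[of 0]] .
  then show ?case
    using continuous_on_compose2[OF continuous_bump] by auto
next
  case (Suc k)
  have der: "((\<lambda>x. bump m (w x)) has_derivative
      (\<lambda>v. (bump (m + 2) (w x) - real m * bump (m + 1) (w x)) * frechet_derivative w (at x) v)) (at x)" for x
  proof -
    have "(w has_derivative frechet_derivative w (at x)) (at x)"
      using assms[of 1] by (auto simp: frechet_derivative_works)
    from has_derivative_compose[OF this bump_has_derivative[unfolded has_field_derivative_def]]
    show ?thesis .
  qed
  have "partial_deriv j (\<lambda>x. bump m (w x)) =
      (\<lambda>x. (bump (m + 2) (w x) + (- real m) * bump (m + 1) (w x)) * partial_deriv j w x)" for j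
    by (rule ext) (simp add: partial_deriv_eq[OF der] partial_deriv_def)
  moreover have "C_diff k (partial_deriv j w)" for j using assms[of "Suc k"] by simp
  ultimately have "C_diff k (partial_deriv j (\<lambda>x. bump m (w x)))" for j
    using Suc by (simp only:) (intro C_diff_mult C_diff_add C_diff_const)
  then show ?case using der by (auto simp: differentiable_def)
qed

text \<open>Normalised separately for each \<open>e\<close>, instead of rescaling one profile. The
  argument of \<open>bump 0\<close> is a polynomial in the coordinates that is positive exactly on
  the open ball of radius \<open>e\<close>, so smoothness reduces to that of
  \<open>bump\<close>.\<close>

definition mollifier :: "real \<Rightarrow> real ^ 'n::finite \<Rightarrow> real"
  where "mollifier e z =
    bump 0 (e\<^sup>2 - (norm z)\<^sup>2) / (LINT y|lborel. bump 0 (e\<^sup>2 - (norm (y :: real ^ 'n))\<^sup>2))"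

lemma norm_square_coordinates: "(norm (z :: real ^ 'n::finite))\<^sup>2 = (\<Sum>j\<in>UNIV. z $ j * z $ j)"
  unfolding power2_norm_eq_inner inner_vec_def by simp

lemma bump_ball:
  assumes "e > 0"
  shows "bump m (e\<^sup>2 - (norm z)\<^sup>2) = 0 \<longleftrightarrow> e \<le> norm z" "bump m s \<ge> 0"
proof -
  have "(norm z)\<^sup>2 < e\<^sup>2 \<longleftrightarrow> norm z < e"
    using assms by (auto intro: power2_less_imp_less power_strict_mono)
  then show "bump m (e\<^sup>2 - (norm z)\<^sup>2) = 0 \<longleftrightarrow> e \<le> norm z"
    by (auto simp: bump_def)
qed (simp add: bump_def)

lemma continuous_bump_ball: "continuous_on A (\<lambda>z :: 'a::real_normed_vector. bump m (e\<^sup>2 - (norm z)\<^sup>2))"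
  by (rule continuous_on_compose2[OF continuous_bump[of UNIV]]) (auto intro!: continuous_intros)

lemma integral_bump_pos:
  assumes "e > 0"
  shows "(LINT y|lborel. bump 0 (e\<^sup>2 - (norm (y :: 'a::euclidean_space))\<^sup>2)) > 0"
    "integrable lborel (\<lambda>y :: 'a. bump 0 (e\<^sup>2 - (norm y)\<^sup>2))"
proof -
  let ?f = "\<lambda>y :: 'a. bump 0 (e\<^sup>2 - (norm y)\<^sup>2)"
  have "integrable lborel (\<lambda>y :: 'a. indicator (cball 0 e) y *\<^sub>R ?f y)"
    by (rule borel_integrable_compact) (auto intro: continuous_bump_ball)
  moreover have "(\<lambda>y. indicator (cball 0 e) y *\<^sub>R ?f y) = ?f"
    proof (rule ext)
    show "indicator (cball 0 e) y *\<^sub>R ?f y = ?f y" for y :: 'a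
      using bump_ball(1)[OF assms, of 0 y] by (auto simp: indicator_def)
  qed
  ultimately show int: "integrable lborel ?f" by (rule back_subst)
  have "integral\<^sup>L lborel ?f \<noteq> 0"
  proof
    assume "integral\<^sup>L lborel ?f = 0"
    then have "AE y in lborel. ?f y = 0"
      using integral_nonneg_eq_0_iff_AE[OF int] bump_ball[OF assms] by auto
    then have "AE y in lborel. y \<notin> ball (0::'a) e"
      by eventually_elim (auto simp: bump_ball(1)[OF assms])
    then have "emeasure lborel (ball (0::'a) e) = 0"
      by (subst (asm) AE_iff_measurable[OF _ refl]) (auto simp: ball_def)
    moreover have "unit_ball_vol (real DIM('a)) \<noteq> 0"
      using unit_ball_vol_pos[of "real DIM('a)"] by linarith
    ultimately show False using assms by (simp add: emeasure_ball)
  qed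
  moreover have "integral\<^sup>L lborel ?f \<ge> 0"
    using bump_ball(2)[OF assms] by (intro integral_nonneg_AE) auto
  ultimately show "integral\<^sup>L lborel ?f > 0" by simp
qed

lemma mollifier_props:
  assumes e: "e > 0"
  shows "mollifier e (z :: real ^ 'n::finite) \<ge> 0" "norm z \<ge> e \<Longrightarrow> mollifier e z = 0"
    "continuous_on UNIV (mollifier e :: real ^ 'n \<Rightarrow> real)"
    "(\<integral>\<^sup>+z. ennreal (mollifier e (z :: real ^ 'n)) \<partial>lborel) = 1"
proof -
  note pos = integral_bump_pos[OF e, where 'a = "real ^ 'n"]
  show "mollifier e z \<ge> 0" "norm z \<ge> e \<Longrightarrow> mollifier e z = 0"
    using pos bump_ball(1)[OF e, of 0] bump_ball(2)[OF e, of 0] by (auto simp: mollifier_def)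
  show "continuous_on UNIV (mollifier e :: real ^ 'n \<Rightarrow> real)"
    unfolding mollifier_def[abs_def] using pos by (intro continuous_on_divide continuous_bump_ball) auto
  have "(\<integral>\<^sup>+z. ennreal (mollifier e (z :: real ^ 'n)) \<partial>lborel) =
      ennreal (LINT z|lborel. mollifier e (z :: real ^ 'n))"
    unfolding mollifier_def using pos bump_ball[OF e]
    by (intro nn_integral_eq_integral) auto
  also have "\<dots> = 1" using pos by (simp add: mollifier_def[abs_def])
  finally show "(\<integral>\<^sup>+z. ennreal (mollifier e (z :: real ^ 'n)) \<partial>lborel) = 1" .
qed

text \<open>\<open>bump 2\<close> is the derivative of \<open>bump 0\<close>, and the factor
  \<open>- 2 * (z \<bullet> w)\<close> is the derivative of -|z|^2 in direction
  \<open>w\<close>.\<close>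

definition mollifier_deriv :: "real \<Rightarrow> real ^ 'n::finite \<Rightarrow> real ^ 'n \<Rightarrow> real"
  where "mollifier_deriv e z w = bump 2 (e\<^sup>2 - (norm z)\<^sup>2) * (- 2 * (z \<bullet> w)) /
    (LINT y|lborel. bump 0 (e\<^sup>2 - (norm (y :: real ^ 'n))\<^sup>2))"

abbreviation mollifier_partial :: "real \<Rightarrow> 'n \<Rightarrow> real ^ 'n::finite \<Rightarrow> real"
  where "mollifier_partial e j \<equiv> (\<lambda>z. mollifier_deriv e z (axis j 1))"

lemma mollifier_has_derivative:
  assumes e: "e > 0"
  shows "(mollifier e has_derivative mollifier_deriv e z) (at (z :: real ^ 'n::finite))"
proof -
  have n: "(norm y)\<^sup>2 = y \<bullet> y" for y :: "real ^ 'n" by (simp add: power2_norm_eq_inner)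
  have "((\<lambda>z :: real ^ 'n. e\<^sup>2 - z \<bullet> z) has_derivative (\<lambda>w. - 2 * (z \<bullet> w))) (at z)"
    by (auto intro!: derivative_eq_intros simp: inner_commute)
  from has_derivative_compose[OF this bump_has_derivative[of 0, unfolded has_field_derivative_def]]
  have "((\<lambda>z. bump 0 (e\<^sup>2 - z \<bullet> z)) has_derivative (\<lambda>w. bump 2 (e\<^sup>2 - z \<bullet> z) * (- 2 * (z \<bullet> w)))) (at z)"
    by (simp add: eval_nat_numeral)
  from has_derivative_divide'[OF this has_derivative_const, of "LINT y|lborel. bump 0 (e\<^sup>2 - (norm (y :: real ^ 'n))\<^sup>2)"]
  show ?thesis
    using integral_bump_pos[OF e, where 'a = "real ^ 'n"]
    unfolding mollifier_def[abs_def] mollifier_deriv_def[abs_def] n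
    by simp
qed

lemma mollifier_deriv_props:
  assumes e: "e > 0"
  shows "norm z \<ge> e \<Longrightarrow> mollifier_deriv e z w = 0"
    "continuous_on UNIV (\<lambda>z :: real ^ 'n::finite. mollifier_deriv e z w)"
    "linear (mollifier_deriv e z)"
proof -
  show "norm z \<ge> e \<Longrightarrow> mollifier_deriv e z w = 0"
    using bump_ball(1)[OF e, of 2] by (auto simp: mollifier_deriv_def)
  show "continuous_on UNIV (\<lambda>z :: real ^ 'n::finite. mollifier_deriv e z w)"
    unfolding mollifier_deriv_def using integral_bump_pos[OF e, where 'a = "real ^ 'n"]
    by (auto intro!: continuous_intros continuous_bump_ball)
  show "linear (mollifier_deriv e z)"
    using has_derivative_linear[OF mollifier_has_derivative[OF e]] .
qed

text \<open>Pairing a distribution with these test functions produces mollifications at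
  \<open>x\<close>. The minus sign, from the inner derivative of \<open>x - y\<close>, cancels the
  one in \<open>distr_partial\<close>.\<close>

lemma test_function_mollifier:
  assumes e: "e > 0"
  shows "test_function (\<lambda>y :: real ^ 'n::finite. mollifier e (x - y))"
    "partial_deriv j (\<lambda>y. mollifier e (x - y)) y = - mollifier_deriv e (x - y) (axis j 1)"
proof -
  let ?c = "LINT y|lborel. bump 0 (e\<^sup>2 - (norm (y :: real ^ 'n))\<^sup>2)"
  have "C_diff k (\<lambda>y. e\<^sup>2 + (- 1) * (\<Sum>j\<in>UNIV. (x $ j + (- 1) * y $ j) * (x $ j + (- 1) * y $ j)))" for k
    by (intro C_diff_add C_diff_mult C_diff_sum C_diff_const C_diff_nth)
  from C_diff_mult[OF C_diff_const[of _ "1 / ?c"] C_diff_bump[OF this, of _ 0]]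
  have "C_diff k (\<lambda>y. mollifier e (x - y))" for k
    by (simp add: mollifier_def norm_square_coordinates)
  moreover have "compact (closure (support_on UNIV (\<lambda>y. mollifier e (x - y))))"
  proof (rule compact_closure[THEN iffD2], rule bounded_subset[OF bounded_cball])
    show "support_on UNIV (\<lambda>y. mollifier e (x - y)) \<subseteq> cball x e"
    proof
      fix y assume "y \<in> support_on UNIV (\<lambda>y. mollifier e (x - y))"
      then have "mollifier e (x - y) \<noteq> 0" by (simp add: support_on_def)
      then have "norm (x - y) < e" using mollifier_props(2)[OF e, of "x - y"] by (meson not_le)
      then show "y \<in> cball x e" by (simp add: dist_norm)
    qed
  qed
  ultimately show "test_function (\<lambda>y :: real ^ 'n. mollifier e (x - y))"
    by (simp add: test_function_def)
  have "((\<lambda>y. x - y) has_derivative (\<lambda>h. - h)) (at y)"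
    by (auto intro!: derivative_eq_intros)
  from partial_deriv_eq[OF has_derivative_compose[OF this mollifier_has_derivative[OF e]], of j]
  show "partial_deriv j (\<lambda>y. mollifier e (x - y)) y = - mollifier_deriv e (x - y) (axis j 1)"
    by (simp add: mollifier_deriv_def)
qed

section \<open>Continuity of translations in L^1\<close>

abbreviation L1_shift :: "('a::euclidean_space \<Rightarrow> real) \<Rightarrow> 'a \<Rightarrow> ennreal"
  where "L1_shift f z \<equiv> \<integral>\<^sup>+x. ennreal \<bar>f (x + z) - f x\<bar> \<partial>lborel"

definition L1_translation_continuous :: "('a::euclidean_space \<Rightarrow> real) \<Rightarrow> bool"
  where "L1_translation_continuous f \<longleftrightarrow> (\<forall>\<epsilon>>0. \<exists>\<delta>>0. \<forall>z. norm z < \<delta> \<longrightarrow>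
    L1_shift f z \<le> ennreal \<epsilon>)"

text \<open>Regularity of Lebesgue measure. The closed inner set is made compact by intersecting it
  with a large ball; finite measure of \<open>A\<close> makes the part of \<open>A\<close> outside
  that ball small.\<close>

lemma compact_open_sandwich:
  fixes A :: "'a::euclidean_space set"
  assumes A: "A \<in> sets borel" "emeasure lborel A < \<infinity>" and \<epsilon>: "\<epsilon> > 0"
  obtains K U where "compact K" "open U" "K \<subseteq> A" "A \<subseteq> U" "emeasure lborel (U - K) \<le> ennreal \<epsilon>"
proof -
  note [measurable] = A(1)
  have leb: "A \<in> sets lebesgue" using A(1) by auto
  have e3: "\<epsilon> / 3 > 0" using \<epsilon> by simp
  obtain U where U: "open U" "A \<subseteq> U" "emeasure lebesgue (U - A) < ennreal (\<epsilon> / 3)"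
    using sets_lebesgue_outer_open[OF leb e3] by metis
  obtain C where C: "closed C" "C \<subseteq> A" "emeasure lebesgue (A - C) < ennreal (\<epsilon> / 3)"
    using sets_lebesgue_inner_closed[OF leb e3] by metis
  have [measurable]: "U \<in> sets borel" "C \<in> sets borel" using U C by auto
  have "(\<lambda>n. emeasure lborel (A - cball 0 (real n))) \<longlonglongrightarrow> emeasure lborel (\<Inter>n. A - cball 0 (real n))"
  proof (rule Lim_emeasure_decseq)
    show "decseq (\<lambda>n. A - cball 0 (real n))"
      by (rule antimonoI) auto
    show "emeasure lborel (A - cball 0 (real n)) \<noteq> \<infinity>" for n
      using A(2) emeasure_mono[of "A - cball 0 (real n)" A lborel] by (auto simp: top_unique)
  qed auto
  moreover have "(\<Inter>n. A - cball 0 (real n)) = {}"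
    by (auto intro: real_arch_simple)
  ultimately have "(\<lambda>n. emeasure lborel (A - cball 0 (real n))) \<longlonglongrightarrow> 0"
    by (simp only: emeasure_empty)
  then have "eventually (\<lambda>n. emeasure lborel (A - cball 0 (real n)) < ennreal (\<epsilon> / 3)) sequentially"
    using e3 by (intro order_tendstoD) auto
  then obtain n where n: "emeasure lborel (A - cball 0 (real n)) < ennreal (\<epsilon> / 3)"
    by (auto simp: eventually_sequentially)
  have "emeasure lborel (U - C \<inter> cball 0 (real n)) \<le> emeasure lborel ((U - A) \<union> ((A - C) \<union> (A - cball 0 (real n))))"
    by (intro emeasure_mono) auto
  also have "\<dots> \<le> emeasure lborel (U - A) + (emeasure lborel (A - C) + emeasure lborel (A - cball 0 (real n)))"
    by (intro order_trans[OF emeasure_subadditive] add_left_mono emeasure_subadditive) auto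
  also have "\<dots> \<le> ennreal (\<epsilon> / 3) + (ennreal (\<epsilon> / 3) + ennreal (\<epsilon> / 3))"
    using U(3) C(3) n by (intro add_mono) auto
  also have "\<dots> = ennreal \<epsilon>" using \<epsilon> by (simp flip: ennreal_plus)
  finally show thesis
    using U C by (intro that[of "C \<inter> cball 0 (real n)" U]) (auto intro: closed_Int_compact)
qed

text \<open>If the shift is shorter than the distance from \<open>K\<close> to the complement of
  \<open>U\<close>, the indicator can change between \<open>x\<close> and \<open>x + z\<close> only
  when one of these two points lies in \<open>U - K\<close>.\<close>

lemma L1_translation_continuous_indicator:
  fixes A :: "'a::euclidean_space set"
  assumes A: "A \<in> sets borel" "emeasure lborel A < \<infinity>"
  shows "L1_translation_continuous (\<lambda>x. indicator A x *\<^sub>R c)"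
  unfolding L1_translation_continuous_def
proof (intro allI impI)
  fix \<epsilon> :: real assume \<epsilon>: "\<epsilon> > 0"
  note [measurable] = A(1)
  \<comment> \<open>The \<open>+ 1\<close> keeps the denominator positive when
    \<open>c = 0\<close>.\<close>
  define \<eta> where "\<eta> = \<epsilon> / (2 * (\<bar>c\<bar> + 1))"
  have \<eta>: "\<eta> > 0" using \<epsilon> by (simp add: \<eta>_def add_nonneg_pos)
  obtain K U where KU: "compact K" "open U" "K \<subseteq> A" "A \<subseteq> U" "emeasure lborel (U - K) \<le> ennreal \<eta>"
    using compact_open_sandwich[OF A \<eta>] .
  have [measurable]: "U \<in> sets borel" "K \<in> sets borel" using KU by (auto intro: borel_compact)
  obtain \<delta> where \<delta>: "\<delta> > 0" "(\<Union>x\<in>K. ball x \<delta>) \<subseteq> U"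
    using compact_subset_open_imp_ball_epsilon_subset[of K U] KU by blast
  have "(\<integral>\<^sup>+x. ennreal \<bar>indicator A (x + z) *\<^sub>R c - indicator A x *\<^sub>R c\<bar> \<partial>lborel) \<le> ennreal \<epsilon>" if z: "norm z < \<delta>" for z
  proof -
    have sub: "x + z \<in> U" "x - z \<in> U" if "x \<in> K" for x
      using \<delta>(2) that z by (force simp: dist_norm)+
    have "(\<integral>\<^sup>+x. ennreal \<bar>indicator A (x + z) *\<^sub>R c - indicator A x *\<^sub>R c\<bar> \<partial>lborel) \<le>
        (\<integral>\<^sup>+x. ennreal \<bar>c\<bar> * (indicator (U - K) x + indicator (U - K) (x + z)) \<partial>lborel)"
    proof (intro nn_integral_mono)
      fix x
      consider "x \<in> A \<longleftrightarrow> x + z \<in> A" | "x \<in> U - K" "x \<in> A \<longleftrightarrow> x + z \<notin> A" | "x + z \<in> U - K" "x \<in> A \<longleftrightarrow> x + z \<notin> A"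
        using sub(1)[of x] sub(2)[of "x + z"] KU(3,4) by auto
      then show "ennreal \<bar>indicator A (x + z) *\<^sub>R c - indicator A x *\<^sub>R c\<bar> \<le>
          ennreal \<bar>c\<bar> * (indicator (U - K) x + indicator (U - K) (x + z))"
        by cases (auto simp: indicator_def distrib_left)
    qed
    also have "\<dots> = ennreal \<bar>c\<bar> * (emeasure lborel (U - K) + emeasure lborel (U - K))"
      using nn_integral_lborel_translate[of "indicator (U - K)" z]
      by (simp add: nn_integral_cmult nn_integral_add)
    also have "\<dots> \<le> ennreal \<bar>c\<bar> * (ennreal \<eta> + ennreal \<eta>)"
      using KU(5) by (intro mult_left_mono add_mono) auto
    also have "\<dots> = ennreal (\<bar>c\<bar> * (2 * \<eta>))" using \<eta> by (simp flip: ennreal_plus ennreal_mult')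
    also have "\<dots> \<le> ennreal \<epsilon>"
    proof (rule ennreal_leI)
      have "\<bar>c\<bar> * (2 * \<eta>) \<le> (\<bar>c\<bar> + 1) * (2 * \<eta>)" using \<eta> by (intro mult_right_mono) auto
      also have "\<dots> = \<epsilon>"
      proof -
        have "X * (2 * (\<epsilon> / (2 * X))) = \<epsilon>" if "X > 0" for X using that by simp
        then show ?thesis unfolding \<eta>_def by (metis abs_ge_zero add_nonneg_pos zero_less_one)
      qed
      finally show "\<bar>c\<bar> * (2 * \<eta>) \<le> \<epsilon>" .
    qed
    finally show ?thesis .
  qed
  with \<delta> show "\<exists>\<delta>>0. \<forall>z. norm z < \<delta> \<longrightarrow>
      (\<integral>\<^sup>+x. ennreal \<bar>indicator A (x + z) *\<^sub>R c - indicator A x *\<^sub>R c\<bar> \<partial>lborel) \<le> ennreal \<epsilon>"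
    by blast
qed

text \<open>Induction over simple functions and L^1 limits. Translations preserve the L^1 distance,
  so replacing \<open>f\<close> by an approximation costs that distance twice, once at
  \<open>x + z\<close> and once at \<open>x\<close>.\<close>

lemma L1_translation_continuous_integrable:
  fixes f :: "'a::euclidean_space \<Rightarrow> real"
  assumes "integrable lborel f"
  shows "L1_translation_continuous f"
  using assms
proof induction
  case (base A c)
  then show ?case by (intro L1_translation_continuous_indicator) auto
next
  case (add f g)
  note [measurable] = borel_measurable_integrable[OF add(1)] borel_measurable_integrable[OF add(2)]
  show ?case
    unfolding L1_translation_continuous_def
  proof (intro allI impI)
    fix \<epsilon> :: real assume "\<epsilon> > 0"
    then have e: "\<epsilon> / 2 > 0" by simp
    obtain d1 where d1: "d1 > 0" "\<And>z. norm z < d1 \<Longrightarrow> L1_shift f z \<le> ennreal (\<epsilon> / 2)"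
      using add(3) e unfolding L1_translation_continuous_def by blast
    obtain d2 where d2: "d2 > 0" "\<And>z. norm z < d2 \<Longrightarrow> L1_shift g z \<le> ennreal (\<epsilon> / 2)"
      using add(4) e unfolding L1_translation_continuous_def by blast
    have "(\<integral>\<^sup>+x. ennreal \<bar>f (x + z) + g (x + z) - (f x + g x)\<bar> \<partial>lborel) \<le> ennreal \<epsilon>" if z: "norm z < min d1 d2" for z
    proof -
      have "(\<integral>\<^sup>+x. ennreal \<bar>f (x + z) + g (x + z) - (f x + g x)\<bar> \<partial>lborel) \<le>
          (\<integral>\<^sup>+x. ennreal \<bar>f (x + z) - f x\<bar> + ennreal \<bar>g (x + z) - g x\<bar> \<partial>lborel)"
        by (intro nn_integral_mono) (auto simp flip: ennreal_plus intro!: ennreal_leI)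
      also have "\<dots> = L1_shift f z + L1_shift g z"
        by (intro nn_integral_add) auto
      also have "\<dots> \<le> ennreal (\<epsilon> / 2) + ennreal (\<epsilon> / 2)"
        using z by (intro add_mono d1 d2) auto
      also have "\<dots> = ennreal \<epsilon>" using e by (simp flip: ennreal_plus)
      finally show ?thesis .
    qed
    then show "\<exists>\<delta>>0. \<forall>z. norm z < \<delta> \<longrightarrow> (\<integral>\<^sup>+x. ennreal \<bar>f (x + z) + g (x + z) - (f x + g x)\<bar> \<partial>lborel) \<le> ennreal \<epsilon>"
      using d1 d2 by (intro exI[of _ "min d1 d2"]) auto
  qed
next
  case (lim f s)
  note [measurable] = borel_measurable_integrable[OF lim(1)] borel_measurable_integrable[OF lim(4)]
  show ?case
    unfolding L1_translation_continuous_def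
  proof (intro allI impI)
    fix \<epsilon> :: real assume "\<epsilon> > 0"
    then have e: "\<epsilon> / 3 > 0" by simp
    have "(\<lambda>i. \<integral>\<^sup>+x. ennreal (norm (f x - s i x)) \<partial>lborel) \<longlonglongrightarrow> 0"
    proof (rule nn_integral_dominated_convergence_norm[where w = "\<lambda>x. 2 * norm (f x)"])
      show "(\<integral>\<^sup>+x. ennreal (2 * norm (f x)) \<partial>lborel) < \<infinity>"
        using lim(4) by (simp add: integrable_iff_bounded ennreal_mult' nn_integral_cmult ennreal_mult_less_top)
    qed (use lim in auto)
    then have "eventually (\<lambda>i. (\<integral>\<^sup>+x. ennreal (norm (f x - s i x)) \<partial>lborel) < ennreal (\<epsilon> / 3)) sequentially"
      using e by (intro order_tendstoD) auto
    then obtain i where i: "(\<integral>\<^sup>+x. ennreal (norm (f x - s i x)) \<partial>lborel) < ennreal (\<epsilon> / 3)"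
      by (auto simp: eventually_sequentially)
    obtain d where d: "d > 0" "\<And>z. norm z < d \<Longrightarrow> L1_shift (s i) z \<le> ennreal (\<epsilon> / 3)"
      using lim(5)[of i] e unfolding L1_translation_continuous_def by blast
    have "L1_shift f z \<le> ennreal \<epsilon>" if z: "norm z < d" for z
    proof -
      let ?D = "\<lambda>x. ennreal (norm (f x - s i x))"
      have "L1_shift f z \<le>
          (\<integral>\<^sup>+x. ?D (x + z) + (ennreal \<bar>s i (x + z) - s i x\<bar> + ?D x) \<partial>lborel)"
        by (intro nn_integral_mono) (auto simp flip: ennreal_plus intro!: ennreal_leI)
      also have "\<dots> = (\<integral>\<^sup>+x. ?D (x + z) \<partial>lborel) + (L1_shift (s i) z + (\<integral>\<^sup>+x. ?D x \<partial>lborel))"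
        by (simp add: nn_integral_add)
      also have "(\<integral>\<^sup>+x. ?D (x + z) \<partial>lborel) = (\<integral>\<^sup>+x. ?D x \<partial>lborel)"
        by (intro nn_integral_lborel_translate[of ?D]) auto
      also have "(\<integral>\<^sup>+x. ?D x \<partial>lborel) + (L1_shift (s i) z + (\<integral>\<^sup>+x. ?D x \<partial>lborel)) \<le>
          ennreal (\<epsilon> / 3) + (ennreal (\<epsilon> / 3) + ennreal (\<epsilon> / 3))"
        using z i by (intro add_mono d) auto
      also have "\<dots> = ennreal \<epsilon>" using e by (simp flip: ennreal_plus)
      finally show ?thesis .
    qed
    then show "\<exists>\<delta>>0. \<forall>z. norm z < \<delta> \<longrightarrow> L1_shift f z \<le> ennreal \<epsilon>"
      using d by blast
  qed
qed

section \<open>Convolution with compactly supported kernels\<close>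

text \<open>Borel measurability is demanded so that Fubini's theorem over \<open>lborel\<close>
  applies; Lebesgue measurable data are exchanged for Borel representatives beforehand.\<close>

definition locally_L1 :: "('a::euclidean_space \<Rightarrow> real) \<Rightarrow> bool"
  where "locally_L1 f \<longleftrightarrow> f \<in> borel_measurable borel \<and>
    (\<forall>R. (\<integral>\<^sup>+y. ennreal \<bar>f y\<bar> * indicator (cball 0 R) y \<partial>lborel) < \<infinity>)"

lemma locally_L1_integrable:
  assumes "locally_L1 f"
  shows "integrable lborel (\<lambda>y. \<bar>f y\<bar> * indicator (cball 0 R) y)" "integrable lborel (\<lambda>y. f y * indicator (cball 0 R) y)"
proof -
  have [measurable]: "f \<in> borel_measurable borel" using assms by (simp add: locally_L1_def)
  have "(\<integral>\<^sup>+y. ennreal (norm (f y * indicator (cball 0 R) y)) \<partial>lborel) =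
      (\<integral>\<^sup>+y. ennreal \<bar>f y\<bar> * indicator (cball 0 R) y \<partial>lborel)"
    by (intro nn_integral_cong) (auto simp: indicator_def)
  moreover have [measurable]: "cball (0 :: 'a) R \<in> sets borel" by simp
  have "(\<lambda>y. f y * indicator (cball 0 R) y) \<in> borel_measurable lborel" by measurable
  ultimately show *: "integrable lborel (\<lambda>y. f y * indicator (cball 0 R) y)"
    using assms by (simp add: integrable_iff_bounded locally_L1_def)
  show "integrable lborel (\<lambda>y. \<bar>f y\<bar> * indicator (cball 0 R) y)"
    using integrable_norm[OF *] by (simp add: abs_mult)
qed

definition conv :: "('a::euclidean_space \<Rightarrow> real) \<Rightarrow> ('a \<Rightarrow> real) \<Rightarrow> 'a \<Rightarrow> real"
  where "conv f k x = (LINT y|lborel. f y * k (x - y))"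

lemma bounded_kernel:
  fixes k :: "'a::euclidean_space \<Rightarrow> real"
  assumes "continuous_on UNIV k" "\<And>z. norm z \<ge> e \<Longrightarrow> k z = 0"
  obtains B where "B \<ge> 0" "\<And>z. \<bar>k z\<bar> \<le> B"
proof -
  have "compact (k ` cball 0 e)"
    using assms(1) by (intro compact_continuous_image) (auto intro: continuous_on_subset)
  then have "\<exists>B. \<forall>z\<in>cball 0 e. \<bar>k z\<bar> \<le> B"
    by (auto dest!: compact_imp_bounded simp: bounded_iff)
  then obtain B where B: "\<And>z. z \<in> cball 0 e \<Longrightarrow> \<bar>k z\<bar> \<le> B"
    by blast
  have "\<bar>k z\<bar> \<le> max B 0" for z
  proof (cases "norm z \<ge> e")
    case False
    then show ?thesis using B[of z] by auto
  qed (use assms(2) in auto)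
  then show thesis by (intro that[of "max B 0"]) auto
qed

lemma conv_integrable:
  fixes f :: "'a::euclidean_space \<Rightarrow> real"
  assumes f: "locally_L1 f" and k: "continuous_on UNIV k" "\<And>z. norm z \<ge> e \<Longrightarrow> k z = 0"
  shows "integrable lborel (\<lambda>y. f y * k (x - y))"
proof -
  have [measurable]: "f \<in> borel_measurable borel" "k \<in> borel_measurable borel"
    using f k by (auto simp: locally_L1_def intro: borel_measurable_continuous_onI)
  obtain B where B: "B \<ge> 0" "\<And>z. \<bar>k z\<bar> \<le> B" using bounded_kernel[OF k] by blast
  show ?thesis
  proof (rule Bochner_Integration.integrable_bound)
    show "integrable lborel (\<lambda>y. B * (\<bar>f y\<bar> * indicator (cball 0 (norm x + e)) y))"
      using locally_L1_integrable(1)[OF f] by (rule integrable_mult_right)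
    have "\<bar>f y * k (x - y)\<bar> \<le> B * (\<bar>f y\<bar> * indicator (cball 0 (norm x + e)) y)" for y
    proof (cases "norm (x - y) \<ge> e")
      case False
      then have "y \<in> cball 0 (norm x + e)"
        using norm_triangle_ineq4[of x "x - y"] by simp
      then show ?thesis using mult_left_mono[OF B(2)[of "x - y"], of "\<bar>f y\<bar>"] by (auto simp: abs_mult mult.commute)
    qed (use k B in auto)
    then show "AE y in lborel. norm (f y * k (x - y)) \<le> norm (B * (\<bar>f y\<bar> * indicator (cball 0 (norm x + e)) y))"
      by (auto intro!: AE_I2 intro: order_trans[OF _ abs_ge_self])
  qed auto
qed

lemma conv_continuous:
  fixes f :: "'a::euclidean_space \<Rightarrow> real"
  assumes f: "locally_L1 f" and k: "continuous_on UNIV k" "\<And>z. norm z \<ge> e \<Longrightarrow> k z = 0"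
  shows "continuous_on UNIV (conv f k)"
proof (unfold continuous_on_sequentially, intro allI ballI impI, unfold comp_def conv_def)
  fix X :: "nat \<Rightarrow> 'a" and a
  assume "(\<forall>n. X n \<in> UNIV) \<and> X \<longlonglongrightarrow> a"
  then have X: "X \<longlonglongrightarrow> a" by simp
  have [measurable]: "f \<in> borel_measurable borel" "k \<in> borel_measurable borel"
    using f k by (auto simp: locally_L1_def intro: borel_measurable_continuous_onI)
  obtain B where B: "B \<ge> 0" "\<And>z. \<bar>k z\<bar> \<le> B" using bounded_kernel[OF k] by blast
  obtain R where R: "\<And>n. norm (X n) \<le> R"
    using convergent_imp_bounded[OF X] by (auto simp: bounded_iff)
  show "(\<lambda>n. LINT y|lborel. f y * k (X n - y)) \<longlonglongrightarrow> (LINT y|lborel. f y * k (a - y))"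
  proof (rule integral_dominated_convergence)
    show "integrable lborel (\<lambda>y. B * (\<bar>f y\<bar> * indicator (cball 0 (R + e)) y))"
      using locally_L1_integrable(1)[OF f] by (rule integrable_mult_right)
    have "(\<lambda>n. f y * k (X n - y)) \<longlonglongrightarrow> f y * k (a - y)" for y
      using continuous_on_tendsto_compose[OF k(1) tendsto_diff[OF X tendsto_const[of y]]]
      by (intro tendsto_mult tendsto_const) auto
    then show "AE y in lborel. (\<lambda>n. f y * k (X n - y)) \<longlonglongrightarrow> f y * k (a - y)" by simp
    have "\<bar>f y * k (X n - y)\<bar> \<le> B * (\<bar>f y\<bar> * indicator (cball 0 (R + e)) y)" for y n
    proof (cases "norm (X n - y) \<ge> e")
      case False
      then have "y \<in> cball 0 (R + e)"
        using norm_triangle_ineq4[of "X n" "X n - y"] R[of n] by simp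
      then show ?thesis using mult_left_mono[OF B(2)[of "X n - y"], of "\<bar>f y\<bar>"] by (auto simp: abs_mult mult.commute)
    qed (use k B in auto)
    then show "AE y in lborel. norm (f y * k (X n - y)) \<le> B * (\<bar>f y\<bar> * indicator (cball 0 (R + e)) y)" for n
      by simp
  qed auto
qed

text \<open>Differentiation under the integral sign along a single line. By the mean value theorem
  the difference quotients of the kernel are bounded by the supremum of |k'|. They vanish unless
  \<open>y\<close> is within \<open>e\<close> of one of the two evaluation points, so a multiple of
  |f| on one large ball dominates the whole sequence.\<close>

lemma conv_has_derivative:
  fixes f :: "'a::euclidean_space \<Rightarrow> real"
  assumes f: "locally_L1 f" and k: "continuous_on UNIV k" "\<And>z. norm z \<ge> e \<Longrightarrow> k z = 0"
    and k': "continuous_on UNIV k'" "\<And>z. norm z \<ge> e \<Longrightarrow> k' z = 0"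
    and der: "\<And>z s. ((\<lambda>s. k (z + s *\<^sub>R w)) has_real_derivative k' (z + s *\<^sub>R w)) (at s)"
  shows "((\<lambda>s. conv f k (x + s *\<^sub>R w)) has_real_derivative conv f k' (x + r *\<^sub>R w)) (at r)"
  unfolding has_field_derivative_iff tendsto_at_iff_sequentially comp_def
proof (intro allI impI)
  fix X :: "nat \<Rightarrow> real"
  assume "\<forall>n. X n \<in> UNIV - {r}" and X: "X \<longlonglongrightarrow> r"
  then have Xr: "X n \<noteq> r" for n by auto
  have [measurable]: "f \<in> borel_measurable borel" "k \<in> borel_measurable borel" "k' \<in> borel_measurable borel"
    using f k k' by (auto simp: locally_L1_def intro: borel_measurable_continuous_onI)
  obtain B where B: "B \<ge> 0" "\<And>z. \<bar>k' z\<bar> \<le> B" using bounded_kernel[OF k'] by blast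
  have "(\<lambda>n. x + X n *\<^sub>R w) \<longlonglongrightarrow> x + r *\<^sub>R w" by (intro tendsto_intros X)
  then have "\<exists>R. \<forall>n. norm (x + X n *\<^sub>R w) \<le> R"
    by (auto dest!: convergent_imp_bounded simp: bounded_iff)
  then obtain R where R: "\<And>n. norm (x + X n *\<^sub>R w) \<le> R"
    by blast
  define S where "S = max R (norm (x + r *\<^sub>R w))"
  let ?q = "\<lambda>n y. f y * ((k (x + X n *\<^sub>R w - y) - k (x + r *\<^sub>R w - y)) / (X n - r))"
  have "(\<lambda>n. LINT y|lborel. ?q n y) \<longlonglongrightarrow> (LINT y|lborel. f y * k' (x + r *\<^sub>R w - y))"
  proof (rule integral_dominated_convergence)
    show "integrable lborel (\<lambda>y. B * (\<bar>f y\<bar> * indicator (cball 0 (S + e)) y))"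
      using locally_L1_integrable(1)[OF f] by (rule integrable_mult_right)
    have "(\<lambda>n. ?q n y) \<longlonglongrightarrow> f y * k' (x + r *\<^sub>R w - y)" for y
    proof (intro tendsto_mult tendsto_const)
      have "((\<lambda>t. (k (x - y + t *\<^sub>R w) - k (x - y + r *\<^sub>R w)) / (t - r)) \<longlongrightarrow> k' (x - y + r *\<^sub>R w)) (at r)"
        using der[of "x - y" r] by (simp add: has_field_derivative_iff)
      then have "(\<lambda>n. (k (x - y + X n *\<^sub>R w) - k (x - y + r *\<^sub>R w)) / (X n - r)) \<longlonglongrightarrow> k' (x - y + r *\<^sub>R w)"
        using X Xr by (auto simp: tendsto_at_iff_sequentially comp_def)
      then show "(\<lambda>n. (k (x + X n *\<^sub>R w - y) - k (x + r *\<^sub>R w - y)) / (X n - r)) \<longlonglongrightarrow> k' (x + r *\<^sub>R w - y)"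
        by (simp add: algebra_simps)
    qed
    then show "AE y in lborel. (\<lambda>n. ?q n y) \<longlonglongrightarrow> f y * k' (x + r *\<^sub>R w - y)" by simp
    have lip: "\<bar>k (z + s *\<^sub>R w) - k (z + t *\<^sub>R w)\<bar> \<le> B * \<bar>s - t\<bar>" for z s t
      using field_differentiable_bound[of UNIV "\<lambda>s. k (z + s *\<^sub>R w)" "\<lambda>s. k' (z + s *\<^sub>R w)" B s t] der[of z] B
      by auto
    have "\<bar>?q n y\<bar> \<le> B * (\<bar>f y\<bar> * indicator (cball 0 (S + e)) y)" for y n
    proof (cases "norm (x + X n *\<^sub>R w - y) \<ge> e \<and> norm (x + r *\<^sub>R w - y) \<ge> e")
      case False
      then have "y \<in> cball 0 (S + e)"
        using norm_triangle_ineq4[of "x + X n *\<^sub>R w" "x + X n *\<^sub>R w - y"] R[of n]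
          norm_triangle_ineq4[of "x + r *\<^sub>R w" "x + r *\<^sub>R w - y"] by (auto simp: S_def)
      moreover have "\<bar>(k (x + X n *\<^sub>R w - y) - k (x + r *\<^sub>R w - y)) / (X n - r)\<bar> \<le> B"
        using lip[of "x - y" "X n" r] Xr[of n] by (simp add: abs_divide divide_le_eq algebra_simps)
      ultimately show ?thesis
        using mult_left_mono[of "\<bar>(k (x + X n *\<^sub>R w - y) - k (x + r *\<^sub>R w - y)) / (X n - r)\<bar>" B "\<bar>f y\<bar>"]
        by (auto simp: abs_mult mult.commute simp del: abs_divide times_divide_eq_right)
    qed (use k B in auto)
    then show "AE y in lborel. norm (?q n y) \<le> B * (\<bar>f y\<bar> * indicator (cball 0 (S + e)) y)" for n
      by simp
  qed auto
  moreover have "(conv f k (x + X n *\<^sub>R w) - conv f k (x + r *\<^sub>R w)) / (X n - r) = (LINT y|lborel. ?q n y)" for n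
  proof -
    have "conv f k (x + X n *\<^sub>R w) - conv f k (x + r *\<^sub>R w) =
        (LINT y|lborel. f y * k (x + X n *\<^sub>R w - y) - f y * k (x + r *\<^sub>R w - y))"
      unfolding conv_def by (intro Bochner_Integration.integral_diff[symmetric] conv_integrable[OF f k])
    then show ?thesis
      by (simp add: right_diff_distrib diff_divide_distrib flip: integral_divide_zero)
  qed
  ultimately show "(\<lambda>n. (conv f k (x + X n *\<^sub>R w) - conv f k (x + r *\<^sub>R w)) / (X n - r)) \<longlonglongrightarrow> conv f k' (x + r *\<^sub>R w)"
    by (simp only: conv_def[of f k'])
qed

section \<open>Convergence and L^p bounds of mollifications\<close>

lemma mollifier_mass:
  assumes e: "e > 0"
  shows "(\<integral>\<^sup>+y. ennreal (mollifier e (x - y)) \<partial>lborel) = 1"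
    "(\<integral>\<^sup>+y. ennreal (mollifier e (y - x)) \<partial>lborel) = 1"
    "integrable lborel (\<lambda>y. mollifier e (x - y))" "(LINT y|lborel. mollifier e (x - y)) = 1"
    "mollifier e \<in> borel_measurable borel"
proof -
  show [measurable]: "mollifier e \<in> borel_measurable borel"
    using mollifier_props(3)[OF e] by (rule borel_measurable_continuous_onI)
  note nonneg = mollifier_props(1)[OF e]
  show 1: "(\<integral>\<^sup>+y. ennreal (mollifier e (x - y)) \<partial>lborel) = 1"
    using nn_integral_lborel_reflect[of "\<lambda>y. ennreal (mollifier e y)" x] mollifier_props(4)[OF e] by simp
  show "(\<integral>\<^sup>+y. ennreal (mollifier e (y - x)) \<partial>lborel) = 1"
    using nn_integral_lborel_translate[of "\<lambda>y. ennreal (mollifier e y)" "- x"] mollifier_props(4)[OF e] by simp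
  show "integrable lborel (\<lambda>y. mollifier e (x - y))"
    using 1 by (simp add: integrable_iff_bounded nonneg)
  show "(LINT y|lborel. mollifier e (x - y)) = 1"
    using 1 by (subst integral_eq_nn_integral) (auto simp: nonneg)
qed

text \<open>As the mollifier has mass 1, the difference at \<open>x\<close> is an average of
  \<open>f (x - z) - f x\<close> over |z| < e; Fubini turns this into an average of the translation
  errors.\<close>

lemma mollify_L1_le:
  fixes f :: "real ^ 'n::finite \<Rightarrow> real"
  assumes f: "locally_L1 f" and e: "e > 0" and \<epsilon>: "\<epsilon> \<ge> 0"
    and tr: "\<And>z. norm z < e \<Longrightarrow> L1_shift f z \<le> ennreal \<epsilon>"
  shows "(\<integral>\<^sup>+x. ennreal \<bar>conv f (mollifier e) x - f x\<bar> \<partial>lborel) \<le> ennreal \<epsilon>"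
proof -
  note props = mollifier_props[OF e]
  note mass = mollifier_mass[OF e]
  have [measurable]: "f \<in> borel_measurable borel" using f by (simp add: locally_L1_def)
  have [measurable]: "(mollifier e :: real ^ 'n \<Rightarrow> real) \<in> borel_measurable borel" by (rule mass)
  have pw: "ennreal \<bar>conv f (mollifier e) x - f x\<bar> \<le> (\<integral>\<^sup>+z. ennreal \<bar>f (x - z) - f x\<bar> * ennreal (mollifier e z) \<partial>lborel)" for x
  proof -
    have int: "integrable lborel (\<lambda>y. f y * mollifier e (x - y))" "integrable lborel (\<lambda>y. f x * mollifier e (x - y))"
      using conv_integrable[OF f props(3,2)] mass(3) by auto
    have "conv f (mollifier e) x - f x = (LINT y|lborel. f y * mollifier e (x - y) - f x * mollifier e (x - y))"
      using int mass(4)[of x] by (simp add: conv_def)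
    also have "ennreal \<bar>\<dots>\<bar> \<le> (\<integral>\<^sup>+y. ennreal (norm (f y * mollifier e (x - y) - f x * mollifier e (x - y))) \<partial>lborel)"
      using integral_norm_bound_ennreal[OF Bochner_Integration.integrable_diff[OF int]] by simp
    also have "\<dots> = (\<integral>\<^sup>+y. ennreal \<bar>f y - f x\<bar> * ennreal (mollifier e (x - y)) \<partial>lborel)"
      by (intro nn_integral_cong) (simp add: abs_mult props(1) ennreal_mult flip: left_diff_distrib)
    also have "\<dots> = (\<integral>\<^sup>+z. ennreal \<bar>f (x - z) - f x\<bar> * ennreal (mollifier e z) \<partial>lborel)"
      using nn_integral_lborel_reflect[of "\<lambda>y. ennreal \<bar>f y - f x\<bar> * ennreal (mollifier e (x - y))" x] by simp
    finally show ?thesis .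
  qed
  have "(\<integral>\<^sup>+x. ennreal \<bar>conv f (mollifier e) x - f x\<bar> \<partial>lborel) \<le>
      (\<integral>\<^sup>+x. \<integral>\<^sup>+z. ennreal \<bar>f (x - z) - f x\<bar> * ennreal (mollifier e z) \<partial>lborel \<partial>lborel)"
    by (intro nn_integral_mono pw)
  also have "\<dots> = (\<integral>\<^sup>+z. \<integral>\<^sup>+x. ennreal \<bar>f (x - z) - f x\<bar> * ennreal (mollifier e z) \<partial>lborel \<partial>lborel)"
    by (rule lborel_pair.Fubini') measurable
  also have "\<dots> = (\<integral>\<^sup>+z. (\<integral>\<^sup>+x. ennreal \<bar>f (x - z) - f x\<bar> \<partial>lborel) * ennreal (mollifier e z) \<partial>lborel)"
    by (intro nn_integral_cong nn_integral_multc) measurable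
  also have "\<dots> \<le> (\<integral>\<^sup>+z. ennreal \<epsilon> * ennreal (mollifier e (z :: real ^ 'n)) \<partial>lborel)"
  proof (intro nn_integral_mono)
    fix z :: "real ^ 'n"
    show "(\<integral>\<^sup>+x. ennreal \<bar>f (x - z) - f x\<bar> \<partial>lborel) * ennreal (mollifier e z) \<le> ennreal \<epsilon> * ennreal (mollifier e z)"
    proof (cases "norm z < e")
      case True
      then show ?thesis using tr[of "- z"] by (intro mult_right_mono) auto
    next
      case False
      then show ?thesis using props(2)[of z] by simp
    qed
  qed
  also have "\<dots> = ennreal \<epsilon>" by (simp add: nn_integral_cmult props(4))
  finally show ?thesis .
qed

lemma integrable_imp_locally_L1:
  fixes f :: "'a::euclidean_space \<Rightarrow> real"
  assumes "integrable lborel f"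
  shows "locally_L1 f"
  unfolding locally_L1_def
proof (intro conjI allI)
  show "f \<in> borel_measurable borel" using assms by auto
  fix R
  have "(\<integral>\<^sup>+y. ennreal \<bar>f y\<bar> * indicator (cball 0 R) y \<partial>lborel) \<le> (\<integral>\<^sup>+y. ennreal (norm (f y)) \<partial>lborel)"
    by (intro nn_integral_mono) (auto simp: indicator_def)
  then show "(\<integral>\<^sup>+y. ennreal \<bar>f y\<bar> * indicator (cball 0 R) y \<partial>lborel) < \<infinity>"
    using assms by (auto simp: integrable_iff_bounded)
qed

text \<open>For scales up to 1, the mollification on the ball of radius \<open>R\<close> only sees
  \<open>f\<close> on the ball of radius \<open>R + 1\<close>, so \<open>f\<close> may be cut off to
  an integrable function. Convergence in L^1 then gives convergence almost everywhere along a
  subsequence, which depends on \<open>R\<close>.\<close>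

lemma mollify_AE:
  fixes f :: "real ^ 'n::finite \<Rightarrow> real"
  assumes f: "locally_L1 f"
  obtains e :: "nat \<Rightarrow> real" where "\<And>n. 0 < e n" "\<And>n. e n \<le> 1"
    "AE x in lborel. norm x \<le> R \<longrightarrow> (\<lambda>n. conv f (mollifier (e n)) x) \<longlonglongrightarrow> f x"
proof -
  define F where "F y = f y * indicator (cball 0 (R + 1)) y" for y
  have F: "integrable lborel F" unfolding F_def by (rule locally_L1_integrable[OF f])
  have FL: "locally_L1 F" by (rule integrable_imp_locally_L1[OF F])
  have "\<exists>e. 0 < e \<and> e \<le> 1 \<and> (\<integral>\<^sup>+x. ennreal \<bar>conv F (mollifier e) x - F x\<bar> \<partial>lborel) \<le> ennreal (1 / real (Suc n))" for n
  proof -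
    have "1 / real (Suc n) > 0" by simp
    then obtain d where d: "d > 0" "\<And>z. norm z < d \<Longrightarrow> L1_shift F z \<le> ennreal (1 / real (Suc n))"
      using L1_translation_continuous_integrable[OF F] unfolding L1_translation_continuous_def by blast
    then show ?thesis
      by (intro exI[of _ "min d 1"] conjI mollify_L1_le FL) auto
  qed
  then obtain e where e: "\<And>n. 0 < e n" "\<And>n. e n \<le> 1" and
    L1: "\<And>n. (\<integral>\<^sup>+x. ennreal \<bar>conv F (mollifier (e n)) x - F x\<bar> \<partial>lborel) \<le> ennreal (1 / real (Suc n))"
    by metis
  have cm: "conv F (mollifier (e n)) \<in> borel_measurable borel" for n
    using conv_continuous[OF FL mollifier_props(3,2)[OF e(1)[of n]]] by (rule borel_measurable_continuous_onI) 
  have [measurable]: "F \<in> borel_measurable borel" using F by auto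
  note [measurable] = cm
  have int: "integrable lborel (\<lambda>x. conv F (mollifier (e n)) x - F x)" for n
    using L1[of n] by (auto simp: integrable_iff_bounded intro: le_less_trans)
  have "(LINT x|lborel. norm (conv F (mollifier (e n)) x - F x)) \<le> 1 / real (Suc n)" for n
  proof -
    have "ennreal (LINT x|lborel. norm (conv F (mollifier (e n)) x - F x)) \<le> ennreal (1 / real (Suc n))"
      using nn_integral_eq_integral[OF integrable_norm[OF int[of n]]] L1[of n] by simp
    then show ?thesis by (subst (asm) ennreal_le_iff) auto
  qed
  then have "(\<lambda>n. LINT x|lborel. norm (conv F (mollifier (e n)) x - F x)) \<longlonglongrightarrow> 0"
    by (intro tendsto_sandwich[OF _ _ tendsto_const LIMSEQ_inverse_real_of_nat])
      (auto simp: inverse_eq_divide intro!: always_eventually)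
  from tendsto_L1_AE_subseq[OF int this] obtain r :: "nat \<Rightarrow> nat" where
    r: "AE x in lborel. (\<lambda>n. conv F (mollifier (e (r n))) x - F x) \<longlonglongrightarrow> 0" by blast
  have same: "conv F (mollifier (e n)) x = conv f (mollifier (e n)) x" if "norm x \<le> R" for n x
    unfolding conv_def
  proof (intro Bochner_Integration.integral_cong refl)
    fix y
    show "F y * mollifier (e n) (x - y) = f y * mollifier (e n) (x - y)"
    proof (cases "norm (x - y) \<ge> e n")
      case True
      then show ?thesis using mollifier_props(2)[OF e(1)[of n], of "x - y"] by simp
    next
      case False
      then have "norm y \<le> R + 1"
        using norm_triangle_ineq4[of x "x - y"] that e(2)[of n] by simp
      then show ?thesis by (simp add: F_def)
    qed
  qed
  show thesis
  proof (rule that[of "\<lambda>n. e (r n)"])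
    show "AE x in lborel. norm x \<le> R \<longrightarrow> (\<lambda>n. conv f (mollifier (e (r n))) x) \<longlonglongrightarrow> f x"
      using r
    proof eventually_elim
      case (elim x)
      show ?case
      proof
        assume x: "norm x \<le> R"
        then have "F x = f x" by (simp add: F_def)
        with elim same[OF x] show "(\<lambda>n. conv f (mollifier (e (r n))) x) \<longlonglongrightarrow> f x"
          by (simp add: LIM_zero_iff)
      qed
    qed
  qed (use e in auto)
qed

text \<open>The fundamental lemma of the calculus of variations for this family of test functions.
  It turns the distributional identity for \<open>x $ j * f x\<close> into one almost
  everywhere.\<close>

lemma AE_zero_if_mollified_zero:
  fixes f :: "real ^ 'n::finite \<Rightarrow> real"
  assumes f: "locally_L1 f" and zero: "\<And>x e. e > 0 \<Longrightarrow> conv f (mollifier e) x = 0"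
  shows "AE x in lborel. f x = 0"
proof -
  have "AE x in lborel. norm x \<le> real m \<longrightarrow> f x = 0" for m
  proof -
    obtain e :: "nat \<Rightarrow> real" where e: "\<And>n. 0 < e n" "\<And>n. e n \<le> 1"
      "AE x in lborel. norm x \<le> real m \<longrightarrow> (\<lambda>n. conv f (mollifier (e n)) x) \<longlonglongrightarrow> f x"
      using mollify_AE[OF f] by blast
    from e(3) show ?thesis
      by eventually_elim (use zero[OF e(1)] in \<open>auto simp: LIMSEQ_const_iff\<close>)
  qed
  then have "AE x in lborel. \<forall>m. norm x \<le> real m \<longrightarrow> f x = 0"
    unfolding AE_all_countable by blast
  then show ?thesis by eventually_elim (meson real_arch_simple)
qed

text \<open>Young's inequality with an extra factor: \<open>powr_le_nn_integral\<close> for the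
  probability measure with density \<open>mollifier e (x - y)\<close>, followed by Fubini. The
  constant does not depend on \<open>e\<close>.\<close>

lemma mollify_powr_integral_le:
  fixes g :: "real ^ 'n::finite \<Rightarrow> real"
  assumes g: "locally_L1 g" "\<And>x. g x \<ge> 0" and e: "e > 0" and p: "p \<ge> 1"
  shows "(\<integral>\<^sup>+x. ennreal (conv g (mollifier e) x powr p) \<partial>lborel) \<le>
    ennreal (2 powr p) * powr_int p g"
proof -
  note props = mollifier_props[OF e]
  note mass = mollifier_mass[OF e]
  have [measurable]: "g \<in> borel_measurable borel" using g by (simp add: locally_L1_def)
  have [measurable]: "(mollifier e :: real ^ 'n \<Rightarrow> real) \<in> borel_measurable borel" by (rule mass)
  let ?D = "\<lambda>x. density lborel (\<lambda>y. ennreal (mollifier e (x - y)))"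
  have pw: "ennreal (conv g (mollifier e) x powr p) \<le>
      ennreal (2 powr p) * (\<integral>\<^sup>+y. ennreal (mollifier e (x - y)) * ennreal (g y powr p) \<partial>lborel)" for x
  proof -
    have "ennreal (conv g (mollifier e) x) = (\<integral>\<^sup>+y. ennreal (g y * mollifier e (x - y)) \<partial>lborel)"
      unfolding conv_def using conv_integrable[OF g(1) props(3,2)]
      by (intro nn_integral_eq_integral[symmetric]) (auto simp: props(1) g(2))
    also have "\<dots> = (\<integral>\<^sup>+y. ennreal (g y) \<partial>?D x)"
      by (subst nn_integral_density) (auto simp: ennreal_mult' mult.commute props(1) g(2))
    finally have "ennreal (conv g (mollifier e) x) \<le> (\<integral>\<^sup>+y. ennreal (g y) \<partial>?D x)" by simp
    then have "ennreal (conv g (mollifier e) x powr p) \<le> ennreal (2 powr p * 1 powr (p - 1)) * (\<integral>\<^sup>+y. ennreal (g y powr p) \<partial>?D x)"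
      using p mass(1)[of x]
      by (intro powr_le_nn_integral) (auto simp: emeasure_density conv_def props(1) g(2) intro!: integral_nonneg_AE)
    then show ?thesis by (simp add: nn_integral_density)
  qed
  have "(\<integral>\<^sup>+x. ennreal (conv g (mollifier e) x powr p) \<partial>lborel) \<le>
      (\<integral>\<^sup>+x. ennreal (2 powr p) * (\<integral>\<^sup>+y. ennreal (mollifier e (x - y)) * ennreal (g y powr p) \<partial>lborel) \<partial>lborel)"
    by (intro nn_integral_mono pw)
  also have "\<dots> = ennreal (2 powr p) * (\<integral>\<^sup>+x. \<integral>\<^sup>+y. ennreal (mollifier e (x - y)) * ennreal (g y powr p) \<partial>lborel \<partial>lborel)"
    by (intro nn_integral_cmult) measurable
  also have "(\<integral>\<^sup>+x. \<integral>\<^sup>+y. ennreal (mollifier e (x - y)) * ennreal (g y powr p) \<partial>lborel \<partial>lborel) =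
      (\<integral>\<^sup>+y. \<integral>\<^sup>+x. ennreal (mollifier e (x - y)) * ennreal (g y powr p) \<partial>lborel \<partial>lborel)"
    by (rule lborel_pair.Fubini') measurable
  also have "\<dots> = (\<integral>\<^sup>+y. ennreal (g y powr p) \<partial>lborel)"
    by (simp add: nn_integral_multc mass(2))
  finally show ?thesis .
qed

text \<open>Domination is asked for only within distance \<open>e\<close> of \<open>x\<close>,
  because it will be available only away from the origin.\<close>

lemma mollifier_conv_abs_le:
  fixes f :: "real ^ 'n::finite \<Rightarrow> real"
  assumes f: "locally_L1 f" and e: "e > 0"
    and g: "locally_L1 g" and le: "AE y in lborel. norm (x - y) < e \<longrightarrow> \<bar>f y\<bar> \<le> g y"
  shows "\<bar>conv f (mollifier e) x\<bar> \<le> conv g (mollifier e) x"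
proof -
  note props = mollifier_props[OF e]
  have "\<bar>conv f (mollifier e) x\<bar> \<le> (LINT y|lborel. \<bar>f y * mollifier e (x - y)\<bar>)"
    unfolding conv_def by (rule integral_abs_bound)
  also have "\<dots> \<le> (LINT y|lborel. g y * mollifier e (x - y))"
  proof (rule integral_mono_AE)
    show "integrable lborel (\<lambda>y. \<bar>f y * mollifier e (x - y)\<bar>)"
      using conv_integrable[OF f props(3,2)] by (rule integrable_abs)
    show "integrable lborel (\<lambda>y. g y * mollifier e (x - y))"
      by (rule conv_integrable[OF g props(3,2)])
    show "AE y in lborel. \<bar>f y * mollifier e (x - y)\<bar> \<le> g y * mollifier e (x - y)"
      using le
    proof eventually_elim
      case (elim y)
      show ?case
      proof (cases "norm (x - y) < e")
        case True
        then show ?thesis using elim props(1)[of "x - y"] by (simp add: abs_mult mult_right_mono)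
      next
        case False
        then show ?thesis using props(2)[of "x - y"] by simp
      qed
    qed
  qed
  finally show ?thesis by (simp add: conv_def)
qed

section \<open>The Hermite heat kernel\<close>

text \<open>Dyadic comparison: with 2^n the power of two just above 1 + |x|, the point lies in the
  ball of radius 2^n and the weight is at most 2^r 2^(-r n). The integrals of the resulting terms
  form a geometric series of ratio 2^(d - r) < 1.\<close>

lemma weight_integral_finite:
  assumes r: "r > real DIM('a)"
  shows "(\<integral>\<^sup>+x. ennreal ((1 + norm (x :: 'a::euclidean_space)) powr (- r)) \<partial>lborel) < \<infinity>"
proof -
  let ?d = "real DIM('a)" and ?V = "unit_ball_vol (real DIM('a))"
  let ?t = "\<lambda>n x. ennreal (2 powr r * 2 powr (- r * real n)) * indicator (cball (0::'a) (2 ^ n)) x"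
  have pw: "ennreal ((1 + norm x) powr (- r)) \<le> (\<Sum>n. ?t n x)" for x :: 'a
  proof -
    define n where "n = nat \<lceil>log 2 (1 + norm x)\<rceil>"
    have pos: "1 + norm x > 0" using norm_ge_zero[of x] by linarith
    then have "log 2 (1 + norm x) \<ge> 0" by simp
    then have l: "log 2 (1 + norm x) \<le> real n" "real n \<le> log 2 (1 + norm x) + 1"
      by (simp_all add: n_def)
    have e: "2 powr (log 2 (1 + norm x)) = 1 + norm x" using pos by simp
    have n: "1 + norm x \<le> 2 powr (real n)" "2 powr (real n) \<le> 2 * (1 + norm x)"
      using powr_mono[OF l(1), of 2] powr_mono[OF l(2), of 2] by (simp_all add: e powr_add)
    have "(1 + norm x) powr (- r) \<le> (2 powr (real n) / 2) powr (- r)"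
      using n r by (intro powr_mono2') auto
    also have "\<dots> = 2 powr r * 2 powr (- r * real n)"
      by (simp add: powr_divide powr_powr powr_minus_divide mult.commute)
    finally have "ennreal ((1 + norm x) powr (- r)) \<le> ?t n x"
      using n(1) by (auto simp: powr_realpow intro!: ennreal_leI)
    moreover have "F n \<le> suminf F" for F :: "nat \<Rightarrow> ennreal"
      using sum_le_suminf[of F "{n}"] by simp
    ultimately show ?thesis by (rule order_trans)
  qed
  have "(\<integral>\<^sup>+x. ennreal ((1 + norm (x :: 'a)) powr (- r)) \<partial>lborel) \<le> (\<integral>\<^sup>+x. (\<Sum>n. ?t n x) \<partial>lborel)"
    by (intro nn_integral_mono pw)
  also have "\<dots> = (\<Sum>n. \<integral>\<^sup>+x. ?t n x \<partial>lborel)"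
  proof (rule nn_integral_suminf)
    show "?t n \<in> borel_measurable lborel" for n
      by (intro borel_measurable_times_ennreal borel_measurable_const borel_measurable_indicator) simp
  qed
  also have "\<dots> = (\<Sum>n. ennreal (2 powr r * ?V * (2 powr (?d - r)) ^ n))"
  proof (intro suminf_cong)
    fix n :: nat
    have "(\<integral>\<^sup>+x. ?t n x \<partial>lborel) = ennreal (2 powr r * 2 powr (- r * real n)) * ennreal (?V * (2 ^ n) ^ DIM('a))"
      by (subst nn_integral_cmult_indicator) (auto simp: emeasure_cball)
    also have "\<dots> = ennreal (2 powr r * ?V * (2 powr (- r * real n) * (2 ^ n) ^ DIM('a)))"
      by (simp add: mult_ac flip: ennreal_mult')
    also have "2 powr (- r * real n) * (2 ^ n) ^ DIM('a) = (2 powr (?d - r)) ^ n"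
    proof -
      have "(2 ^ n :: real) ^ DIM('a) = 2 powr (real n * ?d)"
        by (metis of_nat_mult power_mult powr_realpow zero_less_numeral)
      moreover have "(2 powr (?d - r)) ^ n = 2 powr ((?d - r) * real n)"
        using powr_realpow[of "2 powr (?d - r)" n] by (simp add: powr_powr)
      moreover have "- r * real n + real n * ?d = (?d - r) * real n" by (simp add: algebra_simps)
      ultimately show ?thesis by (metis powr_add)
    qed
    finally show "(\<integral>\<^sup>+x. ?t n x \<partial>lborel) = ennreal (2 powr r * ?V * (2 powr (?d - r)) ^ n)" .
  qed
  also have "\<dots> < \<infinity>"
  proof -
    have "2 powr (?d - r) < 2 powr 0" using r by (intro powr_less_mono) auto
    then have "summable (\<lambda>n. 2 powr r * ?V * (2 powr (?d - r)) ^ n)"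
      by (intro summable_mult summable_geometric) auto
    then have "(\<Sum>n. ennreal (2 powr r * ?V * (2 powr (?d - r)) ^ n)) \<noteq> top"
      by (intro ennreal_suminf_neq_top) auto
    then show ?thesis by (simp add: less_top)
  qed
  finally show ?thesis .
qed

text \<open>Reduced to the polynomial weight through (1 + |z|)^r <= exp (r |z|) <= exp (|z|^2 + r^2
  / 4), where \<open>r = d + 1\<close> lies just in the integrable range.\<close>

lemma gauss_integral_finite: "(\<integral>\<^sup>+z. ennreal (exp (- (norm (z :: 'a::euclidean_space))\<^sup>2)) \<partial>lborel) < \<infinity>"
proof -
  define r where "r = real DIM('a) + 1"
  have "exp (- (norm z)\<^sup>2) \<le> exp (r\<^sup>2 / 4) * (1 + norm z) powr (- r)" for z :: 'a
  proof -
    have "(1 + norm z) powr r \<le> exp (norm z) powr r"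
      by (intro powr_mono2) (auto simp: r_def)
    also have "\<dots> = exp (r * norm z)" by (simp add: powr_def)
    also have "\<dots> \<le> exp ((norm z)\<^sup>2 + r\<^sup>2 / 4)"
      using zero_le_power2[of "norm z - r / 2"] by (simp add: power2_eq_square algebra_simps)
    finally have "(1 + norm z) powr r * exp (- (norm z)\<^sup>2) \<le> exp ((norm z)\<^sup>2 + r\<^sup>2 / 4) * exp (- (norm z)\<^sup>2)"
      by (intro mult_right_mono) auto
    also have "\<dots> = exp (r\<^sup>2 / 4)" by (simp flip: exp_add)
    finally have "(1 + norm z) powr r * exp (- (norm z)\<^sup>2) \<le> exp (r\<^sup>2 / 4)" .
    moreover have "1 + norm z > 0" using norm_ge_zero[of z] by linarith
    ultimately show ?thesis
      by (simp add: powr_minus_divide pos_le_divide_eq mult.commute)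
  qed
  then have "(\<integral>\<^sup>+z. ennreal (exp (- (norm (z :: 'a))\<^sup>2)) \<partial>lborel) \<le>
      (\<integral>\<^sup>+z. ennreal (exp (r\<^sup>2 / 4)) * ennreal ((1 + norm (z :: 'a)) powr (- r)) \<partial>lborel)"
    by (intro nn_integral_mono) (simp add: ennreal_leI flip: ennreal_mult')
  also have "\<dots> = ennreal (exp (r\<^sup>2 / 4)) * (\<integral>\<^sup>+z. ennreal ((1 + norm (z :: 'a)) powr (- r)) \<partial>lborel)"
    by (intro nn_integral_cmult) auto
  also have "\<dots> < \<infinity>"
    using weight_integral_finite[of r, where 'a = 'a] by (simp add: r_def ennreal_mult_less_top)
  finally show ?thesis .
qed

lemma hermite_heat_kernel_commute: "hermite_heat_kernel t x y = hermite_heat_kernel t y x"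
  by (simp add: hermite_heat_kernel_def norm_minus_commute inner_commute)

lemma hermite_heat_kernel_nonneg: "hermite_heat_kernel t x y \<ge> 0"
  by (simp add: hermite_heat_kernel_def)

text \<open>The exponent of the kernel equals \<open>- \<bar>x - y\<bar>\<^sup>2 coth t / 4 - \<bar>x + y\<bar>\<^sup>2 tanh t / 4\<close>.\<close>

lemma hermite_heat_kernel_le:
  fixes x y :: "real ^ 'n::finite"
  assumes t: "t > 0"
  shows "hermite_heat_kernel t x y \<le> (2 * pi * sinh (2 * t)) powr (- real CARD('n) / 2) *
    exp (- (norm ((sqrt (cosh t / sinh t) / 2) *\<^sub>R (x - y)))\<^sup>2)"
proof -
  have s: "sinh t > 0" "cosh t > 0" using t by auto
  let ?c = "cosh (2 * t) / sinh (2 * t)" and ?a = "x - y" and ?b = "x + y"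
  have c: "?c = (sinh t / cosh t + cosh t / sinh t) / 2"
  proof -
    have "(C\<^sup>2 + S\<^sup>2) / (2 * S * C) = (S / C + C / S) / 2" if "S > 0" "C > 0" for S C :: real
      using that by (simp add: field_simps power2_eq_square)
    from this[OF s] show ?thesis by (simp only: cosh_double sinh_double)
  qed
  have xy: "x \<bullet> y = ((norm ?b)\<^sup>2 - (norm ?a)\<^sup>2) / 4"
    by (simp add: power2_norm_eq_inner inner_simps inner_commute)
  have "- (1 / 2) * (norm ?a)\<^sup>2 * ?c - (x \<bullet> y) * tanh t =
      - (norm ?a)\<^sup>2 * (cosh t / sinh t) / 4 - (norm ?b)\<^sup>2 * tanh t / 4"
    unfolding c xy tanh_def by (simp add: algebra_simps diff_divide_distrib add_divide_distrib)
  \<comment> \<open>Dropping the term in |x + y| leaves a Gaussian in \<open>x - y\<close>, whose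
    integral over \<open>y\<close> does not depend on \<open>x\<close>.\<close>
  also have "\<dots> \<le> - (norm ?a)\<^sup>2 * (cosh t / sinh t) / 4"
    using t by (simp add: tanh_def)
  also have "\<dots> = - (norm ((sqrt (cosh t / sinh t) / 2) *\<^sub>R ?a))\<^sup>2"
    using s by (simp add: power_mult_distrib power_divide real_sqrt_pow2)
  finally show ?thesis
    unfolding hermite_heat_kernel_def by (intro mult_left_mono) auto
qed

lemma borel_measurable_hermite_heat_kernel[measurable (raw)]:
  fixes f g :: "'a \<Rightarrow> real ^ 'n::finite"
  assumes [measurable]: "h \<in> borel_measurable M" "f \<in> borel_measurable M" "g \<in> borel_measurable M"
  shows "(\<lambda>x. hermite_heat_kernel (h x) (f x) (g x)) \<in> borel_measurable M"
proof -
  have [measurable]: "(sinh :: real \<Rightarrow> real) \<in> borel_measurable borel"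
    "(cosh :: real \<Rightarrow> real) \<in> borel_measurable borel" "(tanh :: real \<Rightarrow> real) \<in> borel_measurable borel"
    by (auto intro!: borel_measurable_continuous_onI continuous_intros simp: cosh_real_nonzero)
  show ?thesis unfolding hermite_heat_kernel_def by measurable
qed

text \<open>Scaling the Gaussian by a = sqrt (coth t) / 2 cancels the singularity at t = 0: the
  prefactor becomes (pi cosh^2 t)^(-d/2), which is at most 1 / cosh t. The exponential decay makes
  the integral against \<open>t powr (- 1 / 2)\<close> converge at infinity.\<close>

lemma hermite_heat_kernel_integral:
  obtains C where "C > 0" "\<And>(x :: real ^ 'n::finite) t. t > 0 \<Longrightarrow>
    (\<integral>\<^sup>+y. ennreal (hermite_heat_kernel t x y) \<partial>lborel) \<le> ennreal (C * exp (- t))"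
proof -
  let ?gauss = "\<lambda>z :: real ^ 'n. ennreal (exp (- (norm z)\<^sup>2))"
  let ?d = "real CARD('n)"
  obtain G where G: "(\<integral>\<^sup>+z. ?gauss z \<partial>lborel) = ennreal G" "G \<ge> 0"
    using gauss_integral_finite[where 'a = "real ^ 'n"] by (cases "\<integral>\<^sup>+z. ?gauss z \<partial>lborel") auto
  show thesis
  proof (rule that[of "2 * G + 1"])
    show "2 * G + 1 > 0" using G by simp
    fix x :: "real ^ 'n" and t :: real
    assume t: "t > 0"
    then have s: "sinh t > 0" "cosh t > 0" by auto
    define a where "a = sqrt (cosh t / sinh t) / 2"
    define A where "A = (2 * pi * sinh (2 * t)) powr (- ?d / 2)"
    have a: "a > 0" using s by (simp add: a_def)
    have A: "A \<ge> 0" by (simp add: A_def)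
    have "(\<integral>\<^sup>+y. ennreal (hermite_heat_kernel t x y) \<partial>lborel) \<le> (\<integral>\<^sup>+y. ennreal A * ?gauss (a *\<^sub>R (x - y)) \<partial>lborel)"
      using hermite_heat_kernel_le[OF t, of x] A
      by (intro nn_integral_mono) (simp add: a_def A_def ennreal_leI flip: ennreal_mult')
    also have "\<dots> = ennreal A * (\<integral>\<^sup>+y. ?gauss (a *\<^sub>R (x - y)) \<partial>lborel)"
      by (intro nn_integral_cmult) measurable
    also have "(\<integral>\<^sup>+y. ?gauss (a *\<^sub>R (x - y)) \<partial>lborel) = (\<integral>\<^sup>+y. ?gauss (a *\<^sub>R y) \<partial>lborel)"
      by (rule nn_integral_lborel_reflect[of "\<lambda>y. ?gauss (a *\<^sub>R y)"]) measurable
    also have "ennreal A * (\<integral>\<^sup>+y. ?gauss (a *\<^sub>R y) \<partial>lborel) = ennreal (A * a powr (- ?d)) * (ennreal (a powr ?d) * (\<integral>\<^sup>+y. ?gauss (a *\<^sub>R y) \<partial>lborel))"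
    proof -
      have "ennreal (A * a powr (- ?d)) * ennreal (a powr ?d) = ennreal A"
        using A a by (simp add: mult.assoc flip: ennreal_mult' powr_add)
      then show ?thesis by (simp only: mult.assoc[symmetric])
    qed
    also have "ennreal (a powr ?d) * (\<integral>\<^sup>+y. ?gauss (a *\<^sub>R y) \<partial>lborel) = (\<integral>\<^sup>+y. ?gauss y \<partial>lborel)"
      using nn_integral_lborel_affine[of ?gauss a 0] a by (simp add: powr_realpow)
    also have "ennreal (A * a powr (- ?d)) * (\<integral>\<^sup>+y. ?gauss y \<partial>lborel) = ennreal (A * a powr (- ?d) * G)"
      using A G by (simp add: ennreal_mult')
    also have "A * a powr (- ?d) \<le> 2 * exp (- t)"
    proof -
      have d: "?d \<ge> 1" using zero_less_card_finite[where 'a = 'n] by linarith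
      have "a powr (- ?d) = (a\<^sup>2) powr (- ?d / 2)"
        using a by (simp add: powr_powr flip: powr_numeral)
      then have "A * a powr (- ?d) = (2 * pi * sinh (2 * t) * a\<^sup>2) powr (- ?d / 2)"
        using s a t by (simp add: A_def powr_mult)
      also have "2 * pi * sinh (2 * t) * a\<^sup>2 = pi * (cosh t)\<^sup>2"
        using s by (simp add: a_def power_divide real_sqrt_pow2 sinh_double power2_eq_square)
      also have "(pi * (cosh t)\<^sup>2) powr (- ?d / 2) \<le> ((cosh t)\<^sup>2) powr (- ?d / 2)"
        using s pi_gt3 by (intro powr_mono2') (auto intro!: mult_right_mono[of 1, simplified])
      also have "\<dots> = cosh t powr (- ?d)"
        using s by (simp add: powr_powr flip: powr_numeral)
      also have "\<dots> \<le> cosh t powr (- 1)"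
        using d by (intro powr_mono) (auto simp: cosh_real_ge_1)
      also have "\<dots> = 1 / cosh t" using s by (simp add: powr_minus_divide)
      also have "\<dots> \<le> 2 * exp (- t)"
      proof -
        have "exp t \<le> 2 * cosh t" by (simp add: cosh_field_def)
        then have "exp t * exp (- t) \<le> 2 * cosh t * exp (- t)" by (intro mult_right_mono) auto
        then show ?thesis using s by (simp add: field_simps flip: exp_add)
      qed
      finally show ?thesis .
    qed
    then have "ennreal (A * a powr (- ?d) * G) \<le> ennreal (2 * exp (- t) * G)"
      using G by (intro ennreal_leI mult_right_mono) auto
    also have "\<dots> \<le> ennreal ((2 * G + 1) * exp (- t))"
      by (intro ennreal_leI) (simp add: algebra_simps)
    finally show "(\<integral>\<^sup>+y. ennreal (hermite_heat_kernel t x y) \<partial>lborel) \<le> ennreal ((2 * G + 1) * exp (- t))" .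
  qed
qed

text \<open>Uses |g| <= 1 + |g|^p. For the term 1 the kernel is integrated over \<open>y\<close> and
  then over the ball; for |g|^p it is integrated over \<open>x\<close> first. Each order gains exp
  (-t), and the remaining time integral is Gamma (1/2).\<close>

lemma hermite_heat_kernel_potential_finite:
  fixes g :: "real ^ 'n::finite \<Rightarrow> real"
  assumes [measurable]: "g \<in> borel_measurable borel" and p: "p \<ge> 1"
    and g: "abs_powr_int p g < \<infinity>"
  shows "(\<integral>\<^sup>+x. indicator (cball 0 R) x * (\<integral>\<^sup>+y. (\<integral>\<^sup>+t. indicator {0<..} t *
    ennreal (hermite_heat_kernel t x y * t powr (- 1 / 2)) \<partial>lborel) * ennreal \<bar>g y\<bar> \<partial>lborel) \<partial>lborel) < \<infinity>"
    (is "?L < _")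
proof -
  let ?B = "cball (0 :: real ^ 'n) R" and ?H = "\<lambda>t x y. ennreal (hermite_heat_kernel t x y)"
  let ?Q = "\<lambda>t x y. indicator ?B x * (?H t x y * ennreal \<bar>g y\<bar>)"
  let ?P = "\<integral>\<^sup>+x. ennreal (\<bar>g x\<bar> powr p) \<partial>lborel"
  have [measurable]: "?B \<in> sets borel" by simp
  obtain C where C: "C > 0" and le: "\<And>(x :: real ^ 'n) t. t > 0 \<Longrightarrow>
      (\<integral>\<^sup>+y. ?H t x y \<partial>lborel) \<le> ennreal (C * exp (- t))"
    using hermite_heat_kernel_integral by blast
  have fixed: "(\<integral>\<^sup>+x. \<integral>\<^sup>+y. ?Q t x y \<partial>lborel \<partial>lborel) \<le>
      ennreal (C * exp (- t)) * (emeasure lborel ?B + ?P)" if t: "t > 0" for t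
  proof -
    have "(\<integral>\<^sup>+x. \<integral>\<^sup>+y. ?Q t x y \<partial>lborel \<partial>lborel) \<le>
        (\<integral>\<^sup>+x. \<integral>\<^sup>+y. indicator ?B x * ?H t x y + ennreal (\<bar>g y\<bar> powr p) * ?H t x y \<partial>lborel \<partial>lborel)"
    proof (intro nn_integral_mono)
      fix x y
      have "\<bar>g y\<bar> \<le> 1 + \<bar>g y\<bar> powr p" using le_add_scaled_powr[OF p, of 1 "\<bar>g y\<bar>"] by simp
      then have "ennreal \<bar>g y\<bar> \<le> 1 + ennreal (\<bar>g y\<bar> powr p)"
        by (metis ennreal_1 ennreal_leI ennreal_plus powr_ge_zero zero_le_one)
      then have "?H t x y * ennreal \<bar>g y\<bar> \<le> ?H t x y * (1 + ennreal (\<bar>g y\<bar> powr p))"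
        by (intro mult_left_mono) auto
      then show "?Q t x y \<le> indicator ?B x * ?H t x y + ennreal (\<bar>g y\<bar> powr p) * ?H t x y"
        by (auto simp: indicator_def distrib_left mult.commute)
    qed
    also have "\<dots> = (\<integral>\<^sup>+x. indicator ?B x * (\<integral>\<^sup>+y. ?H t x y \<partial>lborel) \<partial>lborel) +
        (\<integral>\<^sup>+x. \<integral>\<^sup>+y. ennreal (\<bar>g y\<bar> powr p) * ?H t x y \<partial>lborel \<partial>lborel)"
      by (simp add: nn_integral_add nn_integral_cmult)
    also have "(\<integral>\<^sup>+x. \<integral>\<^sup>+y. ennreal (\<bar>g y\<bar> powr p) * ?H t x y \<partial>lborel \<partial>lborel) =
        (\<integral>\<^sup>+y. \<integral>\<^sup>+x. ennreal (\<bar>g y\<bar> powr p) * ?H t x y \<partial>lborel \<partial>lborel)"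
      by (rule lborel_pair.Fubini') measurable
    also have "\<dots> = (\<integral>\<^sup>+y. ennreal (\<bar>g y\<bar> powr p) * (\<integral>\<^sup>+x. ?H t y x \<partial>lborel) \<partial>lborel)"
      \<comment> \<open>Symmetry of the kernel brings the inner integral over \<open>x\<close> into
        the form that \<open>le\<close> bounds.\<close>
      by (simp add: nn_integral_cmult hermite_heat_kernel_commute[of t _ "_ :: real ^ 'n", symmetric] cong: nn_integral_cong)
    also have "(\<integral>\<^sup>+x. indicator ?B x * (\<integral>\<^sup>+y. ?H t x y \<partial>lborel) \<partial>lborel) +
        (\<integral>\<^sup>+y. ennreal (\<bar>g y\<bar> powr p) * (\<integral>\<^sup>+x. ?H t y x \<partial>lborel) \<partial>lborel) \<le>
        (\<integral>\<^sup>+x. indicator ?B x * ennreal (C * exp (- t)) \<partial>lborel) +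
        (\<integral>\<^sup>+y. ennreal (\<bar>g y\<bar> powr p) * ennreal (C * exp (- t)) \<partial>lborel)"
      by (intro add_mono nn_integral_mono mult_left_mono le t) auto
    also have "\<dots> = ennreal (C * exp (- t)) * (emeasure lborel ?B + ?P)"
      by (simp add: nn_integral_multc, simp add: distrib_left mult.commute)
    finally show ?thesis .
  qed
  have "?L = (\<integral>\<^sup>+x. \<integral>\<^sup>+y. \<integral>\<^sup>+t. indicator {0<..} t * ennreal (t powr (- 1 / 2)) *
      ?Q t x y \<partial>lborel \<partial>lborel \<partial>lborel)"
    by (simp add: hermite_heat_kernel_nonneg ennreal_mult mult_ac flip: nn_integral_cmult nn_integral_multc)
  also have "\<dots> = (\<integral>\<^sup>+x. \<integral>\<^sup>+t. \<integral>\<^sup>+y. indicator {0<..} t * ennreal (t powr (- 1 / 2)) *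
      ?Q t x y \<partial>lborel \<partial>lborel \<partial>lborel)"
    by (intro nn_integral_cong lborel_pair.Fubini') measurable
  also have "\<dots> = (\<integral>\<^sup>+t. \<integral>\<^sup>+x. \<integral>\<^sup>+y. indicator {0<..} t * ennreal (t powr (- 1 / 2)) *
      ?Q t x y \<partial>lborel \<partial>lborel \<partial>lborel)"
    by (intro lborel_pair.Fubini') measurable
  also have "\<dots> = (\<integral>\<^sup>+t. indicator {0<..} t * ennreal (t powr (- 1 / 2)) * (\<integral>\<^sup>+x. \<integral>\<^sup>+y.
      ?Q t x y \<partial>lborel \<partial>lborel) \<partial>lborel)"
    by (simp add: nn_integral_cmult)
  also have "\<dots> \<le> (\<integral>\<^sup>+t. (ennreal C * (emeasure lborel ?B + ?P)) *
      ennreal (indicator {0..} t * t powr (1 / 2 - 1) / exp t) \<partial>lborel)"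
  proof (intro nn_integral_mono)
    fix t :: real
    show "indicator {0<..} t * ennreal (t powr (- 1 / 2)) * (\<integral>\<^sup>+x. \<integral>\<^sup>+y.
      ?Q t x y \<partial>lborel \<partial>lborel) \<le> (ennreal C * (emeasure lborel ?B + ?P)) *
      ennreal (indicator {0..} t * t powr (1 / 2 - 1) / exp t)"
    proof (cases "t > 0")
      case True
      have "ennreal (t powr (- 1 / 2)) * (\<integral>\<^sup>+x. \<integral>\<^sup>+y. ?Q t x y \<partial>lborel \<partial>lborel) \<le>
          ennreal (t powr (- 1 / 2)) * (ennreal (C * exp (- t)) * (emeasure lborel ?B + ?P))"
        by (intro mult_left_mono fixed True) simp
      also have "\<dots> = ennreal (t powr (- 1 / 2)) * ennreal (C * exp (- t)) * (emeasure lborel ?B + ?P)"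
        by (simp only: mult.assoc)
      also have "ennreal (t powr (- 1 / 2)) * ennreal (C * exp (- t)) = ennreal C * ennreal (t powr (- 1 / 2) / exp t)"
        using C by (simp add: exp_minus field_simps flip: ennreal_mult')
      finally show ?thesis using True by (simp add: mult_ac)
    qed auto
  qed
  also have "\<dots> = ennreal C * (emeasure lborel ?B + ?P) * ennreal (Gamma (1 / 2))"
    by (subst nn_integral_cmult) (simp_all add: Gamma_conv_nn_integral_real)
  also have "\<dots> < \<infinity>"
    using g emeasure_lborel_cball_finite[of "0 :: real ^ 'n" R] by (simp add: ennreal_mult_less_top)
  finally show ?thesis .
qed

text \<open>The kernel and the potential are bounded by the corresponding integrals of absolute
  values, to which the preceding lemma applies. Local integrability is what gives the pairings of
  \<open>f\<close> with test functions a meaning.\<close>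

lemma hermite_neg_power_locally_L1:
  fixes g :: "real ^ 'n::finite \<Rightarrow> real"
  assumes g: "g \<in> borel_measurable lebesgue" and p: "p \<ge> 1"
    and int: "(\<integral>\<^sup>+x. ennreal (\<bar>g x\<bar> powr p) \<partial>lebesgue) < \<infinity>"
  shows "locally_L1 (hermite_neg_power (1 / 2) g)"
proof -
  obtain h where h[measurable]: "h \<in> borel_measurable lborel" and gh: "AE x in lborel. g x = h x"
    using completion_ex_borel_measurable_real[OF g] by blast
  have hb[measurable]: "h \<in> borel_measurable borel" using h by simp
  let ?K = "hermite_power_kernel (1 / 2) :: real ^ 'n \<Rightarrow> real ^ 'n \<Rightarrow> real"
  have Km[measurable]: "(\<lambda>z. ?K (fst z) (snd z)) \<in> borel_measurable (lborel \<Otimes>\<^sub>M lborel)"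
    unfolding hermite_power_kernel_def set_lebesgue_integral_def by measurable
  have Kx[measurable]: "?K x \<in> borel_measurable borel" for x
    unfolding hermite_power_kernel_def set_lebesgue_integral_def by measurable
  have eq: "hermite_neg_power (1 / 2) g = (\<lambda>x. LINT y|lborel. ?K x y * h y)"
  proof (rule ext)
    fix x
    have "hermite_neg_power (1 / 2) g x = (LINT y|lebesgue. ?K x y * h y)"
      unfolding hermite_neg_power_def
    proof (rule integral_cong_AE)
      show "AE y in lebesgue. ?K x y * g y = ?K x y * h y"
        using AE_completion[OF gh] by eventually_elim simp
      show "(\<lambda>y. ?K x y * g y) \<in> borel_measurable lebesgue"
        using Kx g by (intro borel_measurable_times) (auto intro: measurable_completion)
      show "(\<lambda>y. ?K x y * h y) \<in> borel_measurable lebesgue"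
        by (intro measurable_completion) measurable
    qed
    also have "\<dots> = (LINT y|lborel. ?K x y * h y)"
      by (intro integral_completion) measurable
    finally show "hermite_neg_power (1 / 2) g x = (LINT y|lborel. ?K x y * h y)" .
  qed
  have int': "abs_powr_int p h < \<infinity>"
  proof -
    have "abs_powr_int p h = abs_powr_int p g"
      using gh by (intro nn_integral_cong_AE) (auto elim!: eventually_mono)
    then show ?thesis using int by (simp add: nn_integral_completion)
  qed
  let ?c = "1 / Gamma (1 / 2) :: real"
  let ?N = "\<lambda>x y. \<integral>\<^sup>+t. indicator {0<..} t * ennreal (hermite_heat_kernel t x y * t powr (- 1 / 2)) \<partial>lborel"
  have c: "?c > 0" by (simp add: Gamma_real_pos)
  have K: "ennreal \<bar>?K x y\<bar> \<le> ennreal ?c * ?N x y" for x y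
  proof -
    have "ennreal \<bar>?K x y\<bar> = ennreal ?c * ennreal (norm (LINT t:{0<..}|lborel. hermite_heat_kernel t x y * t powr (1 / 2 - 1)))"
      using c by (simp add: hermite_power_kernel_def abs_mult flip: ennreal_mult')
    also have "\<dots> \<le> ennreal ?c * (\<integral>\<^sup>+t. ennreal (norm (indicator {0<..} t *\<^sub>R (hermite_heat_kernel t x y * t powr (1 / 2 - 1)))) \<partial>lborel)"
      unfolding set_lebesgue_integral_def
    proof (intro mult_left_mono)
      show "ennreal (norm (LINT t|lborel. indicator {0<..} t *\<^sub>R (hermite_heat_kernel t x y * t powr (1 / 2 - 1)))) \<le>
          (\<integral>\<^sup>+t. ennreal (norm (indicator {0<..} t *\<^sub>R (hermite_heat_kernel t x y * t powr (1 / 2 - 1)))) \<partial>lborel)"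
        (is "ennreal (norm (integral\<^sup>L lborel ?F)) \<le> _")
      \<comment> \<open>Where the time integral diverges, as it may on the diagonal, the Bochner
        integral has the value 0 and the bound is trivial. The integral over \<open>y\<close> is
        treated likewise below.\<close>
      proof (cases "integrable lborel ?F")
        case True
        then show ?thesis by (rule integral_norm_bound_ennreal)
      next
        case False
        then show ?thesis by (simp add: not_integrable_integral_eq)
      qed
    qed simp
    also have "(\<integral>\<^sup>+t. ennreal (norm (indicator {0<..} t *\<^sub>R (hermite_heat_kernel t x y * t powr (1 / 2 - 1)))) \<partial>lborel) = ?N x y"
      by (intro nn_integral_cong) (auto simp: indicator_def hermite_heat_kernel_nonneg abs_mult)
    finally show ?thesis .
  qed
  show ?thesis
    unfolding locally_L1_def eq
  proof (intro conjI allI)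
    show "(\<lambda>x. LINT y|lborel. ?K x y * h y) \<in> borel_measurable borel"
      using lborel.borel_measurable_lebesgue_integral[of "\<lambda>x y. ?K x y * h y" borel] Km by measurable
    fix R
    have "(\<integral>\<^sup>+x. ennreal \<bar>LINT y|lborel. ?K x y * h y\<bar> * indicator (cball 0 R) x \<partial>lborel) \<le>
        (\<integral>\<^sup>+x. ennreal ?c * (indicator (cball 0 R) x * (\<integral>\<^sup>+y. ?N x y * ennreal \<bar>h y\<bar> \<partial>lborel)) \<partial>lborel)"
    proof (intro nn_integral_mono)
      fix x :: "real ^ 'n"
      have "ennreal \<bar>LINT y|lborel. ?K x y * h y\<bar> \<le> (\<integral>\<^sup>+y. ennreal \<bar>?K x y * h y\<bar> \<partial>lborel)"
      proof (cases "integrable lborel (\<lambda>y. ?K x y * h y)")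
        case True
        then show ?thesis using integral_norm_bound_ennreal by fastforce
      next
        case False
        then show ?thesis by (simp add: not_integrable_integral_eq)
      qed
      also have "\<dots> \<le> (\<integral>\<^sup>+y. ennreal ?c * (?N x y * ennreal \<bar>h y\<bar>) \<partial>lborel)"
      proof (intro nn_integral_mono)
        fix y
        show "ennreal \<bar>?K x y * h y\<bar> \<le> ennreal ?c * (?N x y * ennreal \<bar>h y\<bar>)"
          using mult_right_mono[OF K[of x y], of "ennreal \<bar>h y\<bar>"] by (simp add: abs_mult ennreal_mult' mult.assoc)
      qed
      also have "\<dots> = ennreal ?c * (\<integral>\<^sup>+y. ?N x y * ennreal \<bar>h y\<bar> \<partial>lborel)"
        by (intro nn_integral_cmult) measurable
      finally show "ennreal \<bar>LINT y|lborel. ?K x y * h y\<bar> * indicator (cball 0 R) x \<le>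
          ennreal ?c * (indicator (cball 0 R) x * (\<integral>\<^sup>+y. ?N x y * ennreal \<bar>h y\<bar> \<partial>lborel))"
        by (auto simp: indicator_def)
    qed
    also have "\<dots> = ennreal ?c * (\<integral>\<^sup>+x. indicator (cball 0 R) x * (\<integral>\<^sup>+y. ?N x y * ennreal \<bar>h y\<bar> \<partial>lborel) \<partial>lborel)"
    proof (intro nn_integral_cmult)
      have [measurable]: "cball (0 :: real ^ 'n) R \<in> sets borel" by simp
      show "(\<lambda>x. indicator (cball 0 R) x * (\<integral>\<^sup>+y. ?N x y * ennreal \<bar>h y\<bar> \<partial>lborel)) \<in> borel_measurable lborel"
        by measurable
    qed
    also have "\<dots> < \<infinity>"
      using hermite_heat_kernel_potential_finite[OF hb p int', of R] by (simp add: ennreal_mult_less_top)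
    finally show "(\<integral>\<^sup>+x. ennreal \<bar>LINT y|lborel. ?K x y * h y\<bar> * indicator (cball 0 R) x \<partial>lborel) < \<infinity>" .
  qed
qed

section \<open>The Hermite gradient\<close>

lemma measurable_cball[measurable]: "cball (x :: 'a::metric_space) r \<in> sets borel"
  by simp

lemma conv_sum_kernel:
  assumes "\<And>j. j \<in> I \<Longrightarrow> integrable lborel (\<lambda>y. f y * k j (x - y))"
  shows "conv f (\<lambda>z. \<Sum>j\<in>I. c j * k j z) x = (\<Sum>j\<in>I. c j * conv f (k j) x)"
proof -
  have "conv f (\<lambda>z. \<Sum>j\<in>I. c j * k j z) x = (LINT y|lborel. (\<Sum>j\<in>I. c j * (f y * k j (x - y))))"
    unfolding conv_def by (simp add: sum_distrib_left mult_ac)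
  also have "\<dots> = (\<Sum>j\<in>I. c j * conv f (k j) x)"
    using assms by (subst Bochner_Integration.integral_sum) (auto simp: conv_def)
  finally show ?thesis .
qed

text \<open>A directional derivative is a combination of the partial ones with coefficients
  \<open>w $ j\<close> of modulus at most 1; the sum over \<open>j\<close> costs the factor
  \<open>CARD('n)\<close>.\<close>

lemma mollified_C1_dominated:
  fixes f \<Gamma> :: "real ^ 'n::finite \<Rightarrow> real"
  assumes f: "locally_L1 f" and \<Gamma>: "locally_L1 \<Gamma>" "\<And>x. \<Gamma> x \<ge> 0" and e: "e > 0"
    and grad: "\<And>j x. \<bar>conv f (mollifier_partial e j) x\<bar> \<le> conv \<Gamma> (mollifier e) x"
  shows "C1_dominated (conv f (mollifier e)) (\<lambda>x. real CARD('n) * conv \<Gamma> (mollifier e) x)"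
proof -
  note props = mollifier_props[OF e]
  note dprops = mollifier_deriv_props[OF e]
  have G0: "conv \<Gamma> (mollifier e) x \<ge> 0" for x
    unfolding conv_def by (intro integral_nonneg_AE AE_I2 mult_nonneg_nonneg \<Gamma>(2) props(1))
  show ?thesis
    unfolding C1_dominated_def
  proof (intro conjI allI impI exI[of _ "\<lambda>x w. conv f (\<lambda>z. mollifier_deriv e z w) x"])
    show "continuous_on UNIV (conv f (mollifier e))"
      by (rule conv_continuous[OF f props(3,2)])
    show "(\<lambda>x. real CARD('n) * conv \<Gamma> (mollifier e) x) \<in> borel_measurable borel"
      using conv_continuous[OF \<Gamma>(1) props(3,2)]
      by (intro borel_measurable_times borel_measurable_continuous_onI) auto
    show "0 \<le> real CARD('n) * conv \<Gamma> (mollifier e) x" for x using G0 by simp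
    show "continuous_on UNIV (\<lambda>x. conv f (\<lambda>z. mollifier_deriv e z w) x)" for w
      by (rule conv_continuous[OF f dprops(2,1)])
    show "((\<lambda>r. conv f (mollifier e) (x + r *\<^sub>R w)) has_real_derivative
        conv f (\<lambda>z. mollifier_deriv e z w) (x + r *\<^sub>R w)) (at r)" for x w r
    proof (rule conv_has_derivative[OF f props(3,2) dprops(2,1)])
      fix z :: "real ^ 'n" and s :: real
      have "((\<lambda>s. z + s *\<^sub>R w) has_derivative (\<lambda>h. h *\<^sub>R w)) (at s)"
        by (auto intro!: derivative_eq_intros)
      from has_derivative_compose[OF this mollifier_has_derivative[OF e]]
      show "((\<lambda>s. mollifier e (z + s *\<^sub>R w)) has_real_derivative mollifier_deriv e (z + s *\<^sub>R w) w) (at s)"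
        by (simp add: has_field_derivative_def linear_scale[OF dprops(3)] mult.commute[of _ "mollifier_deriv e (z + s *\<^sub>R w) w"])
    qed
    show "\<bar>conv f (\<lambda>z. mollifier_deriv e z w) x\<bar> \<le> real CARD('n) * conv \<Gamma> (mollifier e) x" if w: "norm w \<le> 1" for x w
    proof -
      have "mollifier_deriv e z w = (\<Sum>j\<in>UNIV. w $ j * mollifier_deriv e z (axis j 1))" for z
      proof -
        have "mollifier_deriv e z w = mollifier_deriv e z (\<Sum>j\<in>UNIV. w $ j *\<^sub>R axis j 1)"
          by (simp add: basis_expansion flip: scalar_mult_eq_scaleR)
        also have "\<dots> = (\<Sum>j\<in>UNIV. w $ j * mollifier_deriv e z (axis j 1))"
          by (simp add: linear_sum[OF dprops(3)] linear_scale[OF dprops(3)])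
        finally show ?thesis .
      qed
      then have "conv f (\<lambda>z. mollifier_deriv e z w) x = conv f (\<lambda>z. \<Sum>j\<in>UNIV. w $ j * mollifier_deriv e z (axis j 1)) x"
        by presburger
      also have "\<dots> = (\<Sum>j\<in>UNIV. w $ j * conv f (mollifier_partial e j) x)"
        by (rule conv_sum_kernel) (rule conv_integrable[OF f dprops(2,1)])
      also have "\<bar>\<dots>\<bar> \<le> (\<Sum>j\<in>UNIV. \<bar>w $ j * conv f (mollifier_partial e j) x\<bar>)"
        by (rule sum_abs)
      also have "\<dots> \<le> (\<Sum>j\<in>(UNIV :: 'n set). conv \<Gamma> (mollifier e) x)"
      proof (rule sum_mono)
        fix j
        have "\<bar>w $ j\<bar> \<le> 1" using component_le_norm_cart[of w j] w by simp
        then have "\<bar>w $ j\<bar> * \<bar>conv f (mollifier_partial e j) x\<bar> \<le> 1 * conv \<Gamma> (mollifier e) x"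
          using grad by (intro mult_mono) auto
        then show "\<bar>w $ j * conv f (mollifier_partial e j) x\<bar> \<le> conv \<Gamma> (mollifier e) x"
          by (simp add: abs_mult)
      qed
      finally show ?thesis by simp
    qed
  qed
qed

lemma nn_integral_le_Fatou:
  fixes u :: "nat \<Rightarrow> 'a \<Rightarrow> ennreal"
  assumes [measurable]: "\<And>n. u n \<in> borel_measurable M"
    and lim: "AE x in M. (\<lambda>n. u n x) \<longlonglongrightarrow> f x" and le: "\<And>n. (\<integral>\<^sup>+x. u n x \<partial>M) \<le> c"
  shows "(\<integral>\<^sup>+x. f x \<partial>M) \<le> c"
proof -
  have "(\<integral>\<^sup>+x. f x \<partial>M) = (\<integral>\<^sup>+x. liminf (\<lambda>n. u n x) \<partial>M)"
    using lim by (intro nn_integral_cong_AE) (auto elim!: eventually_mono dest!: lim_imp_Liminf[OF sequentially_bot])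
  also have "\<dots> \<le> liminf (\<lambda>n. \<integral>\<^sup>+x. u n x \<partial>M)"
    by (intro nn_integral_liminf) auto
  also have "\<dots> \<le> liminf (\<lambda>n. c)"
    using le by (intro Liminf_mono) auto
  finally show ?thesis by (simp add: Liminf_const)
qed

text \<open>The derivative is tested by mollification: \<open>conv f (mollifier_partial e j)\<close> is the
  mollification of the weak derivative \<open>\<partial>\<^sub>j f\<close>.\<close>

definition hermite_dominated :: "(real ^ 'n::finite \<Rightarrow> real) \<Rightarrow> (real ^ 'n \<Rightarrow> real) \<Rightarrow> bool"
  where "hermite_dominated f \<Gamma> \<longleftrightarrow> locally_L1 f \<and> locally_L1 \<Gamma> \<and> (\<forall>x. \<Gamma> x \<ge> 0) \<and>
    (AE x in lborel. norm x * \<bar>f x\<bar> \<le> real CARD('n) * \<Gamma> x) \<and>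
    (\<forall>e>0. \<forall>j x. \<bar>conv f (mollifier_partial e j) x\<bar> \<le> conv \<Gamma> (mollifier e) x)"

lemma hermite_dominatedD:
  fixes f :: "real ^ 'n::finite \<Rightarrow> real"
  assumes "hermite_dominated f \<Gamma>"
  shows "locally_L1 f" "locally_L1 \<Gamma>" "\<Gamma> x \<ge> 0"
    "AE x in lborel. norm x * \<bar>f x\<bar> \<le> real CARD('n) * \<Gamma> x"
    "e > 0 \<Longrightarrow> \<bar>conv f (mollifier_partial e j) x\<bar> \<le> conv \<Gamma> (mollifier e) x"
  using assms by (simp_all add: hermite_dominated_def)

text \<open>\<open>sobolev_confined\<close> is applied to mollifications at scale at most 1. Their
  constants are uniform: the factor \<open>?d\<close> comes from
  \<open>mollified_C1_dominated\<close> and from the weight bound, the factor 2 from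
  \<open>mollify_powr_integral_le\<close>. Fatou's lemma then passes to the limit.\<close>

lemma weighted_sobolev:
  fixes p q :: real
  assumes p: "1 \<le> p" "p \<le> q" and pq: "real CARD('n::finite) * (q - p) \<le> p * q"
  obtains C where "C > 0"
    "\<And>(f :: real ^ 'n \<Rightarrow> real) \<Gamma> N. hermite_dominated f \<Gamma> \<Longrightarrow> N > 0 \<Longrightarrow>
      powr_int p \<Gamma> \<le> ennreal (N powr p) \<Longrightarrow>
      abs_powr_int q f \<le> ennreal (C * N powr q)"
proof -
  let ?d = "real CARD('n)"
  have d: "?d > 0" by simp
  obtain C where C: "C > 0" and sob:
    "\<And>(u :: real ^ 'n \<Rightarrow> real) g N. C1_dominated u g \<Longrightarrow> N > 0 \<Longrightarrow> (\<And>x. norm x \<ge> 2 \<Longrightarrow> \<bar>u x\<bar> \<le> g x) \<Longrightarrow>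
      powr_int p g \<le> ennreal (N powr p) \<Longrightarrow>
      abs_powr_int q u \<le> ennreal (C * N powr q)"
    using sobolev_confined[OF p, where 'a = "real ^ 'n"] pq by auto
  show thesis
  proof (rule that[of "C * (2 * ?d) powr q"])
    show "C * (2 * ?d) powr q > 0" using C by simp
    fix f \<Gamma> :: "real ^ 'n \<Rightarrow> real" and N :: real
    assume dom: "hermite_dominated f \<Gamma>" and N: "N > 0"
      and int: "powr_int p \<Gamma> \<le> ennreal (N powr p)"
    note f = hermite_dominatedD(1)[OF dom] and \<Gamma> = hermite_dominatedD(2,3)[OF dom]
      and wt = hermite_dominatedD(4)[OF dom] and grad = hermite_dominatedD(5)[OF dom]
    have [measurable]: "f \<in> borel_measurable borel" "\<Gamma> \<in> borel_measurable borel"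
      using f \<Gamma> by (simp_all add: locally_L1_def)
    have moll: "(\<integral>\<^sup>+x. ennreal (\<bar>conv f (mollifier e) x\<bar> powr q) \<partial>lborel) \<le> ennreal (C * (2 * ?d * N) powr q)"
      if e: "0 < e" "e \<le> 1" for e
    proof (rule sob)
      show "C1_dominated (conv f (mollifier e)) (\<lambda>x. ?d * conv \<Gamma> (mollifier e) x)"
        by (rule mollified_C1_dominated[OF f \<Gamma> e(1) grad[OF e(1)]])
      show "2 * ?d * N > 0" using d N by simp
      have [measurable]: "conv \<Gamma> (mollifier e) \<in> borel_measurable borel"
        using conv_continuous[OF \<Gamma>(1) mollifier_props(3,2)[OF e(1)]] by (rule borel_measurable_continuous_onI)
      have G0: "conv \<Gamma> (mollifier e) x \<ge> 0" for x
        unfolding conv_def by (intro integral_nonneg_AE AE_I2 mult_nonneg_nonneg \<Gamma>(2) mollifier_props(1)[OF e(1)])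
      show "\<bar>conv f (mollifier e) x\<bar> \<le> ?d * conv \<Gamma> (mollifier e) x" if x: "norm x \<ge> 2" for x
      proof -
        have "\<bar>conv f (mollifier e) x\<bar> \<le> conv (\<lambda>y. ?d * \<Gamma> y) (mollifier e) x"
        proof (rule mollifier_conv_abs_le[OF f e(1)])
          have "(\<integral>\<^sup>+y. ennreal \<bar>?d * \<Gamma> y\<bar> * indicator (cball 0 R) y \<partial>lborel) =
              ennreal ?d * (\<integral>\<^sup>+y. ennreal \<bar>\<Gamma> y\<bar> * indicator (cball 0 R) y \<partial>lborel)" for R
            by (subst nn_integral_cmult[symmetric]) (simp_all add: abs_mult ennreal_mult' mult.assoc)
          then show "locally_L1 (\<lambda>y. ?d * \<Gamma> y)"
            using \<Gamma>(1) by (auto simp: locally_L1_def ennreal_mult_less_top)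
          show "AE y in lborel. norm (x - y) < e \<longrightarrow> \<bar>f y\<bar> \<le> ?d * \<Gamma> y"
            using wt
          proof eventually_elim
            case (elim y)
            show ?case
            proof
              assume "norm (x - y) < e"
              then have "norm y \<ge> 1"
                using norm_triangle_sub[of x y] x e(2) by linarith
              then have "1 * \<bar>f y\<bar> \<le> norm y * \<bar>f y\<bar>" by (intro mult_right_mono) auto
              with elim show "\<bar>f y\<bar> \<le> ?d * \<Gamma> y" by simp
            qed
          qed
        qed
        then show ?thesis by (simp add: conv_def mult.assoc)
      qed
      have "(\<integral>\<^sup>+x. ennreal ((?d * conv \<Gamma> (mollifier e) x) powr p) \<partial>lborel) =
          (\<integral>\<^sup>+x. ennreal (?d powr p) * ennreal (conv \<Gamma> (mollifier e) x powr p) \<partial>lborel)"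
        using G0 by (simp add: powr_mult flip: ennreal_mult')
      also have "\<dots> = ennreal (?d powr p) * (\<integral>\<^sup>+x. ennreal (conv \<Gamma> (mollifier e) x powr p) \<partial>lborel)"
        by (intro nn_integral_cmult) auto
      also have "\<dots> \<le> ennreal (?d powr p) * (ennreal (2 powr p) * ennreal (N powr p))"
        by (intro mult_left_mono order_trans[OF mollify_powr_integral_le[OF \<Gamma> e(1) p(1)]] int) auto
      also have "\<dots> = ennreal ((2 * ?d * N) powr p)"
        using N by (simp add: powr_mult mult_ac flip: ennreal_mult')
      finally show "(\<integral>\<^sup>+x. ennreal ((?d * conv \<Gamma> (mollifier e) x) powr p) \<partial>lborel) \<le> ennreal ((2 * ?d * N) powr p)" .
    qed
    \<comment> \<open>The scales supplied by \<open>mollify_AE\<close> depend on the ball, so the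
      bound is first obtained on each ball with a constant free of \<open>R\<close>; a second use of
      Fatou's lemma exhausts the space.\<close>
    have loc: "(\<integral>\<^sup>+x. indicator (cball 0 R) x * ennreal (\<bar>f x\<bar> powr q) \<partial>lborel) \<le> ennreal (C * (2 * ?d * N) powr q)" for R
    proof -
      obtain e :: "nat \<Rightarrow> real" where e: "\<And>n. 0 < e n" "\<And>n. e n \<le> 1"
        and lim: "AE x in lborel. norm x \<le> R \<longrightarrow> (\<lambda>n. conv f (mollifier (e n)) x) \<longlonglongrightarrow> f x"
        using mollify_AE[OF f] by blast
      have [measurable]: "conv f (mollifier (e n)) \<in> borel_measurable borel" for n
        using conv_continuous[OF f mollifier_props(3,2)[OF e(1)]] by (rule borel_measurable_continuous_onI)
      show ?thesis
      proof (rule nn_integral_le_Fatou)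
        show "AE x in lborel. (\<lambda>n. indicator (cball 0 R) x * ennreal (\<bar>conv f (mollifier (e n)) x\<bar> powr q)) \<longlonglongrightarrow>
            indicator (cball 0 R) x * ennreal (\<bar>f x\<bar> powr q)"
          using lim
        proof eventually_elim
          case (elim x)
          show ?case
          proof (cases "norm x \<le> R")
            case True
            with elim have "(\<lambda>n. \<bar>conv f (mollifier (e n)) x\<bar> powr q) \<longlonglongrightarrow> \<bar>f x\<bar> powr q"
              using p by (intro tendsto_powr') (auto intro: tendsto_rabs)
            then show ?thesis using True by simp
          qed simp
        qed
        show "(\<integral>\<^sup>+x. indicator (cball 0 R) x * ennreal (\<bar>conv f (mollifier (e n)) x\<bar> powr q) \<partial>lborel) \<le> ennreal (C * (2 * ?d * N) powr q)" for n
          using e by (intro order_trans[OF nn_integral_mono moll]) (auto simp: indicator_def)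
      qed simp
    qed
    have "abs_powr_int q f \<le> ennreal (C * (2 * ?d * N) powr q)"
    proof (rule nn_integral_le_Fatou)
      show "AE x in lborel. (\<lambda>n. indicator (cball 0 (real n)) x * ennreal (\<bar>f x\<bar> powr q)) \<longlonglongrightarrow> ennreal (\<bar>f x\<bar> powr q)"
      proof (intro AE_I2 tendsto_eventually)
        fix x :: "real ^ 'n"
        obtain m where "norm x \<le> real m" using real_arch_simple by blast
        then show "\<forall>\<^sub>F n in sequentially. indicator (cball 0 (real n)) x * ennreal (\<bar>f x\<bar> powr q) = ennreal (\<bar>f x\<bar> powr q)"
          by (intro eventually_sequentiallyI[of m]) auto
      qed
    qed (use loc in auto)
    then show "abs_powr_int q f \<le> ennreal (C * (2 * ?d) powr q * N powr q)"
      using N by (simp add: powr_mult mult.assoc)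
  qed
qed

text \<open>In essence Hoelder's inequality for the product of (1 + |x|) f in L^p and (1 + |x|)^(-1)
  in L^r, where 1/q = 1/p + 1/r. It is carried out pointwise, as a sum of a p-th power and the
  weight (1 + |x|)^(-r). The L^p bound on \<open>f\<close> itself is the case of equal exponents of
  \<open>weighted_sobolev\<close>.\<close>

lemma weighted_sobolev_low:
  fixes p q :: real
  assumes p: "1 \<le> p" "1 \<le> q" "q < p" and r: "real CARD('n::finite) < p * q / (p - q)"
  obtains C where "C > 0"
    "\<And>(f :: real ^ 'n \<Rightarrow> real) \<Gamma> N. hermite_dominated f \<Gamma> \<Longrightarrow> N > 0 \<Longrightarrow>
      powr_int p \<Gamma> \<le> ennreal (N powr p) \<Longrightarrow>
      abs_powr_int q f \<le> ennreal (C * N powr q)"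
proof -
  let ?d = "real CARD('n)"
  define r where "r = p * q / (p - q)"
  let ?W = "\<lambda>x :: real ^ 'n. ennreal ((1 + norm x) powr (- r))"
  obtain C where C: "C > 0" and sob:
    "\<And>(f :: real ^ 'n \<Rightarrow> real) \<Gamma> N. hermite_dominated f \<Gamma> \<Longrightarrow> N > 0 \<Longrightarrow>
      powr_int p \<Gamma> \<le> ennreal (N powr p) \<Longrightarrow>
      abs_powr_int p f \<le> ennreal (C * N powr p)"
    by (rule weighted_sobolev[of p p, where 'n = 'n]) (use p in auto)
  obtain W where W: "(\<integral>\<^sup>+x. ?W x \<partial>lborel) = ennreal W" "W \<ge> 0"
    using weight_integral_finite[of r, where 'a = "real ^ 'n"] r
    by (cases "\<integral>\<^sup>+x. ?W x \<partial>lborel") (auto simp: r_def)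
  define K where "K = 2 powr p * (C + ?d powr p) + W"
  have K: "K > 0" using C W by (auto simp: K_def intro!: add_pos_nonneg mult_pos_pos)
  show thesis
  proof (rule that[OF K])
    fix f \<Gamma> :: "real ^ 'n \<Rightarrow> real" and N :: real
    assume dom: "hermite_dominated f \<Gamma>" and N: "N > 0"
      and int: "powr_int p \<Gamma> \<le> ennreal (N powr p)"
    note f = hermite_dominatedD(1)[OF dom] and \<Gamma> = hermite_dominatedD(2,3)[OF dom]
      and wt = hermite_dominatedD(4)[OF dom] and grad = hermite_dominatedD(5)[OF dom]
    have [measurable]: "f \<in> borel_measurable borel" "\<Gamma> \<in> borel_measurable borel"
      using f \<Gamma> by (simp_all add: locally_L1_def)
    have fp: "abs_powr_int p f \<le> ennreal (C * N powr p)"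
      by (rule sob[OF dom N int])
    let ?k = "N powr (q - p) * 2 powr p"
    have pw: "\<bar>f x\<bar> powr q \<le> ?k * \<bar>f x\<bar> powr p + ?k * ?d powr p * \<Gamma> x powr p + N powr q * (1 + norm x) powr (- r)"
      if le: "norm x * \<bar>f x\<bar> \<le> ?d * \<Gamma> x" for x
    proof -
      have pos: "1 + norm x > 0" using norm_ge_zero[of x] by linarith
      define F where "F = (1 + norm x) * \<bar>f x\<bar>"
      have F: "F \<ge> 0" using pos by (simp add: F_def)
      have "F powr p \<le> (2 * max \<bar>f x\<bar> (?d * \<Gamma> x)) powr p"
        using le p pos by (intro powr_mono2) (auto simp: F_def distrib_right max_def)
      also have "\<dots> = 2 powr p * (max \<bar>f x\<bar> (?d * \<Gamma> x)) powr p"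
        by (rule powr_mult)
      also have "\<dots> \<le> 2 powr p * (\<bar>f x\<bar> powr p + ?d powr p * \<Gamma> x powr p)"
        using powr_mult[of ?d "\<Gamma> x" p] by (intro mult_left_mono) (auto simp: max_def)
      finally have Fp: "F powr p \<le> 2 powr p * (\<bar>f x\<bar> powr p + ?d powr p * \<Gamma> x powr p)" .
      have "\<bar>f x\<bar> = F / (1 + norm x)" using pos by (simp add: F_def)
      then have fq: "\<bar>f x\<bar> powr q = F powr q * (1 + norm x) powr (- q)"
        by (simp only: powr_divide powr_minus_divide) simp
      have "\<bar>f x\<bar> powr q \<le> N powr (q - p) * F powr p + N powr q * (1 + norm x) powr (- r)"
      \<comment> \<open>At this threshold the two terms on the right are equal; above it the first
        one dominates, below it the second.\<close>
      proof (cases "F / N \<ge> (1 + norm x) powr (- q / (p - q))")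
        case True
        moreover have "0 < (1 + norm x) powr (- q / (p - q))" using pos by simp
        ultimately have "0 < F / N" by linarith
        then have FN: "F > 0" using N by (simp add: zero_less_divide_iff)
        have "(1 + norm x) powr (- q) = ((1 + norm x) powr (- q / (p - q))) powr (p - q)"
          using p by (simp add: powr_powr)
        also have "\<dots> \<le> (F / N) powr (p - q)"
          using True p by (intro powr_mono2) auto
        finally have "F powr q * (1 + norm x) powr (- q) \<le> F powr q * (F / N) powr (p - q)"
          by (intro mult_left_mono) auto
        also have "\<dots> = N powr (q - p) * F powr p"
          using FN N by (simp add: powr_divide powr_diff field_simps)
        finally have "\<bar>f x\<bar> powr q \<le> N powr (q - p) * F powr p"
          by (simp only: fq)
        then show ?thesis by (simp add: add_increasing2)
      next
        case False
        then have "F \<le> N * (1 + norm x) powr (- q / (p - q))"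
          using N by (simp add: field_simps)
        then have "F powr q \<le> (N * (1 + norm x) powr (- q / (p - q))) powr q"
          using F p by (intro powr_mono2) auto
        also have "\<dots> = N powr q * (1 + norm x) powr (- q / (p - q) * q)"
          using N by (simp add: powr_mult powr_powr)
        finally have "F powr q * (1 + norm x) powr (- q) \<le> N powr q * (1 + norm x) powr (- q / (p - q) * q) * (1 + norm x) powr (- q)"
          by (intro mult_right_mono) auto
        also have "\<dots> = N powr q * (1 + norm x) powr (- r)"
        proof -
          have "- q / (p - q) * q + - q = - r" using p by (simp add: r_def field_simps)
          then show ?thesis by (metis powr_add mult.assoc)
        qed
        finally have "\<bar>f x\<bar> powr q \<le> N powr q * (1 + norm x) powr (- r)"
          by (simp only: fq)
        then show ?thesis by (simp add: add_increasing)
      qed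
      also have "\<dots> \<le> N powr (q - p) * (2 powr p * (\<bar>f x\<bar> powr p + ?d powr p * \<Gamma> x powr p)) + N powr q * (1 + norm x) powr (- r)"
        by (intro add_right_mono mult_left_mono Fp) simp
      also have "\<dots> = ?k * \<bar>f x\<bar> powr p + ?k * ?d powr p * \<Gamma> x powr p + N powr q * (1 + norm x) powr (- r)"
        by (simp add: algebra_simps)
      finally show ?thesis .
    qed
    have "abs_powr_int q f \<le>
        (\<integral>\<^sup>+x. ennreal ?k * ennreal (\<bar>f x\<bar> powr p) + ennreal (?k * ?d powr p) * ennreal (\<Gamma> x powr p) + ennreal (N powr q) * ?W x \<partial>lborel)"
      using wt
    proof (intro nn_integral_mono_AE, eventually_elim)
      case (elim x)
      have "ennreal (\<bar>f x\<bar> powr q) \<le> ennreal (?k * \<bar>f x\<bar> powr p + ?k * ?d powr p * \<Gamma> x powr p + N powr q * (1 + norm x) powr (- r))"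
        by (intro ennreal_leI pw elim)
      also have "\<dots> = ennreal ?k * ennreal (\<bar>f x\<bar> powr p) + ennreal (?k * ?d powr p) * ennreal (\<Gamma> x powr p) + ennreal (N powr q) * ?W x"
        by (simp add: ennreal_mult)
      finally show ?case .
    qed
    also have "\<dots> = ennreal ?k * abs_powr_int p f +
        ennreal (?k * ?d powr p) * powr_int p \<Gamma> + ennreal (N powr q) * (\<integral>\<^sup>+x. ?W x \<partial>lborel)"
      by (simp add: nn_integral_add nn_integral_cmult)
    also have "\<dots> \<le> ennreal ?k * ennreal (C * N powr p) + ennreal (?k * ?d powr p) * ennreal (N powr p) + ennreal (N powr q) * ennreal W"
      by (intro add_mono mult_left_mono fp int) (simp_all add: W)
    also have "\<dots> = ennreal (?k * (C * N powr p) + ?k * ?d powr p * N powr p + N powr q * W)"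
      using C W by (simp add: ennreal_mult')
    also have "?k * (C * N powr p) + ?k * ?d powr p * N powr p + N powr q * W = K * N powr q"
    proof -
      have "?k * N powr p = 2 powr p * N powr q" using N by (simp flip: powr_add)
      moreover have "k * (C * n) + k * a * n + m * W = (b * (C + a) + W) * m" if "k * n = b * m" for k n m a b :: real
      proof -
        have "k * (C * n) + k * a * n + m * W = (C + a) * (k * n) + m * W" by (simp add: algebra_simps)
        then show ?thesis by (simp add: that algebra_simps)
      qed
      ultimately show ?thesis unfolding K_def by blast
    qed
    finally show "abs_powr_int q f \<le> ennreal (K * N powr q)" .
  qed
qed

section \<open>From the distributional gradient to the dominating function\<close>

lemma distr_of_cong_AE:
  fixes F F' :: "real ^ 'n::finite \<Rightarrow> real"
  assumes eq: "AE x in lborel. F x = F' x" and [measurable]: "F' \<in> borel_measurable borel" "\<phi> \<in> borel_measurable borel"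
  shows "distr_of F \<phi> = (LINT x|lborel. F' x * \<phi> x)"
proof -
  have leb: "AE x in lebesgue. F' x = F x"
    using AE_completion[OF eq] by eventually_elim simp
  have "F \<in> borel_measurable lebesgue"
    by (rule borel_measurable_AE[OF _ leb]) (intro measurable_completion, simp)
  moreover have p: "\<phi> \<in> borel_measurable lebesgue" by (intro measurable_completion) simp
  ultimately have "distr_of F \<phi> = (LINT x|lebesgue. F' x * \<phi> x)"
    unfolding distr_of_def
  proof (intro integral_cong_AE)
    show "(\<lambda>x. F' x * \<phi> x) \<in> borel_measurable lebesgue" by (intro measurable_completion) simp
    show "AE x in lebesgue. F x * \<phi> x = F' x * \<phi> x" using leb by eventually_elim simp
  qed auto
  also have "\<dots> = (LINT x|lborel. F' x * \<phi> x)"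
    by (intro integral_completion) simp
  finally show ?thesis .
qed

lemma locally_L1_powr:
  fixes g :: "'a::euclidean_space \<Rightarrow> real"
  assumes [measurable]: "g \<in> borel_measurable borel" and p: "p \<ge> 1"
    and int: "abs_powr_int p g < \<infinity>"
  shows "locally_L1 g"
  unfolding locally_L1_def
proof (intro conjI allI)
  fix R
  have "(\<integral>\<^sup>+y. ennreal \<bar>g y\<bar> * indicator (cball 0 R) y \<partial>lborel) \<le>
      (\<integral>\<^sup>+y. indicator (cball 0 R) y + ennreal (\<bar>g y\<bar> powr p) \<partial>lborel)"
  proof (intro nn_integral_mono)
    fix y
    have "\<bar>g y\<bar> \<le> 1 + \<bar>g y\<bar> powr p" using le_add_scaled_powr[OF p, of 1 "\<bar>g y\<bar>"] by simp
    then have "ennreal \<bar>g y\<bar> \<le> 1 + ennreal (\<bar>g y\<bar> powr p)"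
      by (metis ennreal_1 ennreal_leI ennreal_plus powr_ge_zero zero_le_one)
    then show "ennreal \<bar>g y\<bar> * indicator (cball 0 R) y \<le> indicator (cball 0 R) y + ennreal (\<bar>g y\<bar> powr p)"
      by (auto simp: indicator_def)
  qed
  also have "\<dots> = emeasure lborel (cball (0::'a) R) + abs_powr_int p g"
    by (subst nn_integral_add) auto
  also have "\<dots> < \<infinity>" using int emeasure_lborel_cball_finite[of "0::'a" R] by simp
  finally show "(\<integral>\<^sup>+y. ennreal \<bar>g y\<bar> * indicator (cball 0 R) y \<partial>lborel) < \<infinity>" .
qed simp

lemma locally_L1_abs_le:
  assumes [measurable]: "f \<in> borel_measurable borel" and g: "locally_L1 g" and le: "AE x in lborel. \<bar>f x\<bar> \<le> g x"
  shows "locally_L1 f"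
  unfolding locally_L1_def
proof (intro conjI allI)
  fix R
  have "(\<integral>\<^sup>+y. ennreal \<bar>f y\<bar> * indicator (cball 0 R) y \<partial>lborel) \<le> (\<integral>\<^sup>+y. ennreal \<bar>g y\<bar> * indicator (cball 0 R) y \<partial>lborel)"
    using le by (intro nn_integral_mono_AE) (auto elim!: eventually_mono intro!: mult_right_mono ennreal_leI)
  also have "\<dots> < \<infinity>" using g by (simp add: locally_L1_def)
  finally show "(\<integral>\<^sup>+y. ennreal \<bar>f y\<bar> * indicator (cball 0 R) y \<partial>lborel) < \<infinity>" .
qed simp

lemma locally_L1_diff_half_sum:
  assumes f: "locally_L1 f" and g: "locally_L1 g" and h: "locally_L1 h"
  shows "locally_L1 (\<lambda>x :: 'a::euclidean_space. f x - (g x + h x) / 2)"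
  unfolding locally_L1_def
proof (intro conjI allI)
  have [measurable]: "f \<in> borel_measurable borel" "g \<in> borel_measurable borel" "h \<in> borel_measurable borel"
    using assms by (simp_all add: locally_L1_def)
  show "(\<lambda>x. f x - (g x + h x) / 2) \<in> borel_measurable borel" by measurable
  fix R
  let ?I = "\<lambda>u. \<integral>\<^sup>+y. ennreal \<bar>u y\<bar> * indicator (cball (0::'a) R) y \<partial>lborel"
  have tri: "\<bar>f y - (g y + h y) / 2\<bar> \<le> \<bar>f y\<bar> + (\<bar>g y\<bar> + \<bar>h y\<bar>)" for y
  proof -
    have "\<bar>f y - (g y + h y) / 2\<bar> \<le> \<bar>f y\<bar> + \<bar>g y + h y\<bar> / 2"
      using abs_triangle_ineq4[of "f y" "(g y + h y) / 2"] by simp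
    also have "\<dots> \<le> \<bar>f y\<bar> + (\<bar>g y\<bar> + \<bar>h y\<bar>)"
      using abs_triangle_ineq[of "g y" "h y"] by simp
    finally show ?thesis .
  qed
  have "?I (\<lambda>x. f x - (g x + h x) / 2) \<le>
      (\<integral>\<^sup>+y. ennreal \<bar>f y\<bar> * indicator (cball 0 R) y + (ennreal \<bar>g y\<bar> * indicator (cball 0 R) y + ennreal \<bar>h y\<bar> * indicator (cball 0 R) y) \<partial>lborel)"
    by (intro nn_integral_mono) (auto simp: indicator_def simp flip: ennreal_plus intro!: ennreal_leI tri)
  also have "\<dots> = ?I f + (?I g + ?I h)"
    by (simp add: nn_integral_add)
  also have "\<dots> < \<infinity>" using assms by (simp add: locally_L1_def)
  finally show "?I (\<lambda>x. f x - (g x + h x) / 2) < \<infinity>" .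
qed

lemma locally_L1_nth_mult:
  fixes f :: "real ^ 'n::finite \<Rightarrow> real"
  assumes f: "locally_L1 f"
  shows "locally_L1 (\<lambda>y. y $ j * f y)"
  unfolding locally_L1_def
proof (intro conjI allI)
  have [measurable]: "f \<in> borel_measurable borel" using f by (simp add: locally_L1_def)
  have [measurable]: "(\<lambda>y :: real ^ 'n. y $ j) \<in> borel_measurable borel"
    by (intro borel_measurable_continuous_onI continuous_intros)
  show "(\<lambda>y. y $ j * f y) \<in> borel_measurable borel" by measurable
  fix R
  have "(\<integral>\<^sup>+y. ennreal \<bar>y $ j * f y\<bar> * indicator (cball 0 R) y \<partial>lborel) \<le>
      (\<integral>\<^sup>+y. ennreal \<bar>R\<bar> * (ennreal \<bar>f y\<bar> * indicator (cball 0 R) y) \<partial>lborel)"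
  proof (intro nn_integral_mono)
    fix y :: "real ^ 'n"
    show "ennreal \<bar>y $ j * f y\<bar> * indicator (cball 0 R) y \<le> ennreal \<bar>R\<bar> * (ennreal \<bar>f y\<bar> * indicator (cball 0 R) y)"
    proof (cases "norm y \<le> R")
      case True
      then have "\<bar>y $ j\<bar> \<le> \<bar>R\<bar>" using component_le_norm_cart[of y j] by linarith
      then have "\<bar>y $ j * f y\<bar> \<le> \<bar>R\<bar> * \<bar>f y\<bar>" by (simp add: abs_mult mult_right_mono)
      then show ?thesis using True by (simp add: ennreal_leI flip: ennreal_mult')
    qed simp
  qed
  also have "\<dots> = ennreal \<bar>R\<bar> * (\<integral>\<^sup>+y. ennreal \<bar>f y\<bar> * indicator (cball 0 R) y \<partial>lborel)"
    by (intro nn_integral_cmult) simp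
  also have "\<dots> < \<infinity>" using f by (simp add: locally_L1_def ennreal_mult_less_top)
  finally show "(\<integral>\<^sup>+y. ennreal \<bar>y $ j * f y\<bar> * indicator (cball 0 R) y \<partial>lborel) < \<infinity>" .
qed

text \<open>Testing with \<open>mollifier e (x - y)\<close> turns the distributional identities into
  identities between mollifications. Half the difference of the components \<open>Inr j\<close> and
  \<open>Inl j\<close> is the derivative and stays in mollified form, as
  \<open>hermite_dominated\<close> asks. Half the sum is a multiplication by a coordinate and can be
  brought back to an identity almost everywhere. Here \<open>f\<close> is a Borel representative of
  the given \<open>f0\<close>.\<close>

lemma hermite_gradient_representation:
  fixes f f0 :: "real ^ 'n::finite \<Rightarrow> real" and G :: "real ^ 'n \<Rightarrow> real ^ ('n + 'n)"
  assumes f: "locally_L1 f" and f0: "AE x in lborel. f0 x = f x" and p: "p \<ge> 1"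
    and G: "G \<in> borel_measurable lebesgue"
    and int: "(\<integral>\<^sup>+x. ennreal (norm (G x) powr p) \<partial>lebesgue) < \<infinity>"
    and rep: "\<And>k \<phi>. test_function \<phi> \<Longrightarrow> hermite_gradient f0 k \<phi> = distr_of (\<lambda>x. G x $ k) \<phi>"
  obtains \<Gamma> where "hermite_dominated f \<Gamma>"
    "powr_int p \<Gamma> = (\<integral>\<^sup>+x. ennreal (norm (G x) powr p) \<partial>lebesgue)"
proof -
  have fm[measurable]: "f \<in> borel_measurable borel" using f by (simp add: locally_L1_def)
  have "(\<lambda>x. norm (G x)) \<in> borel_measurable lebesgue" using G by measurable
  then obtain \<Gamma>0 where \<Gamma>0[measurable]: "\<Gamma>0 \<in> borel_measurable lborel" and G\<Gamma>: "AE x in lborel. norm (G x) = \<Gamma>0 x"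
    using completion_ex_borel_measurable_real by blast
  define \<Gamma> where "\<Gamma> x = \<bar>\<Gamma>0 x\<bar>" for x
  have \<Gamma>m[measurable]: "\<Gamma> \<in> borel_measurable borel" unfolding \<Gamma>_def using \<Gamma>0 by measurable
  have G\<Gamma>': "AE x in lborel. norm (G x) = \<Gamma> x" using G\<Gamma> by eventually_elim (metis \<Gamma>_def abs_norm_cancel)
  have eqint: "powr_int p \<Gamma> = (\<integral>\<^sup>+x. ennreal (norm (G x) powr p) \<partial>lebesgue)"
  proof -
    have "powr_int p \<Gamma> = (\<integral>\<^sup>+x. ennreal (norm (G x) powr p) \<partial>lborel)"
      using G\<Gamma>' by (intro nn_integral_cong_AE) (auto elim!: eventually_mono)
    then show ?thesis by (simp add: nn_integral_completion)
  qed
  have \<Gamma>L: "locally_L1 \<Gamma>"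
    using eqint int p by (intro locally_L1_powr[of _ p]) (auto simp: \<Gamma>_def)
  have "\<exists>h. h \<in> borel_measurable lborel \<and> (AE x in lborel. G x $ k = h x)" for k
  proof -
    have "(\<lambda>y :: real ^ ('n + 'n). y $ k) \<in> borel_measurable borel"
      by (intro borel_measurable_continuous_onI continuous_intros)
    from measurable_compose[OF G this] show ?thesis
      using completion_ex_borel_measurable_real by blast
  qed
  then obtain h where h: "\<And>k. h k \<in> borel_measurable lborel" "\<And>k. AE x in lborel. G x $ k = h k x"
    by metis
  have hm[measurable]: "h k \<in> borel_measurable borel" for k using h(1)[of k] by simp
  have h\<Gamma>: "AE x in lborel. \<bar>h k x\<bar> \<le> \<Gamma> x" for k
    using G\<Gamma>' h(2)[of k]
  proof eventually_elim
    case (elim x)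
    then show ?case using component_le_norm_cart[of "G x" k] by simp
  qed
  have hL: "locally_L1 (h k)" for k
    by (rule locally_L1_abs_le[OF hm \<Gamma>L h\<Gamma>])
  have xfL: "locally_L1 (\<lambda>y. y $ j * f y)" for j by (rule locally_L1_nth_mult[OF f])
  have conv_h: "\<bar>conv (h k) (mollifier e) x\<bar> \<le> conv \<Gamma> (mollifier e) x" if "e > 0" for k e x
    using h\<Gamma>[of k] by (intro mollifier_conv_abs_le[OF hL that \<Gamma>L]) (auto elim!: eventually_mono)
  have eqs: "conv (\<lambda>y. y $ j * f y) (mollifier e) x = (conv (h (Inr j)) (mollifier e) x + conv (h (Inl j)) (mollifier e) x) / 2"
    "conv f (mollifier_partial e j) x = (conv (h (Inr j)) (mollifier e) x - conv (h (Inl j)) (mollifier e) x) / 2"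
    if e: "e > 0" for j e x
  proof -
    let ?\<phi> = "\<lambda>y. mollifier e (x - y)"
    have [measurable]: "(mollifier e :: real ^ 'n \<Rightarrow> real) \<in> borel_measurable borel"
      "(\<lambda>z :: real ^ 'n. mollifier_deriv e z (axis j 1)) \<in> borel_measurable borel"
      using mollifier_mass(5)[OF e] mollifier_deriv_props(2)[OF e]
      by (auto intro: borel_measurable_continuous_onI)
    have [measurable]: "(\<lambda>y :: real ^ 'n. y $ j) \<in> borel_measurable borel"
      by (intro borel_measurable_continuous_onI continuous_intros)
    have pd: "partial_deriv j ?\<phi> = (\<lambda>y. - mollifier_deriv e (x - y) (axis j 1))"
      by (rule ext) (rule test_function_mollifier(2)[OF e])
    have T1: "distr_of f0 (partial_deriv j ?\<phi>) = - conv f (mollifier_partial e j) x"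
      unfolding pd by (subst distr_of_cong_AE[OF f0]) (simp_all add: conv_def)
    have T2: "distr_of f0 (\<lambda>y. y $ j * ?\<phi> y) = conv (\<lambda>y. y $ j * f y) (mollifier e) x"
      by (subst distr_of_cong_AE[OF f0]) (simp_all add: conv_def mult_ac)
    have T3: "hermite_gradient f0 k ?\<phi> = conv (h k) (mollifier e) x" for k
      unfolding rep[OF test_function_mollifier(1)[OF e]]
      by (subst distr_of_cong_AE[OF h(2)]) (simp_all add: conv_def)
    have "hermite_gradient f0 (Inr j) ?\<phi> = conv f (mollifier_partial e j) x + conv (\<lambda>y. y $ j * f y) (mollifier e) x"
      by (simp add: hermite_gradient_def A_plus_def distr_partial_def distr_coord_mult_def T1 T2)
    moreover have "hermite_gradient f0 (Inl j) ?\<phi> = - conv f (mollifier_partial e j) x + conv (\<lambda>y. y $ j * f y) (mollifier e) x"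
      by (simp add: hermite_gradient_def A_minus_def distr_partial_def distr_coord_mult_def T1 T2)
    ultimately show "conv (\<lambda>y. y $ j * f y) (mollifier e) x = (conv (h (Inr j)) (mollifier e) x + conv (h (Inl j)) (mollifier e) x) / 2"
      "conv f (mollifier_partial e j) x = (conv (h (Inr j)) (mollifier e) x - conv (h (Inl j)) (mollifier e) x) / 2"
      by (simp_all add: T3)
  qed
  \<comment> \<open>Both sides have equal mollifications at every scale, so their difference
    vanishes almost everywhere; the weight bound can then be read off pointwise.\<close>
  have xf: "AE x in lborel. x $ j * f x = (h (Inr j) x + h (Inl j) x) / 2" for j
  proof -
    let ?k = "\<lambda>x. x $ j * f x - (h (Inr j) x + h (Inl j) x) / 2"
    have "AE x in lborel. ?k x = 0"
    proof (rule AE_zero_if_mollified_zero)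
      show "locally_L1 ?k" by (rule locally_L1_diff_half_sum[OF xfL hL hL])
      fix x :: "real ^ 'n" and e :: real assume e: "e > 0"
      note ci = conv_integrable[OF _ mollifier_props(3,2)[OF e], where x = x]
      have "conv ?k (mollifier e) x = (LINT y|lborel. y $ j * f y * mollifier e (x - y) -
          (h (Inr j) y * mollifier e (x - y) + h (Inl j) y * mollifier e (x - y)) / 2)"
        unfolding conv_def by (intro Bochner_Integration.integral_cong) (auto simp: algebra_simps add_divide_distrib)
      also have "\<dots> = conv (\<lambda>y. y $ j * f y) (mollifier e) x - (conv (h (Inr j)) (mollifier e) x + conv (h (Inl j)) (mollifier e) x) / 2"
        using ci[OF xfL[of j]] ci[OF hL[of "Inr j"]] ci[OF hL[of "Inl j"]]
        unfolding conv_def by simp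
      also have "\<dots> = 0" using eqs(1)[OF e] by simp
      finally show "conv ?k (mollifier e) x = 0" .
    qed
    then show ?thesis by eventually_elim simp
  qed
  show thesis
  proof (rule that[OF _ eqint], unfold hermite_dominated_def, intro conjI allI impI f \<Gamma>L)
    show "\<Gamma> x \<ge> 0" for x by (simp add: \<Gamma>_def)
    have "AE x in lborel. \<bar>x $ j * f x\<bar> \<le> \<Gamma> x" for j
      using xf[of j] h\<Gamma>[of "Inr j"] h\<Gamma>[of "Inl j"] by eventually_elim simp
    then have "AE x in lborel. \<forall>j\<in>UNIV. \<bar>x $ j * f x\<bar> \<le> \<Gamma> x"
      by (intro AE_finite_allI) auto
    then show "AE x in lborel. norm x * \<bar>f x\<bar> \<le> real CARD('n) * \<Gamma> x"
    proof eventually_elim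
      case (elim x)
      have "norm x * \<bar>f x\<bar> \<le> (\<Sum>j\<in>UNIV. \<bar>x $ j\<bar>) * \<bar>f x\<bar>"
        by (intro mult_right_mono norm_le_l1_cart) simp
      also have "\<dots> = (\<Sum>j\<in>UNIV. \<bar>x $ j * f x\<bar>)" by (simp add: sum_distrib_right abs_mult)
      also have "\<dots> \<le> (\<Sum>j\<in>(UNIV :: 'n set). \<Gamma> x)" using elim by (intro sum_mono) simp
      finally show ?case by simp
    qed
    show "\<bar>conv f (mollifier_partial e j) x\<bar> \<le> conv \<Gamma> (mollifier e) x" if e: "e > 0" for e j x
      using conv_h[OF e, of "Inr j" x] conv_h[OF e, of "Inl j" x] eqs(2)[OF e, of j x] by simp
  qed
qed

section \<open>Passage to norms and the final assembly\<close>

text \<open>The integral estimates require \<open>N > 0\<close>, while the norm \<open>N0\<close> of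
  the gradient may be 0. So the bound is assumed for all larger \<open>N\<close>, and
  \<open>N\<close> then decreases to \<open>N0\<close>.\<close>

lemma Lp_norm_le:
  fixes f :: "'a::euclidean_space \<Rightarrow> 'b::real_normed_vector"
  assumes q: "q > 0" and C: "C > 0" and N0: "N0 \<ge> 0"
    and le: "\<And>N. N > N0 \<Longrightarrow> (\<integral>\<^sup>+x. ennreal (norm (f x) powr q) \<partial>lebesgue) \<le> ennreal (C * N powr q)"
  shows "Lp_norm q f \<le> ennreal (C powr (1 / q)) * ennreal N0"
proof -
  let ?I = "\<integral>\<^sup>+x. ennreal (norm (f x) powr q) \<partial>lebesgue"
  obtain i where i: "?I = ennreal i" "i \<ge> 0"
    using le[of "N0 + 1"] by (cases ?I) (auto simp: top_unique)
  have bound: "i powr (1 / q) \<le> C powr (1 / q) * N" if N: "N > N0" for N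
  proof -
    have "i \<le> C * N powr q" using le[OF N] i C by (subst (asm) i, subst (asm) ennreal_le_iff) auto
    then have "i powr (1 / q) \<le> (C * N powr q) powr (1 / q)"
      using q i by (intro powr_mono2) auto
    also have "\<dots> = C powr (1 / q) * N"
      using q N N0 by (simp add: powr_mult powr_powr)
    finally show ?thesis .
  qed
  have "i powr (1 / q) \<le> C powr (1 / q) * N0"
  proof (rule field_le_epsilon)
    fix e :: real assume e: "e > 0"
    have "i powr (1 / q) \<le> C powr (1 / q) * (N0 + e / C powr (1 / q))"
      using e C by (intro bound) simp
    then show "i powr (1 / q) \<le> C powr (1 / q) * N0 + e" using C by (simp add: distrib_left)
  qed
  then show ?thesis
    using i N0 by (simp add: Lp_norm_def ennreal_leI flip: ennreal_mult')
qed

theorem theorem9: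
  fixes p q :: real
  assumes "CARD('n::finite) > 1"
    and "1 < p" and "1 < q"
    and "1 / p - 1 / real CARD('n) \<le> 1 / q"
    and "1 / q < 1 / p + 1 / real CARD('n)"
  shows "\<exists>C::real. C > 0 \<and>
    (\<forall>f \<in> (hermite_sobolev p :: (real ^ 'n \<Rightarrow> real) set).
       Lp_norm q f \<le> ennreal C * distr_Lp_norm p (hermite_gradient f))"
proof -
  let ?d = "real CARD('n)"
  have d: "?d > 0" by simp
  obtain C where C: "C > 0" and bound: "\<And>(f :: real ^ 'n \<Rightarrow> real) \<Gamma> N. hermite_dominated f \<Gamma> \<Longrightarrow> N > 0 \<Longrightarrow>
      powr_int p \<Gamma> \<le> ennreal (N powr p) \<Longrightarrow>
      abs_powr_int q f \<le> ennreal (C * N powr q)"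
  \<comment> \<open>Cleared of denominators, the lower condition on \<open>1 / q\<close> is what
    \<open>weighted_sobolev\<close> needs for \<open>p <= q\<close>, and the upper one is what
    \<open>weighted_sobolev_low\<close> needs for \<open>q < p\<close>.\<close>
  proof (cases "p \<le> q")
    case True
    have "?d * (q - p) \<le> p * q"
      using assms(2,3,4) d by (simp add: field_simps)
    from weighted_sobolev[OF less_imp_le[OF assms(2)] True this] that show thesis by blast
  next
    case False
    then have "q < p" by simp
    moreover have "?d < p * q / (p - q)"
      using assms(2,3,5) d False by (simp add: field_simps)
    ultimately show thesis
      using weighted_sobolev_low[OF less_imp_le[OF assms(2)] less_imp_le[OF assms(3)]] that by blast
  qed
  define K where "K = C powr (1 / q)"
  have K: "K > 0" using C by (simp add: K_def)
  show ?thesis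
  proof (intro exI[of _ K] conjI ballI K)
    fix f0 :: "real ^ 'n \<Rightarrow> real"
    assume "f0 \<in> hermite_sobolev p"
    then obtain g where g: "g \<in> Lp p" and f0: "AE x in lebesgue. f0 x = hermite_neg_power (1 / 2) g x"
      by (auto simp: hermite_sobolev_def)
    define f where "f = hermite_neg_power (1 / 2) g"
    have gint: "(\<integral>\<^sup>+x. ennreal (norm (g x) powr p) \<partial>lebesgue) < \<infinity>"
      using g by (auto simp: Lp_def Lp_norm_def Let_def less_top split: if_splits)
    have f: "locally_L1 f"
      unfolding f_def using g gint assms(2)
      by (intro hermite_neg_power_locally_L1[of _ p]) (auto simp: Lp_def)
    have f0: "AE x in lborel. f0 x = f x"
      using f0 by (simp add: AE_completion_iff f_def)
    have "Lp_norm q f0 \<le> ennreal K * Lp_norm p G"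
      if G: "G \<in> Lp p" and rep: "\<And>k \<phi>. test_function \<phi> \<Longrightarrow> hermite_gradient f0 k \<phi> = distr_of (\<lambda>x. G x $ k) \<phi>"
      for G :: "real ^ 'n \<Rightarrow> real ^ ('n + 'n)"
    proof -
      have Gint: "(\<integral>\<^sup>+x. ennreal (norm (G x) powr p) \<partial>lebesgue) < \<infinity>"
        using G by (auto simp: Lp_def Lp_norm_def Let_def less_top split: if_splits)
      then obtain i where i: "(\<integral>\<^sup>+x. ennreal (norm (G x) powr p) \<partial>lebesgue) = ennreal i" "i \<ge> 0"
        by (cases "\<integral>\<^sup>+x. ennreal (norm (G x) powr p) \<partial>lebesgue") auto
      obtain \<Gamma> where \<Gamma>: "hermite_dominated f \<Gamma>"
        "powr_int p \<Gamma> = (\<integral>\<^sup>+x. ennreal (norm (G x) powr p) \<partial>lebesgue)"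
        using hermite_gradient_representation[OF f f0 _ _ Gint rep] assms(2) G by (auto simp: Lp_def)
      have "Lp_norm q f0 \<le> ennreal (C powr (1 / q)) * ennreal (i powr (1 / p))"
      proof (rule Lp_norm_le)
        fix N assume N: "N > i powr (1 / p)"
        then have N0: "N > 0" by (meson le_less_trans powr_ge_zero)
        have "i = (i powr (1 / p)) powr p" using i assms(2) by (simp add: powr_powr)
        also have "\<dots> \<le> N powr p" using N assms(2) by (intro powr_mono2) auto
        finally have "powr_int p \<Gamma> \<le> ennreal (N powr p)"
          by (simp add: \<Gamma>(2) i(1) ennreal_leI)
        from bound[OF \<Gamma>(1) N0 this]
        have "abs_powr_int q f \<le> ennreal (C * N powr q)" .
        moreover have "(\<integral>\<^sup>+x. ennreal (norm (f0 x) powr q) \<partial>lebesgue) = abs_powr_int q f"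
          unfolding nn_integral_completion using f0
          by (intro nn_integral_cong_AE) (auto elim!: eventually_mono)
        ultimately show "(\<integral>\<^sup>+x. ennreal (norm (f0 x) powr q) \<partial>lebesgue) \<le> ennreal (C * N powr q)" by simp
      qed (use assms C in auto)
      also have "ennreal (i powr (1 / p)) = Lp_norm p G"
        using i by (simp add: Lp_norm_def)
      finally show ?thesis by (simp add: K_def)
    qed
    note single = this
    \<comment> \<open>The constant is moved to the left so that this becomes a lower bound common to
      all representing \<open>G\<close>, hence for their infimum. If there is no such
      \<open>G\<close>, the infimum is infinite and the bound is vacuous.\<close>
    have "ennreal (1 / K) * Lp_norm q f0 \<le> distr_Lp_norm p (hermite_gradient f0)"
      unfolding distr_Lp_norm_def
    proof (intro INF_greatest)
      fix G :: "real ^ 'n \<Rightarrow> real ^ ('n + 'n)"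
      assume "G \<in> {G. G \<in> Lp p \<and> (\<forall>k \<phi>. test_function \<phi> \<longrightarrow> hermite_gradient f0 k \<phi> = distr_of (\<lambda>x. G x $ k) \<phi>)}"
      then have "ennreal (1 / K) * Lp_norm q f0 \<le> ennreal (1 / K) * (ennreal K * Lp_norm p G)"
        by (intro mult_left_mono single) auto
      also have "\<dots> = Lp_norm p G"
        using K by (simp flip: ennreal_mult' mult.assoc)
      finally show "ennreal (1 / K) * Lp_norm q f0 \<le> Lp_norm p G" .
    qed
    then have "ennreal K * (ennreal (1 / K) * Lp_norm q f0) \<le> ennreal K * distr_Lp_norm p (hermite_gradient f0)"
      by (intro mult_left_mono) auto
    moreover have "ennreal K * (ennreal (1 / K) * Lp_norm q f0) = Lp_norm q f0"
      using K by (simp flip: ennreal_mult' mult.assoc)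
    ultimately show "Lp_norm q f0 \<le> ennreal K * distr_Lp_norm p (hermite_gradient f0)" by simp
  qed
qed

end
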